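(* Let $\lambda,\sigma_\mu,\sigma_S>0$, $\tau>0$, $m>0$ and $x>0$, and let $S$, $\mu$, $\tilde\mu$ and $P$ be the price, trend, exponential moving average and portfolio processes defined in the context. Then $$d\ln(P_t)=\frac{m\tau}{2\sigma_S^2}\,d\left(\tilde\mu_t^2\right)+m\left(\frac{\tilde\mu_t^2}{\sigma_S^2}\left(1-\frac m2\right)-\frac1{2\tau}\right)dt.$$
   Context: Market model: $(W^S,W^\mu)$ is a two-dimensional Wiener process with independent components. The risky asset price $S$ (with $S_0>0$ a constant) and its trend $\mu$ satisfy $$\frac{dS_t}{S_t}=\mu_t\,dt+\sigma_S\,dW^S_t,\qquad d\mu_t=-\lambda\mu_t\,dt+\sigma_\mu\,dW^\mu_t,\qquad \mu_0=0,$$ with constants $\lambda,\sigma_\mu,\sigma_S>0$. Strategy: for a duration $\tau>0$, the exponential moving average of returns $\tilde\mu$ is given by $$d\tilde\mu_t=-\frac1\tau\tilde\mu_t\,dt+\frac1\tau\frac{dS_t}{S_t},\qquad \tilde\mu_0=0.$$ For $m>0$, the portfolio value $P$ is given by $$\frac{dP_t}{P_t}=m\frac{\tilde\mu_t}{\sigma_S^2}\frac{dS_t}{S_t},\qquad P_0=x>0.$$ *)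

theory Defs
  imports "HOL-Probability.Probability"
begin

text \<open>
  Continuous-time processes are functions \<open>real \<Rightarrow> 'w \<Rightarrow> real\<close> of which only the times \<open>t \<ge> 0\<close>
  matter.  The library locale \<open>filtration\<close> indexes by the whole type \<open>real\<close>; a filtration on
  \<open>[0,\<infinity>)\<close> is extended by \<open>F t = F 0\<close> for \<open>t < 0\<close>.  The usual conditions are not required, which is
  why path continuity is an almost sure property here.
\<close>

locale filtered_prob_space = prob_space M + filtration "space M" F
  for M :: "'w measure" and F :: "real \<Rightarrow> 'w measure" +
  assumes sets_F_subset: "sets (F t) \<subseteq> sets M"

definition continuous_adapted ::
    "'w measure \<Rightarrow> (real \<Rightarrow> 'w measure) \<Rightarrow> (real \<Rightarrow> 'w \<Rightarrow> real) \<Rightarrow> bool" where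
  "continuous_adapted M F X \<longleftrightarrow>
     (\<forall>t\<ge>0. X t \<in> borel_measurable (F t)) \<and>
     (AE \<omega> in M. continuous_on {0..} (\<lambda>t. X t \<omega>))"

text \<open>
  A two-dimensional Wiener process relative to \<open>F\<close>: the increment over \<open>[s,t]\<close> is a pair of
  independent centred Gaussians of variance \<open>t - s\<close>, and the pair is independent of \<open>F s\<close>.
  In particular the two coordinate processes are independent.
\<close>

definition wiener_process_2 ::
    "'w measure \<Rightarrow> (real \<Rightarrow> 'w measure) \<Rightarrow> (real \<Rightarrow> 'w \<Rightarrow> real) \<Rightarrow> (real \<Rightarrow> 'w \<Rightarrow> real) \<Rightarrow> bool" where
  "wiener_process_2 M F W1 W2 \<longleftrightarrow>
     continuous_adapted M F W1 \<and> continuous_adapted M F W2 \<and>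
     (AE \<omega> in M. W1 0 \<omega> = 0 \<and> W2 0 \<omega> = 0) \<and>
     (\<forall>s t. 0 \<le> s \<and> s < t \<longrightarrow>
        distributed M lborel (\<lambda>\<omega>. W1 t \<omega> - W1 s \<omega>) (normal_density 0 (sqrt (t - s))) \<and>
        distributed M lborel (\<lambda>\<omega>. W2 t \<omega> - W2 s \<omega>) (normal_density 0 (sqrt (t - s))) \<and>
        prob_space.indep_var M
          borel (\<lambda>\<omega>. W1 t \<omega> - W1 s \<omega>) borel (\<lambda>\<omega>. W2 t \<omega> - W2 s \<omega>) \<and>
        prob_space.indep_set M (sets (F s))
          (sets (vimage_algebra (space M)
             (\<lambda>\<omega>. (W1 t \<omega> - W1 s \<omega>, W2 t \<omega> - W2 s \<omega>)) (borel :: (real \<times> real) measure))))"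

text \<open>
  Simple predictable processes
  \<open>\<xi>\<^sub>0 1\<^bsub>{0}\<^esub> + (\<Sum>i<k. \<xi>\<^sub>i 1\<^bsub>(t\<^sub>i, t\<^sub>i\<^sub>+\<^sub>1]\<^esub>)\<close> with \<open>0 = t\<^sub>0 < \<dots> < t\<^sub>k\<close> and bounded
  \<open>F t\<^sub>i\<close>-measurable \<open>\<xi>\<^sub>i\<close>, and their elementary integral
  \<open>\<Sum>i<k. \<xi>\<^sub>i (X\<^bsub>s \<and> t\<^sub>i\<^sub>+\<^sub>1\<^esub> - X\<^bsub>s \<and> t\<^sub>i\<^esub>)\<close> up to time \<open>s\<close>.
\<close>

definition simple_coeffs ::
    "'w measure \<Rightarrow> (real \<Rightarrow> 'w measure) \<Rightarrow> nat \<Rightarrow> (nat \<Rightarrow> real) \<Rightarrow> (nat \<Rightarrow> 'w \<Rightarrow> real) \<Rightarrow> bool" where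
  "simple_coeffs M F k t \<xi> \<longleftrightarrow>
     t 0 = 0 \<and> (\<forall>i<k. t i < t (Suc i)) \<and>
     (\<forall>i\<le>k. \<xi> i \<in> borel_measurable (F (t i)) \<and> bounded (\<xi> i ` space M))"

definition simple_process ::
    "nat \<Rightarrow> (nat \<Rightarrow> real) \<Rightarrow> (nat \<Rightarrow> 'w \<Rightarrow> real) \<Rightarrow> real \<Rightarrow> 'w \<Rightarrow> real" where
  "simple_process k t \<xi> s \<omega> =
     \<xi> 0 \<omega> * indicator {0} s + (\<Sum>i<k. \<xi> i \<omega> * indicator {t i<..t (Suc i)} s)"

definition simple_integral ::
    "nat \<Rightarrow> (nat \<Rightarrow> real) \<Rightarrow> (nat \<Rightarrow> 'w \<Rightarrow> real) \<Rightarrow> (real \<Rightarrow> 'w \<Rightarrow> real) \<Rightarrow> real \<Rightarrow> 'w \<Rightarrow> real" where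
  "simple_integral k t \<xi> X s \<omega> =
     (\<Sum>i<k. \<xi> i \<omega> * (X (min s (t (Suc i))) \<omega> - X (min s (t i)) \<omega>))"

text \<open>
  Uniform convergence on compact time intervals in probability.  The exceptional set
  \<open>{\<omega>. \<exists>t\<in>{0..T}. \<bar>X\<^sub>n t \<omega> - X t \<omega>\<bar> > \<epsilon>}\<close> need not be measurable (\<open>measure\<close> would then be \<open>0\<close>),
  so its outer measure is what is required to tend to \<open>0\<close>.
\<close>

definition ucp_tendsto ::
    "'w measure \<Rightarrow> (nat \<Rightarrow> real \<Rightarrow> 'w \<Rightarrow> real) \<Rightarrow> (real \<Rightarrow> 'w \<Rightarrow> real) \<Rightarrow> bool" where
  "ucp_tendsto M Xs X \<longleftrightarrow>
     (\<forall>T\<ge>0. \<forall>\<epsilon>>0. \<forall>\<delta>>0. \<forall>\<^sub>F n in sequentially.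
        \<exists>A\<in>sets M. measure M A < \<delta> \<and>
          {\<omega>\<in>space M. \<exists>t\<in>{0..T}. \<bar>Xs n t \<omega> - X t \<omega>\<bar> > \<epsilon>} \<subseteq> A)"

text \<open>
  \<open>J = \<integral>\<^sub>0 H dX\<close> for continuous adapted \<open>H\<close> and a continuous semimartingale \<open>X\<close>: the extension of the
  elementary integral by continuity with respect to ucp convergence.  For a semimartingale \<open>X\<close> the
  limit does not depend on the approximating sequence (up to indistinguishability); for a Wiener
  process \<open>X\<close> it is the Ito integral.
\<close>

definition has_stoch_integral ::
    "'w measure \<Rightarrow> (real \<Rightarrow> 'w measure) \<Rightarrow> (real \<Rightarrow> 'w \<Rightarrow> real) \<Rightarrow> (real \<Rightarrow> 'w \<Rightarrow> real) \<Rightarrow>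
      (real \<Rightarrow> 'w \<Rightarrow> real) \<Rightarrow> bool" where
  "has_stoch_integral M F H X J \<longleftrightarrow>
     continuous_adapted M F H \<and> continuous_adapted M F X \<and>
     (\<exists>k t \<xi>. (\<forall>n. simple_coeffs M F (k n) (t n) (\<xi> n)) \<and>
        ucp_tendsto M (\<lambda>n. simple_process (k n) (t n) (\<xi> n)) H \<and>
        ucp_tendsto M (\<lambda>n. simple_integral (k n) (t n) (\<xi> n) X) J)"

text \<open>\<open>dS\<^sub>t / S\<^sub>t = \<mu>\<^sub>t dt + \<sigma> dW\<^sub>t\<close>, i.e. \<open>dS\<^sub>t = S\<^sub>t \<mu>\<^sub>t dt + \<sigma> S\<^sub>t dW\<^sub>t\<close>, with \<open>S\<^sub>0 = S0\<close>.\<close>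

definition price_process ::
    "'w measure \<Rightarrow> (real \<Rightarrow> 'w measure) \<Rightarrow> (real \<Rightarrow> 'w \<Rightarrow> real) \<Rightarrow> real \<Rightarrow> real \<Rightarrow>
      (real \<Rightarrow> 'w \<Rightarrow> real) \<Rightarrow> (real \<Rightarrow> 'w \<Rightarrow> real) \<Rightarrow> bool" where
  "price_process M F W \<sigma> S0 \<mu> S \<longleftrightarrow>
     continuous_adapted M F S \<and>
     (\<exists>J. has_stoch_integral M F S W J \<and>
        (AE \<omega> in M. \<forall>t\<ge>0. S t \<omega> = S0 + (LBINT u:{0..t}. S u \<omega> * \<mu> u \<omega>) + \<sigma> * J t \<omega>))"

text \<open>\<open>d\<mu>\<^sub>t = - \<lambda> \<mu>\<^sub>t dt + \<sigma> dW\<^sub>t\<close>, \<open>\<mu>\<^sub>0 = 0\<close>.\<close>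

definition trend_process ::
    "'w measure \<Rightarrow> (real \<Rightarrow> 'w measure) \<Rightarrow> (real \<Rightarrow> 'w \<Rightarrow> real) \<Rightarrow> real \<Rightarrow> real \<Rightarrow>
      (real \<Rightarrow> 'w \<Rightarrow> real) \<Rightarrow> bool" where
  "trend_process M F W lam \<sigma> \<mu> \<longleftrightarrow>
     continuous_adapted M F \<mu> \<and>
     (AE \<omega> in M. \<forall>t\<ge>0. \<mu> t \<omega> = - lam * (LBINT u:{0..t}. \<mu> u \<omega>) + \<sigma> * W t \<omega>)"

text \<open>\<open>dm\<^sub>t = - (1/\<tau>) m\<^sub>t dt + (1/\<tau>) dS\<^sub>t / S\<^sub>t\<close>, \<open>m\<^sub>0 = 0\<close>.\<close>

definition ema_process ::
    "'w measure \<Rightarrow> (real \<Rightarrow> 'w measure) \<Rightarrow> real \<Rightarrow> (real \<Rightarrow> 'w \<Rightarrow> real) \<Rightarrow>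
      (real \<Rightarrow> 'w \<Rightarrow> real) \<Rightarrow> bool" where
  "ema_process M F \<tau> S mt \<longleftrightarrow>
     continuous_adapted M F mt \<and>
     (\<exists>R. has_stoch_integral M F (\<lambda>t \<omega>. 1 / S t \<omega>) S R \<and>
        (AE \<omega> in M. \<forall>t\<ge>0.
           mt t \<omega> = - (1 / \<tau>) * (LBINT u:{0..t}. mt u \<omega>) + (1 / \<tau>) * R t \<omega>))"

text \<open>\<open>dP\<^sub>t / P\<^sub>t = m (mt\<^sub>t / \<sigma>\<^sup>2) dS\<^sub>t / S\<^sub>t\<close>, i.e. \<open>dP\<^sub>t = P\<^sub>t m (mt\<^sub>t / \<sigma>\<^sup>2) (1 / S\<^sub>t) dS\<^sub>t\<close>, with \<open>P\<^sub>0 = x\<close>.\<close>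

definition portfolio_process ::
    "'w measure \<Rightarrow> (real \<Rightarrow> 'w measure) \<Rightarrow> real \<Rightarrow> real \<Rightarrow> real \<Rightarrow> (real \<Rightarrow> 'w \<Rightarrow> real) \<Rightarrow>
      (real \<Rightarrow> 'w \<Rightarrow> real) \<Rightarrow> (real \<Rightarrow> 'w \<Rightarrow> real) \<Rightarrow> bool" where
  "portfolio_process M F m \<sigma> x S mt P \<longleftrightarrow>
     continuous_adapted M F P \<and>
     (\<exists>J. has_stoch_integral M F (\<lambda>t \<omega>. P t \<omega> * (m * (mt t \<omega> / \<sigma>\<^sup>2)) * (1 / S t \<omega>)) S J \<and>
        (AE \<omega> in M. \<forall>t\<ge>0. P t \<omega> = x + J t \<omega>))"

end

(*
  The only probabilistic estimate needed is the L2 orthogonality of martingale differences at a fixed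
  time; maximal inequalities are avoided because all processes have continuous paths.

  A stochastic integral against S is approximated by simple integrals, and S itself is an integral
  against W.  On a common refinement of the two partitions the integral of H against S becomes an
  Euler sum of zeta_j (mu_j dt_j + sigma dW_j) with zeta close to H S.  For H = 1/S, zeta is close to
  1, which gives R_t = int_0^t mu du + sigma W_t for the integrated returns R.

  For the portfolio put L_t = m tau / (2 sigma^2) mt_t^2 + int_0^t b du, where b is the claimed drift.
  A second order expansion shows that the increments of the Euler approximation of P exp(-L) reduce to
  weighted sums of dW_j^2 - dt_j and of e_j dW_j with e uniformly small, both of which vanish in the
  limit.  Hence P exp(-L) is the constant x, which yields the positivity of P as well.
*)

theory Submission
  imports Defs "HOL-Library.Landau_Symbols"
begin

section \<open>Partitions of an interval\<close>

text \<open>The hypothesis that an integral exists supplies one approximating sequence of simple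
  processes and nothing more: neither an Ito formula nor a quadratic variation nor a moment of the
  integrands. Hence the Ito formula is proved for the Euler sums themselves. The drift b comes from
  a formal computation. With c = m / \<sigma>^2 and dR = \<mu> dt + \<sigma> dW one expects d ln P =
  c mt dR - (c^2 \<sigma>^2 mt^2 / 2) dt, while \<tau> mt dmt = mt dR - mt^2 dt and d(mt^2) = 2 mt
  dmt + (\<sigma>^2 / \<tau>^2) dt. Eliminating mt dR leaves a d(mt^2) + b dt with a = c \<tau> / 2.
  The logarithm is not expanded directly, because P is not known to be positive. Errors are of two
  kinds. Those small against dW^2 + dt are summed path by path with Landau symbols. Those
  proportional to dW or dW^2 - dt are not absolutely negligible and need the martingale estimate,
  which yields almost sure convergence along a subsequence only. This suffices, since the whole
  sequence of Euler sums already converges to the process to be identified.\<close>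

definition grid :: "real \<Rightarrow> real \<Rightarrow> nat \<Rightarrow> (nat \<Rightarrow> real) \<Rightarrow> bool" where
  "grid T \<epsilon> N q \<longleftrightarrow>
     q 0 = 0 \<and> q N = T \<and> (\<forall>i<N. q i < q (Suc i) \<and> q (Suc i) - q i \<le> \<epsilon>)"

lemma grid_mono:
  assumes "grid T \<epsilon> N q" "i \<le> j" "j \<le> N"
  shows "q i \<le> q j"
  using assms(2,3)
proof (induction j rule: dec_induct)
  case (step j)
  then show ?case using assms(1) unfolding grid_def by (force simp: Suc_le_eq)
qed simp

lemma grid_bounds:
  assumes "grid T \<epsilon> N q" "i \<le> N"
  shows "0 \<le> q i" "q i \<le> T"
  using grid_mono[OF assms(1), of 0 i] grid_mono[OF assms(1), of i N] assms
  by (auto simp: grid_def)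

lemma grid_step:
  assumes "grid T \<epsilon> N q" "i < N"
  shows "q i < q (Suc i)" "q (Suc i) - q i \<le> \<epsilon>"
  using assms by (auto simp: grid_def)

lemma grid_telescope:
  assumes "grid T \<epsilon> N q"
  shows "(\<Sum>i<N. q (Suc i) - q i) = T"
  using assms by (simp add: sum_lessThan_telescope grid_def)

text \<open>The partition consists of the multiples of \<open>\<epsilon> / 2\<close>, the points of
  \<open>Q\<close> and both endpoints, in sorted order. \<open>Q\<close> will hold the jump times of
  simple processes, which must not fall inside a cell.\<close>

lemma grid_exists:
  assumes "T > 0" "\<epsilon> > 0" "finite (Q :: real set)"
  shows "\<exists>N q. grid T \<epsilon> N q \<and> (\<forall>i<N. Q \<inter> {q i<..<q (Suc i)} = {})"
proof -
  define U where "U = (\<lambda>k::nat. real k * (\<epsilon> / 2)) ` {k. real k * (\<epsilon> / 2) \<le> T}"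
  have "{k. real k * (\<epsilon> / 2) \<le> T} \<subseteq> {..nat \<lceil>T / (\<epsilon> / 2)\<rceil>}"
  proof
    fix k assume "k \<in> {k. real k * (\<epsilon> / 2) \<le> T}"
    then have "real k \<le> T / (\<epsilon> / 2)" using assms by (simp add: field_simps)
    then show "k \<in> {..nat \<lceil>T / (\<epsilon> / 2)\<rceil>}" by (simp add: le_nat_iff) linarith
  qed
  then have "finite U" unfolding U_def using finite_subset by blast
  define A where "A = {0, T} \<union> U \<union> (Q \<inter> {0..T})"
  have fA: "finite A" using \<open>finite U\<close> assms by (auto simp: A_def)
  have subA: "A \<subseteq> {0..T}" using assms by (auto simp: A_def U_def)
  define xs where "xs = sorted_list_of_set A"
  define N where "N = length xs - 1"
  have setxs: "set xs = A" and sxs: "sorted_wrt (<) xs"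
    using fA by (auto simp: xs_def)
  have "xs \<noteq> []" using setxs by (auto simp: A_def)
  then have len: "length xs = Suc N" by (simp add: N_def)
  have less: "xs ! i < xs ! j \<longleftrightarrow> i < j" if "i \<le> N" "j \<le> N" for i j
    using sorted_wrt_nth_less[OF sxs, of i j] sorted_wrt_nth_less[OF sxs, of j i] that len
    by (metis less_Suc_eq_le less_asym linorder_neqE_nat)
  have gap: "A \<inter> {xs ! i<..<xs ! Suc i} = {}" if "i < N" for i
  proof -
    { fix y assume y: "y \<in> A" "xs ! i < y" "y < xs ! Suc i"
      then obtain k where k: "k \<le> N" "y = xs ! k"
        using setxs len by (metis in_set_conv_nth less_Suc_eq_le)
      then have "i < k" "k < Suc i" using y less that by auto
      then have False by simp }
    then show ?thesis by auto
  qed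
  have in_A: "xs ! i \<in> A" if "i \<le> N" for i
    using that len setxs by (metis less_Suc_eq_le nth_mem)
  have first: "xs ! 0 = 0"
  proof -
    obtain k where k: "k \<le> N" "0 = xs ! k"
      using setxs len by (metis A_def UnI1 in_set_conv_nth insertI1 less_Suc_eq_le)
    show ?thesis using less[of 0 k] k in_A[of 0] subA by (cases "k = 0") force+
  qed
  have last: "xs ! N = T"
  proof -
    have "T \<in> set xs" using setxs by (simp add: A_def)
    then obtain k where k: "k \<le> N" "T = xs ! k"
      using len by (metis in_set_conv_nth less_Suc_eq_le)
    show ?thesis using less[of k N] k in_A[of N] subA by (cases "k = N") force+
  qed
  have mesh: "xs ! Suc i - xs ! i \<le> \<epsilon>" if "i < N" for i
  proof (rule ccontr)
    assume big: "\<not> ?thesis"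
    \<comment> \<open>The first multiple of \<open>\<epsilon> / 2\<close> beyond
      \<open>xs ! i\<close>. It lies at most \<open>\<epsilon> / 2\<close> further, hence strictly
      inside a cell longer than \<open>\<epsilon>\<close>.\<close>
    define k where "k = nat \<lfloor>xs ! i / (\<epsilon> / 2)\<rfloor> + 1"
    have nn: "xs ! i / (\<epsilon> / 2) \<ge> 0" using in_A[of i] subA that assms by force
    have "xs ! i / (\<epsilon> / 2) < real k" "real k \<le> xs ! i / (\<epsilon> / 2) + 1"
      using nn unfolding k_def by linarith+
    then have k: "xs ! i < real k * (\<epsilon> / 2)" "real k * (\<epsilon> / 2) \<le> xs ! i + \<epsilon> / 2"
      using assms by (simp_all add: field_simps)
    then have lt: "real k * (\<epsilon> / 2) < xs ! Suc i" using big assms by linarith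
    then have "real k * (\<epsilon> / 2) \<le> T" using in_A[of "Suc i"] subA that by force
    then have "real k * (\<epsilon> / 2) \<in> A" unfolding A_def U_def by blast
    then show False using gap[OF that] k lt by auto
  qed
  have "grid T \<epsilon> N (\<lambda>i. xs ! i)"
    unfolding grid_def using first last mesh less by (simp add: less)
  moreover have "Q \<inter> {xs ! i<..<xs ! Suc i} = {}" if "i < N" for i
  proof -
    have "{xs ! i<..<xs ! Suc i} \<subseteq> {0..T}"
      using in_A[of i] in_A[of "Suc i"] subA that by force
    then show ?thesis using gap[OF that] by (auto simp: A_def)
  qed
  ultimately show ?thesis by blast
qed

section \<open>Uniform asymptotics over the cells of a sequence of partitions\<close>

text \<open>
  \<open>cells N\<close> is the filter of pairs \<open>(n, i)\<close> with \<open>i < N n\<close> and \<open>n \<rightarrow> \<infinity>\<close>: a limit along it is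
  a limit in \<open>n\<close> uniform in \<open>i\<close>.
\<close>

definition cells :: "(nat \<Rightarrow> nat) \<Rightarrow> (nat \<times> nat) filter" where
  "cells N = inf (filtercomap fst sequentially) (principal {(n, i). i < N n})"

lemma eventually_cells:
  "eventually P (cells N) \<longleftrightarrow> (\<forall>\<^sub>F n in sequentially. \<forall>i<N n. P (n, i))"
proof
  assume "eventually P (cells N)"
  then obtain Q where Q: "eventually Q sequentially" "\<And>n i. Q n \<Longrightarrow> i < N n \<Longrightarrow> P (n, i)"
    by (auto simp: cells_def eventually_inf_principal eventually_filtercomap)
  show "\<forall>\<^sub>F n in sequentially. \<forall>i<N n. P (n, i)"
    using Q(1) by (rule eventually_mono) (use Q(2) in blast)
next
  assume "\<forall>\<^sub>F n in sequentially. \<forall>i<N n. P (n, i)"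
  then show "eventually P (cells N)"
    by (auto simp: cells_def eventually_inf_principal eventually_filtercomap)
qed

lemma tendsto_cells_iff:
  fixes f :: "nat \<times> nat \<Rightarrow> real"
  shows "(f \<longlongrightarrow> 0) (cells N) \<longleftrightarrow>
    (\<forall>\<epsilon>>0. \<forall>\<^sub>F n in sequentially. \<forall>i<N n. \<bar>f (n, i)\<bar> < \<epsilon>)"
  by (simp add: tendsto_iff eventually_cells)

lemma filterlim_cells_subseq:
  assumes "strict_mono r"
  shows "filterlim (\<lambda>(n, i). (r n, i)) (cells N) (cells (\<lambda>n. N (r n)))"
  unfolding filterlim_iff
proof (intro allI impI)
  fix P assume "eventually P (cells N)"
  then have "\<forall>\<^sub>F n in sequentially. \<forall>i<N n. P (n, i)" by (simp add: eventually_cells)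
  then have "\<forall>\<^sub>F n in sequentially. \<forall>i<N (r n). P (r n, i)"
    by (rule eventually_subseq[OF assms])
  then show "\<forall>\<^sub>F x in cells (\<lambda>n. N (r n)). P (case x of (n, i) \<Rightarrow> (r n, i))"
    by (simp add: eventually_cells)
qed

lemma tendsto_cells_subseq:
  assumes "(f \<longlongrightarrow> l) (cells N)" "strict_mono r"
  shows "((\<lambda>(n, i). f (r n, i)) \<longlongrightarrow> l) (cells (\<lambda>n. N (r n)))"
  using filterlim_compose[OF assms(1) filterlim_cells_subseq[OF assms(2)]]
  by (simp add: case_prod_unfold)

text \<open>A partition with \<open>N n\<close> cells has \<open>Suc (N n)\<close> points. A limit
  that is uniform over the points can be read at the left ends of the cells, at their right ends and
  at the final time.\<close>

lemma tendsto_cells_Suc: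
  assumes "(f \<longlongrightarrow> l) (cells (\<lambda>n. Suc (N n)))"
  shows "(f \<longlongrightarrow> l) (cells N)" "((\<lambda>(n, i). f (n, Suc i)) \<longlongrightarrow> l) (cells N)"
    "(\<lambda>n. f (n, N n)) \<longlonglongrightarrow> l"
proof -
  have "cells N \<le> cells (\<lambda>n. Suc (N n))"
    unfolding le_filter_def eventually_cells by (auto elim: eventually_mono)
  then show "(f \<longlongrightarrow> l) (cells N)" using assms by (rule tendsto_mono)
  have "filterlim (\<lambda>(n, i). (n, Suc i)) (cells (\<lambda>n. Suc (N n))) (cells N)"
    unfolding filterlim_iff eventually_cells by (auto elim: eventually_mono)
  from filterlim_compose[OF assms this]
  show "((\<lambda>(n, i). f (n, Suc i)) \<longlongrightarrow> l) (cells N)" by (simp add: case_prod_unfold)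
  have "filterlim (\<lambda>n. (n, N n)) (cells (\<lambda>n. Suc (N n))) sequentially"
    unfolding filterlim_iff eventually_cells by (auto elim: eventually_mono)
  from filterlim_compose[OF assms this]
  show "(\<lambda>n. f (n, N n)) \<longlonglongrightarrow> l" .
qed

text \<open>The Landau constant is uniform over the cells and the weights are nonnegative, so the
  total weight controls every partial sum.\<close>

lemma sum_cells_bound:
  fixes f g :: "nat \<times> nat \<Rightarrow> real"
  assumes "f \<in> O[cells N](g)" "\<And>p. g p \<ge> 0"
    "\<forall>\<^sub>F n in sequentially. (\<Sum>i<N n. g (n, i)) \<le> C"
  shows "\<exists>D. \<forall>\<^sub>F n in sequentially. \<forall>k\<le>N n. \<bar>\<Sum>i<k. f (n, i)\<bar> \<le> D"
proof -
  obtain c where c: "c > 0" "\<forall>\<^sub>F p in cells N. norm (f p) \<le> c * norm (g p)"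
    using assms(1) by (elim landau_o.bigE)
  have "\<forall>\<^sub>F n in sequentially. \<forall>k\<le>N n. \<bar>\<Sum>i<k. f (n, i)\<bar> \<le> c * C"
    using c(2)[unfolded eventually_cells] assms(3)
  proof eventually_elim
    case (elim n)
    show ?case
    proof (intro allI impI)
      fix k assume k: "k \<le> N n"
      have "\<bar>\<Sum>i<k. f (n, i)\<bar> \<le> (\<Sum>i<k. c * g (n, i))"
        using elim(1) assms(2) k by (intro order_trans[OF sum_abs] sum_mono) auto
      also have "\<dots> \<le> (\<Sum>i<N n. c * g (n, i))"
        using k assms(2) c(1) by (intro sum_mono2) auto
      also have "\<dots> \<le> c * C" using elim(2) c(1) by (simp flip: sum_distrib_left)
      finally show "\<bar>\<Sum>i<k. f (n, i)\<bar> \<le> c * C" .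
    qed
  qed
  then show ?thesis by blast
qed

text \<open>This is how errors are discarded: smallness relative to the weights is uniform over the
  cells, and the total weight stays bounded. Partial sums are included because Euler sums are
  compared with integrals at every partition point.\<close>

lemma sum_cells_null:
  fixes f g :: "nat \<times> nat \<Rightarrow> real"
  assumes "f \<in> o[cells N](g)" "\<And>p. g p \<ge> 0"
    "\<forall>\<^sub>F n in sequentially. (\<Sum>i<N n. g (n, i)) \<le> C"
  shows "((\<lambda>(n, k). \<Sum>i<k. f (n, i)) \<longlongrightarrow> 0) (cells (\<lambda>n. Suc (N n)))"
  unfolding tendsto_cells_iff
proof (intro allI impI)
  fix \<epsilon> :: real assume "\<epsilon> > 0"
  \<comment> \<open>\<open>C\<close> may be 0 or negative; the shift by 1 keeps the quotient
    positive.\<close>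
  define c where "c = \<epsilon> / (\<bar>C\<bar> + 1)"
  have "c > 0" using \<open>\<epsilon> > 0\<close> by (simp add: c_def add_nonneg_pos)
  have "\<forall>\<^sub>F p in cells N. norm (f p) \<le> c * norm (g p)"
    using assms(1) \<open>c > 0\<close> by (rule landau_o.smallD)
  then show "\<forall>\<^sub>F n in sequentially. \<forall>k<Suc (N n). \<bar>case (n, k) of (n, k) \<Rightarrow> \<Sum>i<k. f (n, i)\<bar> < \<epsilon>"
    unfolding eventually_cells using assms(3)
  proof eventually_elim
    case (elim n)
    show ?case
    proof (intro allI impI)
      fix k assume k: "k < Suc (N n)"
      have "\<bar>\<Sum>i<k. f (n, i)\<bar> \<le> (\<Sum>i<k. c * g (n, i))"
        using elim(1) assms(2) k by (intro order_trans[OF sum_abs] sum_mono) auto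
      also have "\<dots> \<le> (\<Sum>i<N n. c * g (n, i))"
        using k assms(2) \<open>c > 0\<close> by (intro sum_mono2) auto
      also have "\<dots> \<le> c * C" using elim(2) \<open>c > 0\<close> by (simp flip: sum_distrib_left)
      also have "\<dots> < \<epsilon>"
      proof -
        have "c * C \<le> c * \<bar>C\<bar>" using \<open>c > 0\<close> by (intro mult_left_mono) auto
        also have "\<dots> < c * (\<bar>C\<bar> + 1)" using \<open>c > 0\<close> by simp
        also have "\<dots> = \<epsilon>" by (simp add: c_def)
        finally show ?thesis .
      qed
      finally show "\<bar>case (n, k) of (n, k) \<Rightarrow> \<Sum>i<k. f (n, i)\<bar> < \<epsilon>" by simp
    qed
  qed
qed

section \<open>Continuous paths along fine partitions\<close>

text \<open>The pathwise estimates use only that the mesh tends to 0. The rate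
  \<open>(1 / 4) ^ n\<close> is there to afford a factor \<open>2 ^ n\<close> on compensated squares
  of increments.\<close>

definition fine_grids :: "real \<Rightarrow> (nat \<Rightarrow> nat) \<Rightarrow> (nat \<Rightarrow> nat \<Rightarrow> real) \<Rightarrow> bool" where
  "fine_grids T N q \<longleftrightarrow> (\<forall>n. grid T ((1 / 4) ^ n) (N n) (q n))"

definition cell_incr :: "(nat \<Rightarrow> nat \<Rightarrow> real) \<Rightarrow> (real \<Rightarrow> real) \<Rightarrow> nat \<times> nat \<Rightarrow> real" where
  "cell_incr q f = (\<lambda>(n, i). f (q n (Suc i)) - f (q n i))"

definition cell_left :: "(nat \<Rightarrow> nat \<Rightarrow> real) \<Rightarrow> (real \<Rightarrow> real) \<Rightarrow> nat \<times> nat \<Rightarrow> real" where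
  "cell_left q f = (\<lambda>(n, i). f (q n i))"

abbreviation cell_len :: "(nat \<Rightarrow> nat \<Rightarrow> real) \<Rightarrow> nat \<times> nat \<Rightarrow> real" where
  "cell_len q \<equiv> cell_incr q (\<lambda>u. u)"

lemma fine_grids_grid: "fine_grids T N q \<Longrightarrow> grid T ((1 / 4) ^ n) (N n) (q n)"
  by (simp add: fine_grids_def)

text \<open>A strictly increasing \<open>r\<close> satisfies \<open>n \<le> r n\<close>, so the
  partition of stage \<open>r n\<close> still obeys the mesh bound of stage
  \<open>n\<close>.\<close>

lemma fine_grids_subseq:
  assumes "fine_grids T N q" "strict_mono r"
  shows "fine_grids T (\<lambda>n. N (r n)) (\<lambda>n. q (r n))"
  unfolding fine_grids_def
proof
  fix n
  have "(1 / 4 :: real) ^ r n \<le> (1 / 4) ^ n"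
    by (intro power_decreasing seq_suble assms) auto
  then show "grid T ((1 / 4) ^ n) (N (r n)) (q (r n))"
    using fine_grids_grid[OF assms(1), of "r n"] unfolding grid_def by (meson order_trans)
qed

lemma cell_len_null:
  assumes "fine_grids T N q"
  shows "(cell_len q \<longlongrightarrow> 0) (cells N)"
  unfolding tendsto_cells_iff
proof (intro allI impI)
  fix \<epsilon> :: real assume "\<epsilon> > 0"
  have "(\<lambda>n. (1 / 4 :: real) ^ n) \<longlonglongrightarrow> 0" by (rule LIMSEQ_realpow_zero) auto
  then have "\<forall>\<^sub>F n in sequentially. (1 / 4 :: real) ^ n < \<epsilon>"
    using \<open>\<epsilon> > 0\<close> by (rule order_tendstoD)
  then show "\<forall>\<^sub>F n in sequentially. \<forall>i<N n. \<bar>cell_len q (n, i)\<bar> < \<epsilon>"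
  proof eventually_elim
    case (elim n)
    then show ?case using grid_step[OF fine_grids_grid[OF assms, of n]]
      by (fastforce simp: cell_incr_def)
  qed
qed

text \<open>Uniform continuity on the compact interval. The whole cell is controlled, not only its
  right end, because integrals over cells are estimated with it.\<close>

lemma path_oscillation:
  assumes "fine_grids T N q" "continuous_on {0..T} f" "\<epsilon> > (0::real)"
  shows "\<forall>\<^sub>F p in cells N. case p of (n, i) \<Rightarrow>
           \<forall>u\<in>{q n i..q n (Suc i)}. \<bar>f u - f (q n i)\<bar> < \<epsilon>"
proof -
  have "uniformly_continuous_on {0..T} f"
    using assms(2) by (rule compact_uniformly_continuous) auto
  then obtain d where d: "d > 0"
    "\<And>x y. x \<in> {0..T} \<Longrightarrow> y \<in> {0..T} \<Longrightarrow> dist x y < d \<Longrightarrow> dist (f x) (f y) < \<epsilon>"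
    unfolding uniformly_continuous_on_def using assms(3) by metis
  have "\<forall>\<^sub>F n in sequentially. \<forall>i<N n. \<bar>cell_len q (n, i)\<bar> < d"
    using cell_len_null[OF assms(1)] d(1) unfolding tendsto_cells_iff by blast
  then show ?thesis unfolding eventually_cells
  proof eventually_elim
    case (elim n)
    have g: "grid T ((1 / 4) ^ n) (N n) (q n)" using assms(1) by (rule fine_grids_grid)
    { fix i u assume i: "i < N n" and u: "u \<in> {q n i..q n (Suc i)}"
      have "u \<in> {0..T}" "q n i \<in> {0..T}"
        using grid_bounds[OF g, of i] grid_bounds[OF g, of "Suc i"] i u by auto
      moreover have "dist u (q n i) < d"
        using elim i u by (auto simp: cell_incr_def dist_real_def)
      ultimately have "\<bar>f u - f (q n i)\<bar> < \<epsilon>" using d(2) by (simp add: dist_real_def) }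
    then show ?case by auto
  qed
qed

lemma cell_incr_null:
  assumes "fine_grids T N q" "continuous_on {0..T} f"
  shows "(cell_incr q f \<longlongrightarrow> 0) (cells N)"
  unfolding tendsto_iff
proof (intro allI impI)
  fix \<epsilon> :: real assume "\<epsilon> > 0"
  from path_oscillation[OF assms this] 
  show "\<forall>\<^sub>F p in cells N. dist (cell_incr q f p) 0 < \<epsilon>"
    unfolding eventually_cells
    by eventually_elim
       (auto simp: cell_incr_def less_imp_le grid_step(1)[OF fine_grids_grid[OF assms(1)]])
qed

lemma cell_left_bounded:
  assumes "fine_grids T N q" "continuous_on {0..T} f"
  shows "cell_left q f \<in> O[cells N](\<lambda>_. 1)"
proof -
  obtain C where C: "\<forall>u\<in>{0..T}. norm (f u) \<le> C"
    using compact_imp_bounded[OF compact_continuous_image[OF assms(2)]]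
    unfolding bounded_iff by fastforce
  show ?thesis
  proof (rule bigoI[of _ C])
    show "\<forall>\<^sub>F p in cells N. norm (cell_left q f p) \<le> C * norm (1::real)"
      unfolding eventually_cells
      using grid_bounds[OF fine_grids_grid[OF assms(1)]] C
      by (intro always_eventually) (auto simp: cell_left_def)
  qed
qed

text \<open>The error is the integral of \<open>f\<close> minus its left value over the cell, hence
  at most the oscillation times the length.\<close>

lemma cell_integral_approx:
  assumes "fine_grids T N q" "continuous_on {0..T} f"
  shows "(\<lambda>p. cell_incr q (\<lambda>t. integral {0..t} f) p - cell_left q f p * cell_len q p)
     \<in> o[cells N](cell_len q)"
proof (rule landau_o.smallI)
  fix c :: real assume "c > 0"
  from path_oscillation[OF assms this]
  show "\<forall>\<^sub>F p in cells N. norm (cell_incr q (\<lambda>t. integral {0..t} f) p - cell_left q f p * cell_len q p)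
      \<le> c * norm (cell_len q p)"
    unfolding eventually_cells
  proof eventually_elim
    case (elim n)
    have g: "grid T ((1 / 4) ^ n) (N n) (q n)" using assms(1) by (rule fine_grids_grid)
    show ?case
    proof (intro allI impI)
      fix i assume i: "i < N n"
      let ?a = "q n i" and ?b = "q n (Suc i)"
      have ab: "0 \<le> ?a" "?a < ?b" "?b \<le> T"
        using grid_bounds[OF g, of i] grid_bounds[OF g, of "Suc i"] grid_step[OF g i] i by auto
      have int: "f integrable_on {0..?b}" 
        using ab by (intro integrable_continuous_interval continuous_on_subset[OF assms(2)]) auto
      have cab: "continuous_on {?a..?b} f"
        using ab by (intro continuous_on_subset[OF assms(2)]) auto
      have "integral {0..?a} f + integral {?a..?b} f = integral {0..?b} f"
        using ab int by (intro Henstock_Kurzweil_Integration.integral_combine) auto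
      moreover have "integral {?a..?b} (\<lambda>u. f u - f ?a) = integral {?a..?b} f - f ?a * (?b - ?a)"
        using ab cab by (subst Henstock_Kurzweil_Integration.integral_diff)
          (auto intro: integrable_continuous_interval)
      moreover have "norm (integral {?a..?b} (\<lambda>u. f u - f ?a)) \<le> c * (?b - ?a)"
        using ab elim i cab by (intro integral_bound continuous_intros) (auto intro: less_imp_le)
      ultimately show "norm (cell_incr q (\<lambda>t. integral {0..t} f) (n, i) -
           cell_left q f (n, i) * cell_len q (n, i)) \<le> c * norm (cell_len q (n, i))"
        using ab by (simp add: cell_incr_def cell_left_def)
    qed
  qed
qed

lemma cell_len_pos:
  assumes "fine_grids T N q" "i < N n"
  shows "cell_len q (n, i) > 0"
  using grid_step(1)[OF fine_grids_grid[OF assms(1)] assms(2)] by (simp add: cell_incr_def)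

lemma sum_cell_len:
  assumes "fine_grids T N q"
  shows "(\<Sum>i<N n. cell_len q (n, i)) = T"
  using grid_telescope[OF fine_grids_grid[OF assms, of n]] by (simp add: cell_incr_def)

text \<open>The sign of \<open>cell_len\<close> is known on actual cells only, while the weights in
  \<open>sum_cells_null\<close> are nonnegative at every pair of indices; hence the absolute
  values.\<close>

lemma sum_abs_cell_len:
  assumes "fine_grids T N q"
  shows "(\<Sum>i<N n. \<bar>cell_len q (n, i)\<bar>) = T"
proof -
  have "(\<Sum>i<N n. \<bar>cell_len q (n, i)\<bar>) = (\<Sum>i<N n. cell_len q (n, i))"
    using cell_len_pos[OF assms] by (intro sum.cong) (auto simp: less_imp_le)
  then show ?thesis using sum_cell_len[OF assms] by simp
qed

section \<open>Simple processes along a refinement of their partition\<close>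

lemma simple_coeffs_times:
  assumes "simple_coeffs M F k t \<xi>"
  shows "i \<le> j \<Longrightarrow> j \<le> k \<Longrightarrow> t i \<le> t j" "i \<le> k \<Longrightarrow> 0 \<le> t i"
proof -
  have mono: "t i \<le> t j" if "i \<le> j" "j \<le> k" for i j
    using that
  proof (induction j rule: dec_induct)
    case (step j)
    then show ?case using assms unfolding simple_coeffs_def by (force simp: Suc_le_eq)
  qed simp
  then show "i \<le> j \<Longrightarrow> j \<le> k \<Longrightarrow> t i \<le> t j" .
  show "0 \<le> t i" if "i \<le> k"
    using mono[of 0 i] that assms by (auto simp: simple_coeffs_def)
qed

text \<open>The bound is taken at least 1 so that it can serve as a divisor.\<close>

lemma simple_coeffs_bounded:
  assumes "simple_coeffs M F k t \<xi>"
  shows "\<exists>B\<ge>1. \<forall>i\<le>k. \<forall>\<omega>\<in>space M. \<bar>\<xi> i \<omega>\<bar> \<le> B"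
proof -
  have "bounded (\<Union>i\<in>{..k}. \<xi> i ` space M)"
    using assms by (intro bounded_UN) (auto simp: simple_coeffs_def)
  then obtain B where B: "\<forall>x\<in>(\<Union>i\<in>{..k}. \<xi> i ` space M). norm x \<le> B"
    unfolding bounded_iff by blast
  have "\<forall>i\<le>k. \<forall>\<omega>\<in>space M. \<bar>\<xi> i \<omega>\<bar> \<le> max 1 B" using B by force
  then show ?thesis by (intro exI[of _ "max 1 B"]) auto
qed

lemma simple_process_eq:
  assumes "b > 0"
  shows "simple_process k t \<xi> b \<omega> = (\<Sum>i<k. \<xi> i \<omega> * indicator {t i<..t (Suc i)} b)"
  using assms by (simp add: simple_process_def)

text \<open>Disjointness of the intervals would remove the factor \<open>real k\<close>. It is
  harmless, since \<open>k\<close> is fixed before the next approximation is chosen.\<close>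

lemma abs_simple_process_le:
  assumes "\<forall>i\<le>k. \<bar>\<xi> i \<omega>\<bar> \<le> B" "b > 0"
  shows "\<bar>simple_process k t \<xi> b \<omega>\<bar> \<le> real k * B"
proof -
  have "\<bar>simple_process k t \<xi> b \<omega>\<bar> \<le> (\<Sum>i<k. \<bar>\<xi> i \<omega> * indicator {t i<..t (Suc i)} b\<bar>)"
    unfolding simple_process_eq[OF assms(2)] by (rule sum_abs)
  also have "\<dots> \<le> (\<Sum>i<k. B)"
    using assms(1) by (intro sum_mono) (force simp: indicator_def)
  finally show ?thesis by simp
qed

text \<open>An interval \<open>{t i<..t (Suc i)}\<close> that contains \<open>b\<close> starts at or
  before \<open>a\<close>, as no partition time lies strictly between. The value at the right end of
  the cell is therefore known at its left end.\<close>

lemma simple_process_measurable: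
  assumes "filtration (space M) F" "simple_coeffs M F k t \<xi>"
    "0 \<le> a" "a < b" "t ` {..k} \<inter> {a<..<b} = {}"
  shows "simple_process k t \<xi> b \<in> borel_measurable (F a)"
proof -
  interpret filtration "space M" F by fact
  have "(\<lambda>\<omega>. \<xi> i \<omega> * indicator {t i<..t (Suc i)} b) \<in> borel_measurable (F a)" if "i < k" for i
  proof (cases "t i < b")
    case True
    moreover have "t i \<in> t ` {..k}" using that by simp
    ultimately have "t i \<le> a" using assms(5) by force
    then have "subalgebra (F a) (F (t i))"
      using sets_F_mono space_F by (auto simp: subalgebra_def)
    moreover have "\<xi> i \<in> borel_measurable (F (t i))"
      using assms(2) that by (auto simp: simple_coeffs_def)
    ultimately have "\<xi> i \<in> borel_measurable (F a)" by (rule measurable_from_subalg)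
    then show ?thesis by measurable
  qed simp
  moreover have "simple_process k t \<xi> b = (\<lambda>\<omega>. \<Sum>i<k. \<xi> i \<omega> * indicator {t i<..t (Suc i)} b)"
    using assms(3,4) by (intro ext simple_process_eq) linarith
  ultimately show ?thesis
    by (simp only:) (rule borel_measurable_sum, simp only: lessThan_iff)
qed

text \<open>Every interval of the partition either contains \<open>{a<..b}\<close> or misses it, so
  the increment is multiplied by the coefficient in force at \<open>b\<close>.\<close>

lemma simple_integral_block:
  assumes "simple_coeffs M F k t \<xi>" "0 \<le> a" "a < b" "t ` {..k} \<inter> {a<..<b} = {}"
  shows "simple_integral k t \<xi> X b \<omega> - simple_integral k t \<xi> X a \<omega> =
    simple_process k t \<xi> b \<omega> * (X b \<omega> - X a \<omega>)"
proof -
  have "\<xi> i \<omega> * (X (min b (t (Suc i))) \<omega> - X (min b (t i)) \<omega>) -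
      \<xi> i \<omega> * (X (min a (t (Suc i))) \<omega> - X (min a (t i)) \<omega>) =
      \<xi> i \<omega> * indicator {t i<..t (Suc i)} b * (X b \<omega> - X a \<omega>)" if i: "i < k" for i
  proof -
    have "t i \<in> t ` {..k}" "t (Suc i) \<in> t ` {..k}" using i by auto
    then have "t i \<notin> {a<..<b}" "t (Suc i) \<notin> {a<..<b}" using assms(4) by blast+
    then have "t i \<le> a \<or> t i \<ge> b" "t (Suc i) \<le> a \<or> t (Suc i) \<ge> b" by auto
    moreover have "t i < t (Suc i)" using assms(1) i by (auto simp: simple_coeffs_def)
    ultimately show ?thesis using assms(3)
      by (auto simp: min_def indicator_def algebra_simps)
  qed
  then have "simple_integral k t \<xi> X b \<omega> - simple_integral k t \<xi> X a \<omega> =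
      (\<Sum>i<k. \<xi> i \<omega> * indicator {t i<..t (Suc i)} b * (X b \<omega> - X a \<omega>))"
    unfolding simple_integral_def sum_subtractf[symmetric] by (intro sum.cong) auto
  also have "\<dots> = simple_process k t \<xi> b \<omega> * (X b \<omega> - X a \<omega>)"
    using assms(2,3) unfolding sum_distrib_right[symmetric] by (subst simple_process_eq) auto
  finally show ?thesis .
qed

lemma simple_integral_0:
  assumes "simple_coeffs M F k t \<xi>"
  shows "simple_integral k t \<xi> X 0 \<omega> = 0"
  unfolding simple_integral_def
proof (intro sum.neutral ballI)
  fix i assume "i \<in> {..<k}"
  then have "0 \<le> t i" "0 \<le> t (Suc i)" using simple_coeffs_times(2)[OF assms] by auto
  then show "\<xi> i \<omega> * (X (min 0 (t (Suc i))) \<omega> - X (min 0 (t i)) \<omega>) = 0" by simp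
qed

lemma simple_integral_grid:
  assumes "simple_coeffs M F k t \<xi>" "grid T \<delta> N q"
    "\<forall>i<N. t ` {..k} \<inter> {q i<..<q (Suc i)} = {}" "n \<le> N"
  shows "simple_integral k t \<xi> X (q n) \<omega> =
    (\<Sum>i<n. simple_process k t \<xi> (q (Suc i)) \<omega> * (X (q (Suc i)) \<omega> - X (q i) \<omega>))"
  using assms(4)
proof (induction n)
  case 0
  have "q 0 = 0" using assms(2) by (simp add: grid_def)
  then show ?case using simple_integral_0[OF assms(1)] by simp
next
  case (Suc n)
  have "simple_integral k t \<xi> X (q (Suc n)) \<omega> - simple_integral k t \<xi> X (q n) \<omega> =
      simple_process k t \<xi> (q (Suc n)) \<omega> * (X (q (Suc n)) \<omega> - X (q n) \<omega>)"
    using assms(2,3) Suc.prems grid_bounds(1)[OF assms(2)] grid_step(1)[OF assms(2)]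
    by (intro simple_integral_block[OF assms(1)]) auto
  then show ?case using Suc by simp
qed

text \<open>Stability in the integrator for fixed coefficients; a uniform error enters each summand
  at two endpoints. The constant depends on the coefficients, which dictates the order of choices
  when two approximations are composed.\<close>

lemma simple_integral_diff_le:
  assumes "simple_coeffs M F k t \<xi>" "\<forall>i\<le>k. \<bar>\<xi> i \<omega>\<bar> \<le> B" "0 \<le> s"
    "\<forall>u\<in>{0..s}. \<bar>X u \<omega> - Y u \<omega>\<bar> \<le> \<delta>"
  shows "\<bar>simple_integral k t \<xi> X s \<omega> - simple_integral k t \<xi> Y s \<omega>\<bar> \<le> real k * (B * (2 * \<delta>))"
proof -
  let ?D = "\<lambda>i. (X (min s (t (Suc i))) \<omega> - X (min s (t i)) \<omega>) -
      (Y (min s (t (Suc i))) \<omega> - Y (min s (t i)) \<omega>)"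
  have "\<bar>simple_integral k t \<xi> X s \<omega> - simple_integral k t \<xi> Y s \<omega>\<bar> = \<bar>\<Sum>i<k. \<xi> i \<omega> * ?D i\<bar>"
    unfolding simple_integral_def by (simp add: right_diff_distrib flip: sum_subtractf)
  also have "\<dots> \<le> (\<Sum>i<k. \<bar>\<xi> i \<omega>\<bar> * \<bar>?D i\<bar>)"
    by (rule order_trans[OF sum_abs]) (simp add: abs_mult)
  also have "\<dots> \<le> (\<Sum>i<k. B * (2 * \<delta>))"
  proof (rule sum_mono)
    fix i assume i: "i \<in> {..<k}"
    then have "min s (t (Suc i)) \<in> {0..s}" "min s (t i) \<in> {0..s}"
      using simple_coeffs_times(2)[OF assms(1)] assms(3) by auto
    from this[THEN assms(4)[rule_format]] have "\<bar>?D i\<bar> \<le> 2 * \<delta>" by linarith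
    moreover have "\<bar>\<xi> i \<omega>\<bar> \<le> B" using assms(2) i by auto
    ultimately show "\<bar>\<xi> i \<omega>\<bar> * \<bar>?D i\<bar> \<le> B * (2 * \<delta>)" by (intro mult_mono) auto
  qed
  finally show ?thesis by simp
qed

section \<open>Stochastic integrals as limits along common partitions\<close>

lemma ucp_tendstoD:
  assumes "ucp_tendsto M Xs X" "0 \<le> T" "0 < \<epsilon>" "0 < \<delta>"
  shows "\<forall>\<^sub>F n in sequentially. \<exists>A\<in>sets M. measure M A < \<delta> \<and>
     (\<forall>\<omega>\<in>space M - A. \<forall>t\<in>{0..T}. \<bar>Xs n t \<omega> - X t \<omega>\<bar> \<le> \<epsilon>)"
proof -
  have "\<forall>\<^sub>F n in sequentially. \<exists>A\<in>sets M. measure M A < \<delta> \<and>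
      {\<omega>\<in>space M. \<exists>t\<in>{0..T}. \<bar>Xs n t \<omega> - X t \<omega>\<bar> > \<epsilon>} \<subseteq> A"
    using assms unfolding ucp_tendsto_def by blast
  then show ?thesis by eventually_elim (force simp: not_le[symmetric])
qed

text \<open>The two ucp limits are made to share one index and one exceptional set, to which each
  contributes half of \<open>\<delta>\<close>.\<close>

lemma has_stoch_integral_simple:
  assumes "has_stoch_integral M F H X J" "0 \<le> T" "0 < \<epsilon>" "0 < \<delta>" "finite_measure M"
  obtains k t \<xi> A where "simple_coeffs M F k t \<xi>" "A \<in> sets M" "measure M A < \<delta>"
    "\<And>\<omega> s. \<omega> \<in> space M - A \<Longrightarrow> s \<in> {0..T} \<Longrightarrow> \<bar>simple_process k t \<xi> s \<omega> - H s \<omega>\<bar> \<le> \<epsilon>"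
    "\<And>\<omega> s. \<omega> \<in> space M - A \<Longrightarrow> s \<in> {0..T} \<Longrightarrow> \<bar>simple_integral k t \<xi> X s \<omega> - J s \<omega>\<bar> \<le> \<epsilon>"
proof -
  interpret finite_measure M by fact
  obtain k t \<xi> where *: "\<forall>n. simple_coeffs M F (k n) (t n) (\<xi> n)"
    "ucp_tendsto M (\<lambda>n. simple_process (k n) (t n) (\<xi> n)) H"
    "ucp_tendsto M (\<lambda>n. simple_integral (k n) (t n) (\<xi> n) X) J"
    using assms(1) unfolding has_stoch_integral_def by blast
  have "\<delta> / 2 > 0" using assms by simp
  from eventually_happens'[OF sequentially_bot
      eventually_conj[OF ucp_tendstoD[OF *(2) assms(2,3) this] ucp_tendstoD[OF *(3) assms(2,3) this]]]
  obtain n A A' where A: "A \<in> sets M" "A' \<in> sets M" "measure M A < \<delta> / 2" "measure M A' < \<delta> / 2"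
    "\<forall>\<omega>\<in>space M - A. \<forall>s\<in>{0..T}. \<bar>simple_process (k n) (t n) (\<xi> n) s \<omega> - H s \<omega>\<bar> \<le> \<epsilon>"
    "\<forall>\<omega>\<in>space M - A'. \<forall>s\<in>{0..T}. \<bar>simple_integral (k n) (t n) (\<xi> n) X s \<omega> - J s \<omega>\<bar> \<le> \<epsilon>"
    by (elim exE conjE bexE) (rule that, assumption+)
  have "measure M (A \<union> A') < \<delta>"
    using A(3,4) measure_Un_le[OF A(1,2)] by linarith
  then show ?thesis using A *(1) by (intro that[of "k n" "t n" "\<xi> n" "A \<union> A'"]) auto
qed

text \<open>
  The integrand of the outer integral is chosen first; being bounded, it leaves room to choose the
  integrand of the inner one so close that the two approximations can be composed.
\<close>

lemma stoch_integral_iterated_grid: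
  assumes "filtered_prob_space M F" "has_stoch_integral M F H S K" "has_stoch_integral M F S W J"
    "T > 0" "\<epsilon> > 0" "\<delta> > 0"
  shows "\<exists>A N q \<alpha> \<beta>. A \<in> sets M \<and> measure M A < \<epsilon> \<and> grid T \<delta> N q \<and>
    (\<forall>i<N. \<alpha> i \<in> borel_measurable (F (q i)) \<and> \<beta> i \<in> borel_measurable (F (q i))) \<and>
    (\<forall>\<omega>\<in>space M - A.
       (\<forall>i<N. \<bar>\<alpha> i \<omega> - H (q (Suc i)) \<omega>\<bar> \<le> \<epsilon> \<and> \<bar>\<alpha> i \<omega> * (\<beta> i \<omega> - S (q (Suc i)) \<omega>)\<bar> \<le> \<epsilon>) \<and>
       (\<forall>n\<le>N. \<bar>(\<Sum>i<n. \<alpha> i \<omega> * (S (q (Suc i)) \<omega> - S (q i) \<omega>)) - K (q n) \<omega>\<bar> \<le> \<epsilon> \<and>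
          \<bar>(\<Sum>i<n. \<alpha> i \<omega> * \<beta> i \<omega> * (W (q (Suc i)) \<omega> - W (q i) \<omega>)) -
             (\<Sum>i<n. \<alpha> i \<omega> * (J (q (Suc i)) \<omega> - J (q i) \<omega>))\<bar> \<le> \<epsilon>))"
proof -
  interpret filtered_prob_space M F by fact
  have T: "0 \<le> T" using assms by simp
  obtain k t \<xi> A where 1: "simple_coeffs M F k t \<xi>" "A \<in> sets M" "measure M A < \<epsilon> / 2"
    "\<And>\<omega> s. \<omega> \<in> space M - A \<Longrightarrow> s \<in> {0..T} \<Longrightarrow> \<bar>simple_process k t \<xi> s \<omega> - H s \<omega>\<bar> \<le> \<epsilon>"
    "\<And>\<omega> s. \<omega> \<in> space M - A \<Longrightarrow> s \<in> {0..T} \<Longrightarrow> \<bar>simple_integral k t \<xi> S s \<omega> - K s \<omega>\<bar> \<le> \<epsilon>"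
    by (rule has_stoch_integral_simple[OF assms(2) T assms(5) half_gt_zero[OF assms(5)]
          finite_measure_axioms]) blast
  obtain B where B: "B \<ge> 1" "\<forall>i\<le>k. \<forall>\<omega>\<in>space M. \<bar>\<xi> i \<omega>\<bar> \<le> B"
    using simple_coeffs_bounded[OF 1(1)] by blast
  \<comment> \<open>Makes \<open>real k * (B * (2 * \<epsilon>'))\<close> at most
    \<open>\<epsilon>\<close>; \<open>real k + 1\<close> replaces \<open>real k\<close> because
    \<open>k\<close> may be 0.\<close>
  define \<epsilon>' where "\<epsilon>' = \<epsilon> / (2 * (real k + 1) * B)"
  have \<epsilon>': "\<epsilon>' > 0" using B assms(5) by (simp add: \<epsilon>'_def add_nonneg_pos)
  have le: "real k * (B * (2 * \<epsilon>')) \<le> \<epsilon>"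
  proof -
    have "real k * (B * (2 * \<epsilon>')) \<le> (real k + 1) * (B * (2 * \<epsilon>'))"
      using B \<epsilon>' by (intro mult_right_mono) auto
    also have "\<dots> = \<epsilon>"
    proof -
      have "D * (B * (2 * (\<epsilon> / (2 * D * B)))) = \<epsilon>" if "D \<noteq> 0" for D
        using that B(1) by simp
      from this[of "real k + 1"] show ?thesis by (simp add: \<epsilon>'_def)
    qed
    finally show ?thesis .
  qed
  obtain k' t' \<eta> A' where 2: "simple_coeffs M F k' t' \<eta>" "A' \<in> sets M" "measure M A' < \<epsilon> / 2"
    "\<And>\<omega> s. \<omega> \<in> space M - A' \<Longrightarrow> s \<in> {0..T} \<Longrightarrow> \<bar>simple_process k' t' \<eta> s \<omega> - S s \<omega>\<bar> \<le> \<epsilon>'"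
    "\<And>\<omega> s. \<omega> \<in> space M - A' \<Longrightarrow> s \<in> {0..T} \<Longrightarrow> \<bar>simple_integral k' t' \<eta> W s \<omega> - J s \<omega>\<bar> \<le> \<epsilon>'"
    by (rule has_stoch_integral_simple[OF assms(3) T \<epsilon>' half_gt_zero[OF assms(5)]
          finite_measure_axioms]) blast
  obtain N q where g: "grid T \<delta> N q"
    and no: "\<forall>i<N. (t ` {..k} \<union> t' ` {..k'}) \<inter> {q i<..<q (Suc i)} = {}"
    using grid_exists[OF assms(4,6), of "t ` {..k} \<union> t' ` {..k'}"] by auto
  have no1: "\<forall>i<N. t ` {..k} \<inter> {q i<..<q (Suc i)} = {}"
    and no2: "\<forall>i<N. t' ` {..k'} \<inter> {q i<..<q (Suc i)} = {}"
    using no by auto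
  \<comment> \<open>Simple processes are constant on a cell up to and including its right end, where
    their value on the cell is therefore read.\<close>
  define \<alpha> where "\<alpha> i = simple_process k t \<xi> (q (Suc i))" for i
  define \<beta> where "\<beta> i = simple_process k' t' \<eta> (q (Suc i))" for i
  have q: "0 \<le> q i" "q i < q (Suc i)" "q (Suc i) \<in> {0..T}" if "i < N" for i
    using grid_bounds[OF g, of i] grid_bounds[OF g, of "Suc i"] grid_step[OF g that] that by auto
  have qn: "q n \<in> {0..T}" if "n \<le> N" for n
    using grid_bounds[OF g that] by simp
  have "measure M (A \<union> A') < \<epsilon>"
    using 1(3) 2(3) measure_Un_le[OF 1(2) 2(2)] by linarith
  moreover have "\<alpha> i \<in> borel_measurable (F (q i)) \<and> \<beta> i \<in> borel_measurable (F (q i))"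
    if "i < N" for i
    unfolding \<alpha>_def \<beta>_def using q[OF that] no1 no2 that
    by (intro conjI simple_process_measurable[OF filtration_axioms 1(1)]
        simple_process_measurable[OF filtration_axioms 2(1)]) auto
  moreover have "\<bar>\<alpha> i \<omega> - H (q (Suc i)) \<omega>\<bar> \<le> \<epsilon> \<and> \<bar>\<alpha> i \<omega> * (\<beta> i \<omega> - S (q (Suc i)) \<omega>)\<bar> \<le> \<epsilon>"
    if \<omega>: "\<omega> \<in> space M - (A \<union> A')" and i: "i < N" for \<omega> i
  proof
    show "\<bar>\<alpha> i \<omega> - H (q (Suc i)) \<omega>\<bar> \<le> \<epsilon>"
      unfolding \<alpha>_def using 1(4) \<omega> q[OF i] by blast
    have "\<bar>\<alpha> i \<omega>\<bar> \<le> real k * B"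
      unfolding \<alpha>_def using B \<omega> q[OF i] by (intro abs_simple_process_le) auto
    moreover have "\<bar>\<beta> i \<omega> - S (q (Suc i)) \<omega>\<bar> \<le> \<epsilon>'"
      unfolding \<beta>_def using 2(4) \<omega> q[OF i] by blast
    ultimately have "\<bar>\<alpha> i \<omega> * (\<beta> i \<omega> - S (q (Suc i)) \<omega>)\<bar> \<le> (real k * B) * \<epsilon>'"
      unfolding abs_mult using B by (intro mult_mono) auto
    also have "\<dots> \<le> real k * (B * (2 * \<epsilon>'))" using B \<epsilon>' by (simp add: mult_left_mono)
    finally show "\<bar>\<alpha> i \<omega> * (\<beta> i \<omega> - S (q (Suc i)) \<omega>)\<bar> \<le> \<epsilon>" using le by linarith
  qed
  moreover have "\<bar>(\<Sum>i<n. \<alpha> i \<omega> * (S (q (Suc i)) \<omega> - S (q i) \<omega>)) - K (q n) \<omega>\<bar> \<le> \<epsilon> \<and>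
          \<bar>(\<Sum>i<n. \<alpha> i \<omega> * \<beta> i \<omega> * (W (q (Suc i)) \<omega> - W (q i) \<omega>)) -
             (\<Sum>i<n. \<alpha> i \<omega> * (J (q (Suc i)) \<omega> - J (q i) \<omega>))\<bar> \<le> \<epsilon>"
    if \<omega>: "\<omega> \<in> space M - (A \<union> A')" and n: "n \<le> N" for \<omega> n
  proof
    have "(\<Sum>i<n. \<alpha> i \<omega> * (S (q (Suc i)) \<omega> - S (q i) \<omega>)) = simple_integral k t \<xi> S (q n) \<omega>"
      unfolding simple_integral_grid[OF 1(1) g no1 n] \<alpha>_def ..
    then show "\<bar>(\<Sum>i<n. \<alpha> i \<omega> * (S (q (Suc i)) \<omega> - S (q i) \<omega>)) - K (q n) \<omega>\<bar> \<le> \<epsilon>"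
      using 1(5) \<omega> qn[OF n] by auto
    let ?J = "simple_integral k' t' \<eta> W"
    \<comment> \<open>On the common partition, multiplying the two integrands amounts to integrating
      the outer one against the simple integral of the inner one.\<close>
    have "(\<Sum>i<n. \<alpha> i \<omega> * \<beta> i \<omega> * (W (q (Suc i)) \<omega> - W (q i) \<omega>)) =
        (\<Sum>i<n. \<alpha> i \<omega> * (?J (q (Suc i)) \<omega> - ?J (q i) \<omega>))"
    proof (intro sum.cong refl)
      fix i assume "i \<in> {..<n}"
      then have i: "i < N" using n by auto
      have "?J (q (Suc i)) \<omega> - ?J (q i) \<omega> = \<beta> i \<omega> * (W (q (Suc i)) \<omega> - W (q i) \<omega>)"
        unfolding \<beta>_def using q[OF i] no2 i by (intro simple_integral_block[OF 2(1)]) auto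
      then show "\<alpha> i \<omega> * \<beta> i \<omega> * (W (q (Suc i)) \<omega> - W (q i) \<omega>) =
          \<alpha> i \<omega> * (?J (q (Suc i)) \<omega> - ?J (q i) \<omega>)" by simp
    qed
    also have "\<dots> = simple_integral k t \<xi> ?J (q n) \<omega>"
      unfolding simple_integral_grid[OF 1(1) g no1 n] \<alpha>_def ..
    finally have a: "(\<Sum>i<n. \<alpha> i \<omega> * \<beta> i \<omega> * (W (q (Suc i)) \<omega> - W (q i) \<omega>)) =
        simple_integral k t \<xi> ?J (q n) \<omega>" .
    have b: "(\<Sum>i<n. \<alpha> i \<omega> * (J (q (Suc i)) \<omega> - J (q i) \<omega>)) = simple_integral k t \<xi> J (q n) \<omega>"
      unfolding simple_integral_grid[OF 1(1) g no1 n] \<alpha>_def ..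
    have "\<bar>simple_integral k t \<xi> ?J (q n) \<omega> - simple_integral k t \<xi> J (q n) \<omega>\<bar>
        \<le> real k * (B * (2 * \<epsilon>'))"
      using B \<omega> qn[OF n] 2(5)[of \<omega>] by (intro simple_integral_diff_le[OF 1(1)]) auto
    then show "\<bar>(\<Sum>i<n. \<alpha> i \<omega> * \<beta> i \<omega> * (W (q (Suc i)) \<omega> - W (q i) \<omega>)) -
             (\<Sum>i<n. \<alpha> i \<omega> * (J (q (Suc i)) \<omega> - J (q i) \<omega>))\<bar> \<le> \<epsilon>"
      unfolding a b using le by linarith
  qed
  ultimately show ?thesis
    using g 1(2) 2(2) by (intro exI[of _ "A \<union> A'"] exI[of _ N] exI[of _ q] exI[of _ \<alpha>] exI[of _ \<beta>]) auto
qed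

section \<open>Sums of martingale differences\<close>

definition martingale_diff :: "'w measure \<Rightarrow> 'w measure \<Rightarrow> ('w \<Rightarrow> real) \<Rightarrow> real \<Rightarrow> bool" where
  "martingale_diff M G Y v \<longleftrightarrow>
     (\<forall>g\<in>borel_measurable G. integrable M g \<longrightarrow>
        integrable M (\<lambda>\<omega>. g \<omega> * Y \<omega>) \<and> (\<integral>\<omega>. g \<omega> * Y \<omega> \<partial>M) = 0 \<and>
        integrable M (\<lambda>\<omega>. g \<omega> * (Y \<omega>)\<^sup>2) \<and> (\<integral>\<omega>. g \<omega> * (Y \<omega>)\<^sup>2 \<partial>M) = v * (\<integral>\<omega>. g \<omega> \<partial>M))"

lemma (in filtered_prob_space) measurable_F:
  assumes "f \<in> borel_measurable (F s)"
  shows "s \<le> t \<Longrightarrow> f \<in> borel_measurable (F t)" "f \<in> borel_measurable M"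
proof -
  show "f \<in> borel_measurable (F t)" if "s \<le> t"
    by (rule measurable_from_subalg[OF _ assms])
       (use that sets_F_mono space_F in \<open>auto simp: subalgebra_def\<close>)
  show "f \<in> borel_measurable M"
    by (rule measurable_from_subalg[OF _ assms])
       (use sets_F_subset space_F in \<open>auto simp: subalgebra_def\<close>)
qed

text \<open>Discrete Ito isometry: the sum of the earlier terms times \<open>g k\<close> is a
  legitimate test function for \<open>Y k\<close>, so the mixed term of the square has integral
  0.\<close>

lemma (in filtered_prob_space) martingale_diff_sum_square:
  assumes "\<And>i. i < k \<Longrightarrow> q i \<le> q (Suc i)"
    and "\<And>i. i < k \<Longrightarrow> g i \<in> borel_measurable (F (q i))"
    and "\<And>i \<omega>. i < k \<Longrightarrow> \<bar>g i \<omega>\<bar> \<le> 1"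
    and "\<And>i. i < k \<Longrightarrow> Y i \<in> borel_measurable (F (q (Suc i)))"
    and "\<And>i. i < k \<Longrightarrow> martingale_diff M (F (q i)) (Y i) (v i)"
  shows "(\<lambda>\<omega>. \<Sum>i<k. g i \<omega> * Y i \<omega>) \<in> borel_measurable (F (q k))"
    and "integrable M (\<lambda>\<omega>. (\<Sum>i<k. g i \<omega> * Y i \<omega>)\<^sup>2)"
    and "(\<integral>\<omega>. (\<Sum>i<k. g i \<omega> * Y i \<omega>)\<^sup>2 \<partial>M) = (\<Sum>i<k. v i * (\<integral>\<omega>. (g i \<omega>)\<^sup>2 \<partial>M))"
  using assms
proof (induction k)
  case 0
  { case 1 show ?case by simp next case 2 show ?case by simp next case 3 show ?case by simp }
next
  case (Suc k)
  let ?S = "\<lambda>\<omega>. \<Sum>i<k. g i \<omega> * Y i \<omega>"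
  \<comment> \<open>The claims go through the induction together, because square-integrability of
    the earlier sum is what makes the mixed term integrable.\<close>
  have main: "?S \<in> borel_measurable (F (q k)) \<and> integrable M (\<lambda>\<omega>. (?S \<omega>)\<^sup>2) \<and>
      (\<integral>\<omega>. (?S \<omega>)\<^sup>2 \<partial>M) = (\<Sum>i<k. v i * (\<integral>\<omega>. (g i \<omega>)\<^sup>2 \<partial>M)) \<and>
      (\<lambda>\<omega>. \<Sum>i<Suc k. g i \<omega> * Y i \<omega>) \<in> borel_measurable (F (q (Suc k))) \<and>
      integrable M (\<lambda>\<omega>. (\<Sum>i<Suc k. g i \<omega> * Y i \<omega>)\<^sup>2) \<and>
      (\<integral>\<omega>. (\<Sum>i<Suc k. g i \<omega> * Y i \<omega>)\<^sup>2 \<partial>M) = (\<Sum>i<Suc k. v i * (\<integral>\<omega>. (g i \<omega>)\<^sup>2 \<partial>M))"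
    if A: "\<And>i. i < Suc k \<Longrightarrow> q i \<le> q (Suc i)"
      "\<And>i. i < Suc k \<Longrightarrow> g i \<in> borel_measurable (F (q i))"
      "\<And>i \<omega>. i < Suc k \<Longrightarrow> \<bar>g i \<omega>\<bar> \<le> 1"
      "\<And>i. i < Suc k \<Longrightarrow> Y i \<in> borel_measurable (F (q (Suc i)))"
      "\<And>i. i < Suc k \<Longrightarrow> martingale_diff M (F (q i)) (Y i) (v i)"
  proof -
    have S: "?S \<in> borel_measurable (F (q k))" and S2: "integrable M (\<lambda>\<omega>. (?S \<omega>)\<^sup>2)"
      and ES: "(\<integral>\<omega>. (?S \<omega>)\<^sup>2 \<partial>M) = (\<Sum>i<k. v i * (\<integral>\<omega>. (g i \<omega>)\<^sup>2 \<partial>M))"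
      using Suc.IH A by auto
    have g: "g k \<in> borel_measurable (F (q k))" and gb: "\<And>\<omega>. \<bar>g k \<omega>\<bar> \<le> 1" using A by auto
    have Sg: "(\<lambda>\<omega>. ?S \<omega> * g k \<omega>) \<in> borel_measurable (F (q k))" using S g by measurable
    have g2: "(\<lambda>\<omega>. (g k \<omega>)\<^sup>2) \<in> borel_measurable (F (q k))" using g by measurable
    have iSg: "integrable M (\<lambda>\<omega>. ?S \<omega> * g k \<omega>)"
    proof (rule Bochner_Integration.integrable_bound)
      show "integrable M (\<lambda>\<omega>. 1 + (?S \<omega>)\<^sup>2)" using S2 by simp
      show "(\<lambda>\<omega>. ?S \<omega> * g k \<omega>) \<in> borel_measurable M" using Sg by (rule measurable_F)
      have "\<bar>a * b\<bar> \<le> 1 + a\<^sup>2" if "\<bar>b\<bar> \<le> 1" for a b :: real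
      proof -
        have "\<bar>a * b\<bar> \<le> \<bar>a\<bar> * 1" unfolding abs_mult using that by (intro mult_left_mono) auto
        also have "\<dots> \<le> 1 + a\<^sup>2"
          using sum_squares_ge_zero[of "\<bar>a\<bar> - 1" 0] zero_le_power2[of a]
          by (simp add: power2_eq_square algebra_simps)
        finally show ?thesis .
      qed
      then show "AE \<omega> in M. norm (?S \<omega> * g k \<omega>) \<le> norm (1 + (?S \<omega>)\<^sup>2)"
        using gb by (intro AE_I2) (simp add: add_nonneg_nonneg)
    qed
    have ig2: "integrable M (\<lambda>\<omega>. (g k \<omega>)\<^sup>2)"
      by (rule integrable_const_bound[of _ 1])
         (use gb measurable_F(2)[OF g2] in \<open>auto simp: abs_square_le_1\<close>)
    have cross: "integrable M (\<lambda>\<omega>. ?S \<omega> * g k \<omega> * Y k \<omega>)" "(\<integral>\<omega>. ?S \<omega> * g k \<omega> * Y k \<omega> \<partial>M) = 0"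
      using A(5)[of k] Sg iSg unfolding martingale_diff_def by auto
    have sq: "integrable M (\<lambda>\<omega>. (g k \<omega>)\<^sup>2 * (Y k \<omega>)\<^sup>2)"
      "(\<integral>\<omega>. (g k \<omega>)\<^sup>2 * (Y k \<omega>)\<^sup>2 \<partial>M) = v k * (\<integral>\<omega>. (g k \<omega>)\<^sup>2 \<partial>M)"
      using A(5)[of k] g2 ig2 unfolding martingale_diff_def by auto
    have eq: "(\<lambda>\<omega>. (\<Sum>i<Suc k. g i \<omega> * Y i \<omega>)\<^sup>2) =
        (\<lambda>\<omega>. (?S \<omega>)\<^sup>2 + 2 * (?S \<omega> * g k \<omega> * Y k \<omega>) + (g k \<omega>)\<^sup>2 * (Y k \<omega>)\<^sup>2)"
      by (simp add: power2_sum power_mult_distrib algebra_simps)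
    have "(\<lambda>\<omega>. \<Sum>i<Suc k. g i \<omega> * Y i \<omega>) \<in> borel_measurable (F (q (Suc k)))"
    proof -
      have "?S \<in> borel_measurable (F (q (Suc k)))" "g k \<in> borel_measurable (F (q (Suc k)))"
        using measurable_F(1)[OF S] measurable_F(1)[OF g] A(1) by auto
      then show ?thesis using A(4)[of k] by simp
    qed
    then show ?thesis using S S2 ES cross sq unfolding eq by simp
  qed
  { case 1 then show ?case using main by blast }
  { case 2 then show ?case using main by blast }
  { case 3 then show ?case using main by blast }
qed

text \<open>For clipped weights the isometry bounds the second moment by a multiple of the expected
  Riemann sum of the squared weights. Dominated convergence, with the constant \<open>T\<close> as
  dominating function, sends this to 0, and convergence in mean of the squares gives an almost
  surely convergent subsequence.\<close>

lemma (in filtered_prob_space) martingale_diff_sum_null: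
  fixes e Y :: "nat \<times> nat \<Rightarrow> 'w \<Rightarrow> real"
  assumes grids: "fine_grids T N q"
    and e: "\<And>n i. i < N n \<Longrightarrow> e (n, i) \<in> borel_measurable (F (q n i))"
    and Y: "\<And>n i. i < N n \<Longrightarrow> Y (n, i) \<in> borel_measurable (F (q n (Suc i)))"
    and md: "\<And>n i. i < N n \<Longrightarrow> martingale_diff M (F (q n i)) (Y (n, i)) (v (n, i))"
    and v: "\<And>n i. i < N n \<Longrightarrow> v (n, i) \<le> C * cell_len q (n, i)"
    and null: "AE \<omega> in M. ((\<lambda>p. e p \<omega>) \<longlongrightarrow> 0) (cells N)"
  shows "\<exists>r. strict_mono r \<and>
    (AE \<omega> in M. (\<lambda>n. \<Sum>i<N (r n). e (r n, i) \<omega> * Y (r n, i) \<omega>) \<longlonglongrightarrow> 0)"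
proof -
  \<comment> \<open>Clipping gives the square-integrability; as \<open>e\<close> tends to 0 uniformly, it is eventually inactive.\<close>
  define g where "g p \<omega> = max (- 1) (min 1 (e p \<omega>))" for p \<omega>
  define u where "u n \<omega> = (\<Sum>i<N n. g (n, i) \<omega> * Y (n, i) \<omega>)\<^sup>2" for n \<omega>
  define f where "f n \<omega> = (\<Sum>i<N n. (g (n, i) \<omega>)\<^sup>2 * cell_len q (n, i))" for n \<omega>
  have gm: "g (n, i) \<in> borel_measurable (F (q n i))" if "i < N n" for n i
    using e[OF that] unfolding g_def by measurable
  have gM: "g (n, i) \<in> borel_measurable M" if "i < N n" for n i
    using gm[OF that] by (rule measurable_F)
  have gb: "\<bar>g p \<omega>\<bar> \<le> 1" for p \<omega> by (auto simp: g_def)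
  then have gb2: "(g p \<omega>)\<^sup>2 \<le> 1" for p \<omega> by (simp add: abs_square_le_1)
  have len: "cell_len q (n, i) > 0" if "i < N n" for n i
    using grid_step(1)[OF fine_grids_grid[OF grids] that] by (simp add: cell_incr_def)
  have ig2: "integrable M (\<lambda>\<omega>. (g (n, i) \<omega>)\<^sup>2)" if "i < N n" for n i
    by (rule integrable_const_bound[of _ 1]) (use gb2 gM[OF that] in auto)
  have u: "integrable M (u n)"
    "(\<integral>\<omega>. u n \<omega> \<partial>M) = (\<Sum>i<N n. v (n, i) * (\<integral>\<omega>. (g (n, i) \<omega>)\<^sup>2 \<partial>M))" for n
  proof -
    note * = martingale_diff_sum_square(2,3)[of "N n" "q n" "\<lambda>i. g (n, i)" "\<lambda>i. Y (n, i)" "\<lambda>i. v (n, i)",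
        OF less_imp_le[OF grid_step(1)[OF fine_grids_grid[OF grids]]] gm gb Y md]
    show "integrable M (u n)" unfolding u_def[abs_def] by (rule *)
    show "(\<integral>\<omega>. u n \<omega> \<partial>M) = (\<Sum>i<N n. v (n, i) * (\<integral>\<omega>. (g (n, i) \<omega>)\<^sup>2 \<partial>M))"
      unfolding u_def by (rule *)
  qed
  have fM: "f n \<in> borel_measurable M" for n
    unfolding f_def[abs_def] using gM by (intro borel_measurable_sum) auto
  have fT: "\<bar>f n \<omega>\<bar> \<le> T" for n \<omega>
  proof -
    have "\<bar>f n \<omega>\<bar> = f n \<omega>" unfolding f_def using len by (intro abs_of_nonneg sum_nonneg) (auto simp: less_imp_le)
    also have "\<dots> \<le> (\<Sum>i<N n. 1 * cell_len q (n, i))"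
      unfolding f_def using len gb2 by (intro sum_mono mult_right_mono) (auto simp: less_imp_le)
    also have "\<dots> = T" using sum_cell_len[OF grids] by simp
    finally show ?thesis .
  qed
  have f0: "AE \<omega> in M. (\<lambda>n. f n \<omega>) \<longlonglongrightarrow> 0"
    using null
  proof eventually_elim
    case (elim \<omega>)
    have "((\<lambda>p. max (- 1) (min 1 (e p \<omega>))) \<longlongrightarrow> max (- 1) (min 1 0)) (cells N)"
      by (intro tendsto_intros elim)
    then have "((\<lambda>p. (g p \<omega>)\<^sup>2) \<longlongrightarrow> 0\<^sup>2) (cells N)"
      unfolding g_def by (intro tendsto_power) auto
    then have "(\<lambda>p. (g p \<omega>)\<^sup>2) \<in> o[cells N](\<lambda>_. 1)"
      by (intro smalloI_tendsto) auto
    then have "(\<lambda>p. (g p \<omega>)\<^sup>2 * \<bar>cell_len q p\<bar>) \<in> o[cells N](\<lambda>p. 1 * \<bar>cell_len q p\<bar>)"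
      by (rule landau_o.small_big_mult) simp
    then have "((\<lambda>(n, k). \<Sum>i<k. (g (n, i) \<omega>)\<^sup>2 * \<bar>cell_len q (n, i)\<bar>) \<longlongrightarrow> 0) (cells (\<lambda>n. Suc (N n)))"
      using sum_cell_len[OF grids] len
      by (intro sum_cells_null[of _ _ "\<lambda>p. \<bar>cell_len q p\<bar>" T]) (auto simp: less_imp_le)
    from tendsto_cells_Suc(3)[OF this] show ?case
      unfolding f_def using len by (simp add: less_imp_le)
  qed
  have "(\<lambda>n. \<integral>\<omega>. f n \<omega> \<partial>M) \<longlonglongrightarrow> (\<integral>\<omega>. 0 \<partial>M)"
    by (rule integral_dominated_convergence[of _ _ _ "\<lambda>_. T"]) (use f0 fM fT in auto)
  then have lim: "(\<lambda>n. \<bar>C\<bar> * (\<integral>\<omega>. f n \<omega> \<partial>M)) \<longlonglongrightarrow> 0"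
    using tendsto_mult_right_zero by auto
  have "(\<lambda>n. \<integral>\<omega>. norm (u n \<omega>) \<partial>M) \<longlonglongrightarrow> 0"
  proof (rule tendsto_sandwich[OF _ _ tendsto_const lim])
    show "\<forall>\<^sub>F n in sequentially. 0 \<le> (\<integral>\<omega>. norm (u n \<omega>) \<partial>M)" by simp
    have "(\<integral>\<omega>. norm (u n \<omega>) \<partial>M) \<le> \<bar>C\<bar> * (\<integral>\<omega>. f n \<omega> \<partial>M)" for n
    proof -
      have "(\<integral>\<omega>. norm (u n \<omega>) \<partial>M) = (\<integral>\<omega>. u n \<omega> \<partial>M)" by (simp add: u_def)
      also have "\<dots> = (\<Sum>i<N n. v (n, i) * (\<integral>\<omega>. (g (n, i) \<omega>)\<^sup>2 \<partial>M))" by (rule u)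
      also have "\<dots> \<le> (\<Sum>i<N n. (\<bar>C\<bar> * cell_len q (n, i)) * (\<integral>\<omega>. (g (n, i) \<omega>)\<^sup>2 \<partial>M))"
      proof (intro sum_mono mult_right_mono)
        fix i assume i: "i \<in> {..<N n}"
        have "C * cell_len q (n, i) \<le> \<bar>C\<bar> * cell_len q (n, i)"
          using len[of i n] i by (intro mult_right_mono) auto
        then show "v (n, i) \<le> \<bar>C\<bar> * cell_len q (n, i)" using v[of i n] i by simp
      qed simp
      also have "\<dots> = \<bar>C\<bar> * (\<Sum>i<N n. \<integral>\<omega>. (g (n, i) \<omega>)\<^sup>2 * cell_len q (n, i) \<partial>M)"
        by (simp add: sum_distrib_left mult_ac)
      also have "\<dots> = \<bar>C\<bar> * (\<integral>\<omega>. f n \<omega> \<partial>M)"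
        unfolding f_def using ig2 by (subst Bochner_Integration.integral_sum) auto
      finally show ?thesis .
    qed
    then show "\<forall>\<^sub>F n in sequentially. (\<integral>\<omega>. norm (u n \<omega>) \<partial>M) \<le> \<bar>C\<bar> * (\<integral>\<omega>. f n \<omega> \<partial>M)"
      by simp
  qed
  from tendsto_L1_AE_subseq[OF u(1) this]
  obtain r where r: "strict_mono r" "AE \<omega> in M. (\<lambda>n. u (r n) \<omega>) \<longlonglongrightarrow> 0" by blast
  have "AE \<omega> in M. (\<lambda>n. \<Sum>i<N (r n). e (r n, i) \<omega> * Y (r n, i) \<omega>) \<longlonglongrightarrow> 0"
    using r(2) null
  proof eventually_elim
    case (elim \<omega>)
    have "\<forall>\<^sub>F n in sequentially. \<forall>i<N n. \<bar>e (n, i) \<omega>\<bar> < 1"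
      by (rule elim(2)[unfolded tendsto_cells_iff, rule_format, OF zero_less_one])
    then have "\<forall>\<^sub>F n in sequentially. \<forall>i<N (r n). \<bar>e (r n, i) \<omega>\<bar> < 1"
      by (rule eventually_subseq[OF r(1)])
    then have ev: "\<forall>\<^sub>F n in sequentially. \<bar>\<Sum>i<N (r n). g (r n, i) \<omega> * Y (r n, i) \<omega>\<bar> =
        \<bar>\<Sum>i<N (r n). e (r n, i) \<omega> * Y (r n, i) \<omega>\<bar>"
    proof eventually_elim
      case (elim n)
      have "g (r n, i) \<omega> = e (r n, i) \<omega>" if "i < N (r n)" for i
        using elim[rule_format, OF that] unfolding g_def by linarith
      then show ?case by simp
    qed
    have "(\<lambda>n. sqrt (u (r n) \<omega>)) \<longlonglongrightarrow> sqrt 0" by (intro tendsto_real_sqrt elim)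
    then have "(\<lambda>n. \<bar>\<Sum>i<N (r n). g (r n, i) \<omega> * Y (r n, i) \<omega>\<bar>) \<longlonglongrightarrow> 0"
      by (simp add: u_def)
    then have "(\<lambda>n. \<bar>\<Sum>i<N (r n). e (r n, i) \<omega> * Y (r n, i) \<omega>\<bar>) \<longlonglongrightarrow> 0"
      by (rule Lim_transform_eventually[OF _ ev])
    then show ?case by (simp add: tendsto_rabs_zero_iff)
  qed
  with r(1) show ?thesis by blast
qed

section \<open>Increments of a Wiener process\<close>

text \<open>Independence factors the expectations for every integrable \<open>g\<close>, so only two
  moments of \<open>f (X \<omega>)\<close> matter.\<close>

lemma (in prob_space) martingale_diff_indep:
  fixes X :: "'a \<Rightarrow> real" and f :: "real \<Rightarrow> real"
  assumes "\<And>g. g \<in> borel_measurable G \<Longrightarrow> indep_var borel g borel X"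
    and "f \<in> borel_measurable borel"
    and "has_bochner_integral M (\<lambda>\<omega>. f (X \<omega>)) 0" "has_bochner_integral M (\<lambda>\<omega>. (f (X \<omega>))\<^sup>2) v"
  shows "martingale_diff M G (\<lambda>\<omega>. f (X \<omega>)) v"
  unfolding martingale_diff_def
proof (intro ballI impI)
  fix g :: "'a \<Rightarrow> real" assume g: "g \<in> borel_measurable G" "integrable M g"
  have I: "indep_var borel (\<lambda>\<omega>. g \<omega>) borel (\<lambda>\<omega>. h (X \<omega>))" if "h \<in> borel_measurable borel" for h :: "real \<Rightarrow> real"
    using indep_var_compose[OF assms(1)[OF g(1)], of "\<lambda>x. x" borel h borel] that by (simp add: o_def)
  have I1: "indep_var borel (\<lambda>\<omega>. g \<omega>) borel (\<lambda>\<omega>. f (X \<omega>))"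
    and I2: "indep_var borel (\<lambda>\<omega>. g \<omega>) borel (\<lambda>\<omega>. (f (X \<omega>))\<^sup>2)"
    using I[of f] I[of "\<lambda>x. (f x)\<^sup>2"] assms(2) by auto
  have f: "integrable M (\<lambda>\<omega>. f (X \<omega>))" "integrable M (\<lambda>\<omega>. (f (X \<omega>))\<^sup>2)"
    "(\<integral>\<omega>. f (X \<omega>) \<partial>M) = 0" "(\<integral>\<omega>. (f (X \<omega>))\<^sup>2 \<partial>M) = v"
    using assms(3,4) by (auto simp: has_bochner_integral_iff)
  show "integrable M (\<lambda>\<omega>. g \<omega> * f (X \<omega>)) \<and> (\<integral>\<omega>. g \<omega> * f (X \<omega>) \<partial>M) = 0 \<and>
        integrable M (\<lambda>\<omega>. g \<omega> * (f (X \<omega>))\<^sup>2) \<and>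
        (\<integral>\<omega>. g \<omega> * (f (X \<omega>))\<^sup>2 \<partial>M) = v * (\<integral>\<omega>. g \<omega> \<partial>M)"
    using indep_var_integrable[OF I1 g(2) f(1)] indep_var_integrable[OF I2 g(2) f(2)]
      indep_var_lebesgue_integral[OF I1 g(2) f(1)] indep_var_lebesgue_integral[OF I2 g(2) f(2)] f
    by simp
qed

text \<open>Independence passes to smaller sigma-algebras: that of \<open>g\<close> lies in
  \<open>F s\<close>, and that of the first coordinate lies in the one generated by the pair of
  increments.\<close>

lemma (in filtered_prob_space) wiener_increment_indep:
  assumes "wiener_process_2 M F W W'" "0 \<le> s" "s < t" "g \<in> borel_measurable (F s)"
  shows "indep_var borel g borel (\<lambda>\<omega>. W t \<omega> - W s \<omega>)"
proof -
  let ?V = "\<lambda>\<omega>. (W t \<omega> - W s \<omega>, W' t \<omega> - W' s \<omega>)"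
  have ind: "indep_set (sets (F s)) (sets (vimage_algebra (space M) ?V (borel :: (real \<times> real) measure)))"
    and X: "(\<lambda>\<omega>. W t \<omega> - W s \<omega>) \<in> borel_measurable M"
    using assms(1-3) by (auto simp: wiener_process_2_def distributed_def)
  have a: "sigma_sets (space M) {g -` A \<inter> space M | A. A \<in> sets borel} \<subseteq> sets (F s)"
  proof -
    have "{g -` A \<inter> space M | A. A \<in> sets borel} \<subseteq> sets (F s)"
      using measurable_sets[OF assms(4)] space_F[of s] by auto
    from sets.sigma_sets_subset[OF this] show ?thesis by (simp only: space_F)
  qed
  have b: "sigma_sets (space M) {(\<lambda>\<omega>. W t \<omega> - W s \<omega>) -` A \<inter> space M | A. A \<in> sets borel}
      \<subseteq> sets (vimage_algebra (space M) ?V (borel :: (real \<times> real) measure))"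
  proof -
    have "(\<lambda>\<omega>. W t \<omega> - W s \<omega>) -` A \<inter> space M \<in> sets (vimage_algebra (space M) ?V (borel :: (real \<times> real) measure))"
      if "A \<in> sets borel" for A
    proof -
      \<comment> \<open>An event of the first coordinate is a rectangle event of the pair.\<close>
      have "A \<times> UNIV \<in> sets (borel :: (real \<times> real) measure)"
        using that by (intro borel_Times) auto
      then have "?V -` (A \<times> UNIV) \<inter> space M \<in> sets (vimage_algebra (space M) ?V (borel :: (real \<times> real) measure))"
        by (rule in_vimage_algebra)
      moreover have "?V -` (A \<times> UNIV) \<inter> space M = (\<lambda>\<omega>. W t \<omega> - W s \<omega>) -` A \<inter> space M" by auto
      ultimately show ?thesis by simp
    qed
    then have "{(\<lambda>\<omega>. W t \<omega> - W s \<omega>) -` A \<inter> space M | A. A \<in> sets borel}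
        \<subseteq> sets (vimage_algebra (space M) ?V (borel :: (real \<times> real) measure))" by blast
    from sets.sigma_sets_subset[OF this] show ?thesis by (simp only: space_vimage_algebra)
  qed
  have "indep_set (sigma_sets (space M) {g -` A \<inter> space M | A. A \<in> sets borel})
      (sigma_sets (space M) {(\<lambda>\<omega>. W t \<omega> - W s \<omega>) -` A \<inter> space M | A. A \<in> sets borel})"
    unfolding indep_set_def
    by (rule indep_sets_mono_sets[OF ind[unfolded indep_set_def]]) (simp add: a b split: bool.split)
  then show ?thesis
    unfolding indep_var_eq using measurable_F(2)[OF assms(4)] X by simp
qed

text \<open>With \<open>v = t - s\<close>, the Gaussian moments \<open>v\<close> and
  \<open>3 * v\<^sup>2\<close> of orders 2 and 4 give the squared increment the variance
  \<open>2 * v\<^sup>2\<close>. The scale \<open>c\<close> leaves room for a factor that grows as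
  the mesh shrinks.\<close>

lemma (in filtered_prob_space) wiener_increment_martingale_diff:
  assumes "wiener_process_2 M F W W'" "0 \<le> s" "s < t"
  shows "martingale_diff M (F s) (\<lambda>\<omega>. W t \<omega> - W s \<omega>) (t - s)"
    "martingale_diff M (F s) (\<lambda>\<omega>. c * ((W t \<omega> - W s \<omega>)\<^sup>2 - (t - s))) (2 * (c * (t - s))\<^sup>2)"
proof -
  define \<sigma> where "\<sigma> = sqrt (t - s)"
  have \<sigma>: "\<sigma> > 0" "\<sigma>\<^sup>2 = t - s" using assms by (auto simp: \<sigma>_def)
  let ?X = "\<lambda>\<omega>. W t \<omega> - W s \<omega>"
  have D: "distributed M lborel ?X (normal_density 0 \<sigma>)"
    using assms by (auto simp: wiener_process_2_def \<sigma>_def)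
  have transfer: "has_bochner_integral M (\<lambda>\<omega>. h (?X \<omega>)) a"
    if "h \<in> borel_measurable borel" "has_bochner_integral lborel (\<lambda>x. normal_density 0 \<sigma> x * h x) a"
    for h :: "real \<Rightarrow> real" and a
    using distributed_integrable[OF D, of h] distributed_integral[OF D, of h] that
    by (auto simp: has_bochner_integral_iff)
  have m1: "has_bochner_integral lborel (\<lambda>x. normal_density 0 \<sigma> x * x) 0"
    using normal_moment_odd[OF \<sigma>(1), of 0 0] by simp
  have m2: "has_bochner_integral lborel (\<lambda>x. normal_density 0 \<sigma> x * x\<^sup>2) (t - s)"
    using normal_moment_even[OF \<sigma>(1), of 0 1] \<sigma> by (simp add: power2_eq_square)
  have m4: "has_bochner_integral lborel (\<lambda>x. normal_density 0 \<sigma> x * x ^ 4) (3 * (t - s)\<^sup>2)"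
    using normal_moment_even[OF \<sigma>(1), of 0 2] \<sigma>
    by (simp add: fact_numeral power_divide)
  have m0: "has_bochner_integral lborel (\<lambda>x. normal_density 0 \<sigma> x) 1"
    using normal_moment_even[OF \<sigma>(1), of 0 0] by simp
  show "martingale_diff M (F s) (\<lambda>\<omega>. W t \<omega> - W s \<omega>) (t - s)"
    by (rule martingale_diff_indep[where f = "\<lambda>x. x"])
       (use wiener_increment_indep[OF assms] transfer[OF _ m1] transfer[OF _ m2] in auto)
  have 1: "has_bochner_integral lborel (\<lambda>x. normal_density 0 \<sigma> x * (c * (x\<^sup>2 - (t - s)))) 0"
    using has_bochner_integral_mult_right[OF has_bochner_integral_diff[OF m2 has_bochner_integral_mult_right[OF m0, of "t - s"]], of c]
    by (simp add: algebra_simps)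
  have 2: "has_bochner_integral lborel (\<lambda>x. normal_density 0 \<sigma> x * (c * (x\<^sup>2 - (t - s)))\<^sup>2) (2 * (c * (t - s))\<^sup>2)"
  proof -
    have "(\<lambda>x. normal_density 0 \<sigma> x * (c * (x\<^sup>2 - (t - s)))\<^sup>2) =
      (\<lambda>x. c\<^sup>2 * ((normal_density 0 \<sigma> x * x ^ 4 - (2 * (t - s)) * (normal_density 0 \<sigma> x * x\<^sup>2)) +
         (t - s)\<^sup>2 * normal_density 0 \<sigma> x))"
      by (intro ext) algebra
    moreover have "2 * (c * (t - s))\<^sup>2 = c\<^sup>2 * ((3 * (t - s)\<^sup>2 - (2 * (t - s)) * (t - s)) + (t - s)\<^sup>2 * 1)"
      by algebra
    ultimately show ?thesis
      by (simp only:) (intro has_bochner_integral_mult_right has_bochner_integral_add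
          has_bochner_integral_diff m0 m2 m4)
  qed
  show "martingale_diff M (F s) (\<lambda>\<omega>. c * ((W t \<omega> - W s \<omega>)\<^sup>2 - (t - s))) (2 * (c * (t - s))\<^sup>2)"
    by (rule martingale_diff_indep[where f = "\<lambda>x. c * (x\<^sup>2 - (t - s))"])
       (use wiener_increment_indep[OF assms] transfer[OF _ 1] transfer[OF _ 2] in auto)
qed

section \<open>Integrals against the price as limits of Euler sums\<close>

lemma fst_cells: "filterlim fst sequentially (cells N)"
  unfolding filterlim_iff eventually_cells by (auto elim: eventually_mono)

lemma pow_half_cells: "((\<lambda>p. (1 / 2 :: real) ^ fst p) \<longlongrightarrow> 0) (cells N)"
  by (rule filterlim_compose[OF _ fst_cells]) (auto intro: LIMSEQ_realpow_zero)

lemma tendsto_0_iff_smallo_1: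
  fixes f :: "'b \<Rightarrow> real"
  shows "(f \<longlongrightarrow> 0) G \<longleftrightarrow> f \<in> o[G](\<lambda>_. 1)"
  by (auto dest: smalloD_tendsto intro: smalloI_tendsto)

lemma tendsto_imp_bigo_1:
  fixes f :: "'b \<Rightarrow> real"
  assumes "(f \<longlongrightarrow> c) G"
  shows "f \<in> O[G](\<lambda>_. 1)"
  by (rule bigoI_tendsto[of _ _ c]) (use assms in auto)

lemma null_mult_bigo_1:
  fixes f g :: "'b \<Rightarrow> real"
  assumes "(f \<longlongrightarrow> 0) G" "g \<in> O[G](\<lambda>_. 1)"
  shows "((\<lambda>x. f x * g x) \<longlongrightarrow> 0) G" "((\<lambda>x. g x * f x) \<longlongrightarrow> 0) G"
  using landau_o.small_big_mult[of f G "\<lambda>_. 1" g "\<lambda>_. 1"]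
    landau_o.big_small_mult[of g G "\<lambda>_. 1" f "\<lambda>_. 1"] assms
  by (simp_all add: tendsto_0_iff_smallo_1)

text \<open>One Euler step of the cumulated return, formally dS / S = \<mu> dt + \<sigma>
  dW.\<close>

definition euler_incr :: "(nat \<Rightarrow> nat \<Rightarrow> real) \<Rightarrow> real \<Rightarrow> (real \<Rightarrow> real) \<Rightarrow> (real \<Rightarrow> real) \<Rightarrow> nat \<times> nat \<Rightarrow> real" where
  "euler_incr q \<sigma> \<mu> w = (\<lambda>p. cell_left q \<mu> p * cell_len q p + \<sigma> * cell_incr q w p)"

text \<open>Purely pathwise. From ds = s \<mu> dt + \<sigma> dj one gets \<alpha> ds = \<alpha> s
  \<mu> dt + \<sigma> \<alpha> dj. In the first term \<alpha> s may be replaced by \<alpha> \<beta>,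
  and the sums of \<alpha> dj are nearly those of \<alpha> \<beta> dw, so the common weight \<alpha>
  \<beta> factors out.\<close>

lemma euler_sum_limit:
  fixes \<alpha> \<beta> :: "nat \<times> nat \<Rightarrow> real"
  assumes grids: "fine_grids T N q"
    and cont: "continuous_on {0..T} H" "continuous_on {0..T} s" "continuous_on {0..T} \<mu>"
    and s: "\<And>t. t \<in> {0..T} \<Longrightarrow> s t = s0 + integral {0..t} (\<lambda>u. s u * \<mu> u) + \<sigma> * j t"
    and approx: "\<forall>\<^sub>F n in sequentially.
      (\<forall>i<N n. \<bar>\<alpha> (n, i) - H (q n (Suc i))\<bar> \<le> (1 / 2) ^ n \<and>
         \<bar>\<alpha> (n, i) * (\<beta> (n, i) - s (q n (Suc i)))\<bar> \<le> (1 / 2) ^ n) \<and>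
      (\<forall>k\<le>N n. \<bar>(\<Sum>i<k. \<alpha> (n, i) * (s (q n (Suc i)) - s (q n i))) - K (q n k)\<bar> \<le> (1 / 2) ^ n \<and>
         \<bar>(\<Sum>i<k. \<alpha> (n, i) * \<beta> (n, i) * (w (q n (Suc i)) - w (q n i))) -
            (\<Sum>i<k. \<alpha> (n, i) * (j (q n (Suc i)) - j (q n i)))\<bar> \<le> (1 / 2) ^ n)"
  shows "((\<lambda>p. \<alpha> p * \<beta> p - cell_left q (\<lambda>u. H u * s u) p) \<longlongrightarrow> 0) (cells N)"
    and "((\<lambda>(n, k). (\<Sum>i<k. \<alpha> (n, i) * \<beta> (n, i) * euler_incr q \<sigma> \<mu> w (n, i)) - K (q n k)) \<longlongrightarrow> 0)
      (cells (\<lambda>n. Suc (N n)))"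
proof -
  note g = fine_grids_grid[OF grids]
  \<comment> \<open>The simple processes are controlled at right ends, the Euler sums use left ends;
    the two differ by path increments, which vanish uniformly.\<close>
  let ?r = "\<lambda>f. \<lambda>(n, i). f (q n (Suc i))"
  have r_eq: "?r f p = cell_left q f p + cell_incr q f p" for f :: "real \<Rightarrow> real" and p
    by (simp add: cell_left_def cell_incr_def split: prod.split)
  have \<alpha>H: "((\<lambda>p. \<alpha> p - ?r H p) \<longlongrightarrow> 0) (cells N)"
    by (rule Lim_null_comparison[OF _ pow_half_cells])
       (use approx in \<open>auto simp: eventually_cells elim: eventually_mono\<close>)
  have \<alpha>\<beta>s: "((\<lambda>p. \<alpha> p * (\<beta> p - ?r s p)) \<longlongrightarrow> 0) (cells N)"
    by (rule Lim_null_comparison[OF _ pow_half_cells])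
       (use approx in \<open>auto simp: eventually_cells elim: eventually_mono\<close>)
  have sO: "cell_left q s \<in> O[cells N](\<lambda>_. 1)" and HO: "cell_left q H \<in> O[cells N](\<lambda>_. 1)"
    and \<mu>O: "cell_left q \<mu> \<in> O[cells N](\<lambda>_. 1)"
    using cell_left_bounded[OF grids] cont by auto
  have ds: "(cell_incr q s \<longlongrightarrow> 0) (cells N)" and dH: "(cell_incr q H \<longlongrightarrow> 0) (cells N)"
    using cell_incr_null[OF grids] cont by auto
  have \<alpha>H': "((\<lambda>p. \<alpha> p - cell_left q H p) \<longlongrightarrow> 0) (cells N)"
    using tendsto_add[OF \<alpha>H dH] unfolding r_eq by (simp add: algebra_simps)
  have \<alpha>O: "\<alpha> \<in> O[cells N](\<lambda>_. 1)"
    using sum_in_bigo(1)[OF tendsto_imp_bigo_1[OF \<alpha>H'] HO] by simp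
  have \<alpha>\<beta>s': "((\<lambda>p. \<alpha> p * \<beta> p - \<alpha> p * cell_left q s p) \<longlongrightarrow> 0) (cells N)"
    using tendsto_add[OF \<alpha>\<beta>s null_mult_bigo_1(2)[OF ds \<alpha>O]] unfolding r_eq
    by (simp add: algebra_simps)
  show "((\<lambda>p. \<alpha> p * \<beta> p - cell_left q (\<lambda>u. H u * s u) p) \<longlongrightarrow> 0) (cells N)"
    using tendsto_add[OF \<alpha>\<beta>s' null_mult_bigo_1(1)[OF \<alpha>H' sO]]
    by (simp add: algebra_simps cell_left_def case_prod_unfold)
  define B where "B t = integral {0..t} (\<lambda>u. s u * \<mu> u)" for t
  have B: "(\<lambda>p. cell_incr q B p - cell_left q (\<lambda>u. s u * \<mu> u) p * cell_len q p) \<in> o[cells N](cell_len q)"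
    unfolding B_def[abs_def] by (intro cell_integral_approx[OF grids] continuous_intros cont)
  \<comment> \<open>Error per cell when the weighted drift of the price is replaced by that of the
    Euler step. It is small against the cell length and so disappears in the sum.\<close>
  define f where "f p = \<alpha> p * \<beta> p * (cell_left q \<mu> p * cell_len q p) - \<alpha> p * cell_incr q B p" for p
  have "f \<in> o[cells N](cell_len q)"
  proof -
    have "((\<lambda>p. (\<alpha> p * \<beta> p - \<alpha> p * cell_left q s p) * cell_left q \<mu> p) \<longlongrightarrow> 0) (cells N)"
      by (rule null_mult_bigo_1[OF \<alpha>\<beta>s' \<mu>O])
    then have 1: "(\<lambda>p. ((\<alpha> p * \<beta> p - \<alpha> p * cell_left q s p) * cell_left q \<mu> p) * cell_len q p) \<in> o[cells N](\<lambda>p. 1 * cell_len q p)"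
      unfolding tendsto_0_iff_smallo_1 by (rule landau_o.small_big_mult) simp
    have 2: "(\<lambda>p. \<alpha> p * (cell_incr q B p - cell_left q (\<lambda>u. s u * \<mu> u) p * cell_len q p)) \<in> o[cells N](\<lambda>p. 1 * cell_len q p)"
      by (rule landau_o.big_small_mult[OF \<alpha>O B])
    have "f = (\<lambda>p. ((\<alpha> p * \<beta> p - \<alpha> p * cell_left q s p) * cell_left q \<mu> p) * cell_len q p -
        \<alpha> p * (cell_incr q B p - cell_left q (\<lambda>u. s u * \<mu> u) p * cell_len q p))"
      by (simp add: f_def fun_eq_iff cell_left_def algebra_simps)
    then show ?thesis using sum_in_smallo(2)[OF 1 2] by simp
  qed
  then have "f \<in> o[cells N](\<lambda>p. \<bar>cell_len q p\<bar>)" by simp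
  then have F: "((\<lambda>(n, k). \<Sum>i<k. f (n, i)) \<longlongrightarrow> 0) (cells (\<lambda>n. Suc (N n)))"
  proof (rule sum_cells_null)
    show "\<forall>\<^sub>F n in sequentially. (\<Sum>i<N n. \<bar>cell_len q (n, i)\<bar>) \<le> T"
      using sum_abs_cell_len[OF grids] by simp
  qed simp
  have E1: "((\<lambda>(n, k). (\<Sum>i<k. \<alpha> (n, i) * (s (q n (Suc i)) - s (q n i))) - K (q n k)) \<longlongrightarrow> 0) (cells (\<lambda>n. Suc (N n)))"
    by (rule Lim_null_comparison[OF _ pow_half_cells])
       (use approx in \<open>auto simp: eventually_cells less_Suc_eq_le elim: eventually_mono\<close>)
  have E2: "((\<lambda>(n, k). (\<Sum>i<k. \<alpha> (n, i) * \<beta> (n, i) * (w (q n (Suc i)) - w (q n i))) -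
      (\<Sum>i<k. \<alpha> (n, i) * (j (q n (Suc i)) - j (q n i)))) \<longlongrightarrow> 0) (cells (\<lambda>n. Suc (N n)))"
    by (rule Lim_null_comparison[OF _ pow_half_cells])
       (use approx in \<open>auto simp: eventually_cells less_Suc_eq_le elim: eventually_mono\<close>)
  have lim: "((\<lambda>p. (case p of (n, k) \<Rightarrow> \<Sum>i<k. f (n, i)) +
      (case p of (n, k) \<Rightarrow> (\<Sum>i<k. \<alpha> (n, i) * (s (q n (Suc i)) - s (q n i))) - K (q n k)) +
      \<sigma> * (case p of (n, k) \<Rightarrow> (\<Sum>i<k. \<alpha> (n, i) * \<beta> (n, i) * (w (q n (Suc i)) - w (q n i))) -
      (\<Sum>i<k. \<alpha> (n, i) * (j (q n (Suc i)) - j (q n i))))) \<longlongrightarrow> 0) (cells (\<lambda>n. Suc (N n)))"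
    using tendsto_add[OF tendsto_add[OF F E1] tendsto_mult[OF tendsto_const[of \<sigma>] E2]] by simp
  have eq: "(\<Sum>i<k. f (n, i)) + ((\<Sum>i<k. \<alpha> (n, i) * (s (q n (Suc i)) - s (q n i))) - K (q n k)) +
      \<sigma> * ((\<Sum>i<k. \<alpha> (n, i) * \<beta> (n, i) * (w (q n (Suc i)) - w (q n i))) -
      (\<Sum>i<k. \<alpha> (n, i) * (j (q n (Suc i)) - j (q n i)))) =
      (\<Sum>i<k. \<alpha> (n, i) * \<beta> (n, i) * euler_incr q \<sigma> \<mu> w (n, i)) - K (q n k)"
    if k: "k \<le> N n" for n k
  proof -
    have "f (n, i) + \<alpha> (n, i) * (s (q n (Suc i)) - s (q n i)) +
        \<sigma> * (\<alpha> (n, i) * \<beta> (n, i) * (w (q n (Suc i)) - w (q n i)) - \<alpha> (n, i) * (j (q n (Suc i)) - j (q n i))) =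
        \<alpha> (n, i) * \<beta> (n, i) * euler_incr q \<sigma> \<mu> w (n, i)" if "i < k" for i
    proof -
      have "q n i \<in> {0..T}" "q n (Suc i) \<in> {0..T}"
        using grid_bounds[OF g, of i n] grid_bounds[OF g, of "Suc i" n] that k by auto
      then have e: "s (q n (Suc i)) = s (q n i) + cell_incr q B (n, i) + \<sigma> * j (q n (Suc i)) - \<sigma> * j (q n i)"
        using s[of "q n i"] s[of "q n (Suc i)"] by (simp add: B_def cell_incr_def algebra_simps)
      show ?thesis
        unfolding e f_def euler_incr_def cell_incr_def[of q w] prod.case by (simp add: algebra_simps)
    qed
    then have "(\<Sum>i<k. f (n, i) + \<alpha> (n, i) * (s (q n (Suc i)) - s (q n i)) +
        \<sigma> * (\<alpha> (n, i) * \<beta> (n, i) * (w (q n (Suc i)) - w (q n i)) - \<alpha> (n, i) * (j (q n (Suc i)) - j (q n i)))) =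
        (\<Sum>i<k. \<alpha> (n, i) * \<beta> (n, i) * euler_incr q \<sigma> \<mu> w (n, i))"
      by (intro sum.cong) auto
    then show ?thesis
      by (simp add: sum.distrib sum_subtractf flip: sum_distrib_left)
  qed
  show "((\<lambda>(n, k). (\<Sum>i<k. \<alpha> (n, i) * \<beta> (n, i) * euler_incr q \<sigma> \<mu> w (n, i)) - K (q n k)) \<longlongrightarrow> 0)
      (cells (\<lambda>n. Suc (N n)))"
    by (rule Lim_transform_eventually[OF lim])
       (unfold eventually_cells, intro always_eventually allI impI, use eq in auto)
qed

lemma lborel_integral_eq:
  assumes "continuous_on {0..} (f :: real \<Rightarrow> real)" "0 \<le> a"
  shows "(LBINT u:{a..b}. f u) = integral {a..b} f"
  by (intro set_borel_integral_eq_integral borel_integrable_atLeastAtMost')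
     (use assms in \<open>auto intro: continuous_on_subset\<close>)

text \<open>At stage \<open>n\<close> the errors are at most \<open>(1 / 2) ^ n\<close> outside an
  event of probability below \<open>(1 / 2) ^ n\<close>. By Borel-Cantelli almost every path
  eventually satisfies all estimates, and the remaining argument is deterministic.\<close>

lemma stoch_integral_euler:
  assumes "filtered_prob_space M F" "has_stoch_integral M F H S K" "continuous_adapted M F \<mu>"
    "price_process M F W \<sigma> S0 \<mu> S" "T > 0"
  shows "\<exists>N q \<zeta>. fine_grids T N q \<and>
    (\<forall>n. \<forall>i<N n. \<zeta> (n, i) \<in> borel_measurable (F (q n i))) \<and>
    (AE \<omega> in M. ((\<lambda>p. \<zeta> p \<omega> - cell_left q (\<lambda>u. H u \<omega> * S u \<omega>) p) \<longlongrightarrow> 0) (cells N) \<and>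
       ((\<lambda>(n, k). (\<Sum>i<k. \<zeta> (n, i) \<omega> * euler_incr q \<sigma> (\<lambda>u. \<mu> u \<omega>) (\<lambda>u. W u \<omega>) (n, i)) - K (q n k) \<omega>)
          \<longlongrightarrow> 0) (cells (\<lambda>n. Suc (N n))))"
proof -
  interpret filtered_prob_space M F by fact
  obtain J where J: "has_stoch_integral M F S W J"
    "AE \<omega> in M. \<forall>t\<ge>0. S t \<omega> = S0 + (LBINT u:{0..t}. S u \<omega> * \<mu> u \<omega>) + \<sigma> * J t \<omega>"
    using assms(4) unfolding price_process_def by blast
  define P where "P n A N q \<alpha> \<beta> \<longleftrightarrow> A \<in> sets M \<and> measure M A < (1 / 2) ^ n \<and> grid T ((1 / 4) ^ n) N q \<and>
    (\<forall>i<N. \<alpha> i \<in> borel_measurable (F (q i)) \<and> \<beta> i \<in> borel_measurable (F (q i))) \<and>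
    (\<forall>\<omega>\<in>space M - A.
       (\<forall>i<N. \<bar>\<alpha> i \<omega> - H (q (Suc i)) \<omega>\<bar> \<le> (1 / 2) ^ n \<and> \<bar>\<alpha> i \<omega> * (\<beta> i \<omega> - S (q (Suc i)) \<omega>)\<bar> \<le> (1 / 2) ^ n) \<and>
       (\<forall>k\<le>N. \<bar>(\<Sum>i<k. \<alpha> i \<omega> * (S (q (Suc i)) \<omega> - S (q i) \<omega>)) - K (q k) \<omega>\<bar> \<le> (1 / 2) ^ n \<and>
          \<bar>(\<Sum>i<k. \<alpha> i \<omega> * \<beta> i \<omega> * (W (q (Suc i)) \<omega> - W (q i) \<omega>)) -
             (\<Sum>i<k. \<alpha> i \<omega> * (J (q (Suc i)) \<omega> - J (q i) \<omega>))\<bar> \<le> (1 / 2) ^ n))"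
    for n :: nat and A N q \<alpha> \<beta>
  have "\<exists>A N q \<alpha> \<beta>. P n A N q \<alpha> \<beta>" for n
    unfolding P_def by (rule stoch_integral_iterated_grid[OF assms(1,2) J(1) assms(5)]) auto
  then obtain A N q \<alpha> \<beta> where P: "\<And>n. P n (A n) (N n) (q n) (\<alpha> n) (\<beta> n)" by metis
  have A: "A n \<in> sets M" "measure M (A n) < (1 / 2) ^ n" and g: "grid T ((1 / 4) ^ n) (N n) (q n)" for n
    using P[of n] unfolding P_def by blast+
  have meas: "\<alpha> n i \<in> borel_measurable (F (q n i)) \<and> \<beta> n i \<in> borel_measurable (F (q n i))"
    if "i < N n" for n i
    using P[of n] that unfolding P_def by blast
  have appr: "(\<forall>i<N n. \<bar>\<alpha> n i \<omega> - H (q n (Suc i)) \<omega>\<bar> \<le> (1 / 2) ^ n \<and> \<bar>\<alpha> n i \<omega> * (\<beta> n i \<omega> - S (q n (Suc i)) \<omega>)\<bar> \<le> (1 / 2) ^ n) \<and>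
       (\<forall>k\<le>N n. \<bar>(\<Sum>i<k. \<alpha> n i \<omega> * (S (q n (Suc i)) \<omega> - S (q n i) \<omega>)) - K (q n k) \<omega>\<bar> \<le> (1 / 2) ^ n \<and>
          \<bar>(\<Sum>i<k. \<alpha> n i \<omega> * \<beta> n i \<omega> * (W (q n (Suc i)) \<omega> - W (q n i) \<omega>)) -
             (\<Sum>i<k. \<alpha> n i \<omega> * (J (q n (Suc i)) \<omega> - J (q n i) \<omega>))\<bar> \<le> (1 / 2) ^ n)"
    if "\<omega> \<in> space M - A n" for n \<omega>
    using P[of n] that unfolding P_def by blast
  have grids: "fine_grids T N q" using g by (simp add: fine_grids_def)
  have "summable (\<lambda>n. measure M (A n))"
    by (rule summable_comparison_test'[OF summable_geometric[of "1 / 2 :: real"], of 0])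
       (use A(2) in \<open>auto intro: less_imp_le\<close>)
  then have "AE \<omega> in M. \<forall>\<^sub>F n in sequentially. \<omega> \<in> space M - A n"
    using A(1) by (intro borel_cantelli_AE1) (auto simp: less_top[symmetric])
  moreover have "AE \<omega> in M. continuous_on {0..} (\<lambda>t. H t \<omega>)" "AE \<omega> in M. continuous_on {0..} (\<lambda>t. S t \<omega>)"
    "AE \<omega> in M. continuous_on {0..} (\<lambda>t. \<mu> t \<omega>)"
    using assms(2,3) by (auto simp: has_stoch_integral_def continuous_adapted_def)
  ultimately have lim: "AE \<omega> in M.
      ((\<lambda>p. \<alpha> (fst p) (snd p) \<omega> * \<beta> (fst p) (snd p) \<omega> - cell_left q (\<lambda>u. H u \<omega> * S u \<omega>) p) \<longlongrightarrow> 0) (cells N) \<and>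
      ((\<lambda>(n, k). (\<Sum>i<k. \<alpha> n i \<omega> * \<beta> n i \<omega> * euler_incr q \<sigma> (\<lambda>u. \<mu> u \<omega>) (\<lambda>u. W u \<omega>) (n, i)) - K (q n k) \<omega>)
          \<longlongrightarrow> 0) (cells (\<lambda>n. Suc (N n)))"
    using J(2)
  proof eventually_elim
    case (elim \<omega>)
    have sub: "{0..T} \<subseteq> {0..}" by auto
    have ev: "\<forall>\<^sub>F n in sequentially.
       (\<forall>i<N n. \<bar>\<alpha> n i \<omega> - H (q n (Suc i)) \<omega>\<bar> \<le> (1 / 2) ^ n \<and> \<bar>\<alpha> n i \<omega> * (\<beta> n i \<omega> - S (q n (Suc i)) \<omega>)\<bar> \<le> (1 / 2) ^ n) \<and>
       (\<forall>k\<le>N n. \<bar>(\<Sum>i<k. \<alpha> n i \<omega> * (S (q n (Suc i)) \<omega> - S (q n i) \<omega>)) - K (q n k) \<omega>\<bar> \<le> (1 / 2) ^ n \<and>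
          \<bar>(\<Sum>i<k. \<alpha> n i \<omega> * \<beta> n i \<omega> * (W (q n (Suc i)) \<omega> - W (q n i) \<omega>)) -
             (\<Sum>i<k. \<alpha> n i \<omega> * (J (q n (Suc i)) \<omega> - J (q n i) \<omega>))\<bar> \<le> (1 / 2) ^ n)"
      using elim(1) by (rule eventually_mono) (rule appr)
    have seq: "S t \<omega> = S0 + integral {0..t} (\<lambda>u. S u \<omega> * \<mu> u \<omega>) + \<sigma> * J t \<omega>" if "t \<in> {0..T}" for t
      using elim(5) that lborel_integral_eq[OF continuous_on_mult[OF elim(3,4)], of 0 t] by simp
    show ?case
      using euler_sum_limit[OF grids continuous_on_subset[OF elim(2) sub] continuous_on_subset[OF elim(3) sub]
          continuous_on_subset[OF elim(4) sub] seq, where \<alpha> = "\<lambda>p. \<alpha> (fst p) (snd p) \<omega>"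
          and \<beta> = "\<lambda>p. \<beta> (fst p) (snd p) \<omega>" and K = "\<lambda>t. K t \<omega>" and w = "\<lambda>t. W t \<omega>"] ev
      by simp
  qed
  show ?thesis
    by (rule exI[of _ N], rule exI[of _ q], rule exI[of _ "\<lambda>p \<omega>. \<alpha> (fst p) (snd p) \<omega> * \<beta> (fst p) (snd p) \<omega>"])
       (use grids meas lim in \<open>auto intro!: borel_measurable_times\<close>)
qed

section \<open>A discrete Ito formula\<close>

text \<open>The increments are of the order of the square root of the cell length, so the quadratic
  term contributes to the drift and only the cubic one may be dropped.\<close>

lemma exp_taylor_bigo:
  fixes h :: "'b \<Rightarrow> real"
  assumes "(h \<longlongrightarrow> 0) G"
  shows "(\<lambda>p. exp (h p) - 1 - h p - (h p)\<^sup>2 / 2) \<in> O[G](\<lambda>p. (h p) ^ 3)"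
    "(\<lambda>p. exp (h p) - 1) \<in> O[G](h)"
proof -
  have ev: "\<forall>\<^sub>F p in G. \<bar>h p\<bar> < 1"
    using tendstoD[OF assms, of 1] by simp
  have bound: "\<bar>exp x - 1 - x - x\<^sup>2 / 2\<bar> \<le> \<bar>x\<bar> ^ 3" if "\<bar>x\<bar> < 1" for x :: real
  proof -
    obtain t where t: "\<bar>t\<bar> \<le> \<bar>x\<bar>" "exp x = (\<Sum>m<3. x ^ m / fact m) + exp t / fact 3 * x ^ 3"
      using Maclaurin_exp_le by blast
    have eq: "exp x - 1 - x - x\<^sup>2 / 2 = exp t / 6 * x ^ 3"
      using t(2) by (simp add: eval_nat_numeral)
    have "exp t \<le> 3"
      using t(1) that exp_le by (smt (verit) exp_le_cancel_iff)
    then have "exp t / 6 * \<bar>x\<bar> ^ 3 \<le> 1 * \<bar>x\<bar> ^ 3" by (intro mult_right_mono) auto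
    then show ?thesis unfolding eq abs_mult power_abs by simp
  qed
  show 1: "(\<lambda>p. exp (h p) - 1 - h p - (h p)\<^sup>2 / 2) \<in> O[G](\<lambda>p. (h p) ^ 3)"
    by (rule bigoI[of _ 1]) (use ev bound in \<open>auto simp: power_abs elim: eventually_mono\<close>)
  have "\<bar>exp x - 1\<bar> \<le> 3 * \<bar>x\<bar>" if "\<bar>x\<bar> < 1" for x :: real
  proof -
    have "\<bar>x\<bar> ^ 3 \<le> \<bar>x\<bar> ^ 1" "\<bar>x\<bar> ^ 2 \<le> \<bar>x\<bar> ^ 1" using that by (intro power_decreasing; simp)+
    then show ?thesis using bound[OF that] by (simp only: power2_abs) (smt (verit) power_one_right zero_le_power2 field_sum_of_halves)
  qed
  then show "(\<lambda>p. exp (h p) - 1) \<in> O[G](h)"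
    by (intro bigoI[of _ 3]) (use ev in \<open>auto elim: eventually_mono\<close>)
qed

lemma riemann_sum_limit:
  assumes "fine_grids T N q" "continuous_on {0..T} f" "T > 0"
  shows "(\<lambda>n. \<Sum>i<N n. cell_left q f (n, i) * cell_len q (n, i)) \<longlonglongrightarrow> integral {0..T} f"
proof -
  define B where "B t = integral {0..t} f" for t
  have "(\<lambda>p. cell_incr q B p - cell_left q f p * cell_len q p) \<in> o[cells N](\<lambda>p. \<bar>cell_len q p\<bar>)"
    using cell_integral_approx[OF assms(1,2)] by (simp add: B_def[abs_def])
  then have "((\<lambda>(n, k). \<Sum>i<k. cell_incr q B (n, i) - cell_left q f (n, i) * cell_len q (n, i)) \<longlongrightarrow> 0)
      (cells (\<lambda>n. Suc (N n)))"
    by (rule sum_cells_null[where C = T]) (use sum_abs_cell_len[OF assms(1)] in auto)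
  from tendsto_cells_Suc(3)[OF this]
  have "(\<lambda>n. (\<Sum>i<N n. cell_incr q B (n, i)) - (\<Sum>i<N n. cell_left q f (n, i) * cell_len q (n, i))) \<longlonglongrightarrow> 0"
    by (simp add: sum_subtractf)
  moreover have "(\<Sum>i<N n. cell_incr q B (n, i)) = integral {0..T} f" for n
  proof -
    have "(\<Sum>i<N n. cell_incr q B (n, i)) = B (q n (N n)) - B (q n 0)"
      unfolding cell_incr_def prod.case by (rule sum_lessThan_telescope)
    then show ?thesis using fine_grids_grid[OF assms(1), of n] by (simp add: grid_def B_def)
  qed
  ultimately have "(\<lambda>n. integral {0..T} f - (\<Sum>i<N n. cell_left q f (n, i) * cell_len q (n, i))) \<longlonglongrightarrow> 0"
    by simp
  from tendsto_diff[OF tendsto_const[of "integral {0..T} f"] this] show ?thesis by simp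
qed

text \<open>As \<open>a\<close> is nonnegative, the quadratic term can only decrease the
  exponential; it remains to bound the drift sum.\<close>

lemma exp_minus_sum_bounded:
  fixes z :: "nat \<times> nat \<Rightarrow> real"
  assumes "fine_grids T N q" "continuous_on {0..T} b" "a \<ge> 0"
    and z: "\<And>n k. z (n, k) = exp (- (a * (y (q n k))\<^sup>2 + (\<Sum>i<k. b (q n i) * cell_len q (n, i))))"
  shows "z \<in> O[cells N](\<lambda>_. 1)"
proof -
  have "(\<lambda>p. cell_left q b p * cell_len q p) \<in> O[cells N](\<lambda>p. \<bar>cell_len q p\<bar>)"
    using landau_o.big_mult[OF cell_left_bounded[OF assms(1,2)] landau_o.big_refl[of "cell_len q"]] by simp
  then obtain D where D: "\<forall>\<^sub>F n in sequentially. \<forall>k\<le>N n. \<bar>\<Sum>i<k. cell_left q b (n, i) * cell_len q (n, i)\<bar> \<le> D"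
    using sum_cells_bound[of _ N "\<lambda>p. \<bar>cell_len q p\<bar>" T] sum_abs_cell_len[OF assms(1)] by auto
  show ?thesis
  proof (rule bigoI[of _ "exp D"])
    show "\<forall>\<^sub>F p in cells N. norm (z p) \<le> exp D * norm (1::real)"
      unfolding eventually_cells using D
    proof eventually_elim
      case (elim n)
      { fix i assume "i < N n"
        then have "\<bar>\<Sum>j<i. b (q n j) * cell_len q (n, j)\<bar> \<le> D"
          using elim by (simp add: cell_left_def)
        moreover have "a * (y (q n i))\<^sup>2 \<ge> 0" using assms(3) by simp
        ultimately have "z (n, i) \<le> exp D" unfolding z by simp }
      then show ?case by (auto simp: z)
    qed
  qed
qed

text \<open>
  The summed increments of \<open>p z\<close> are the hypotheses \<open>quad\<close> and \<open>mart\<close> up to terms negligible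
  against \<open>s\<^sup>2 = dw\<^sup>2 + d\<close>; the choice of \<open>b\<close> is what makes the remaining drift vanish.
\<close>

lemma discrete_ito:
  fixes \<zeta> p z e G :: "nat \<times> nat \<Rightarrow> real" and w \<mu> y P b :: "real \<Rightarrow> real"
  assumes grids: "fine_grids T N q" and "T > 0" "\<tau> > 0" "a \<ge> 0"
    and cont: "continuous_on {0..T} w" "continuous_on {0..T} \<mu>" "continuous_on {0..T} y"
      "continuous_on {0..T} P" "continuous_on {0..T} b"
    and y: "\<And>t. t \<in> {0..T} \<Longrightarrow>
      y t = - (1 / \<tau>) * integral {0..t} y + (1 / \<tau>) * (integral {0..t} \<mu> + \<sigma> * w t)"
    and w0: "w 0 = 0"
    and a: "2 * a = c * \<tau>"
    and b: "\<And>t. b t = c * (y t)\<^sup>2 - (a * \<sigma>\<^sup>2 / \<tau>\<^sup>2 + c\<^sup>2 * \<sigma>\<^sup>2 * (y t)\<^sup>2 / 2)"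
    and p: "\<And>n k. p (n, k) = x + (\<Sum>i<k. \<zeta> (n, i) * euler_incr q \<sigma> \<mu> w (n, i))"
    and z: "\<And>n k. z (n, k) = exp (- (a * (y (q n k))\<^sup>2 + (\<Sum>i<k. b (q n i) * cell_len q (n, i))))"
    and e: "\<And>n i. e (n, i) = \<zeta> (n, i) - c * y (q n i) * p (n, i)"
    and G: "\<And>n i. G (n, i) = a * \<sigma>\<^sup>2 / \<tau>\<^sup>2 + c\<^sup>2 * \<sigma>\<^sup>2 * (y (q n i))\<^sup>2 / 2"
    and pP: "((\<lambda>(n, k). p (n, k) - P (q n k)) \<longlongrightarrow> 0) (cells (\<lambda>n. Suc (N n)))"
    and \<zeta>: "(e \<longlongrightarrow> 0) (cells N)"
    and quad1: "(\<lambda>n. \<Sum>i<N n. (cell_incr q w (n, i))\<^sup>2 - cell_len q (n, i)) \<longlonglongrightarrow> 0"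
    and quad: "(\<lambda>n. \<Sum>i<N n. p (n, i) * z (n, i) * G (n, i) * ((cell_incr q w (n, i))\<^sup>2 - cell_len q (n, i))) \<longlonglongrightarrow> 0"
    and mart: "(\<lambda>n. \<Sum>i<N n. e (n, i) * z (n, i) * cell_incr q w (n, i)) \<longlonglongrightarrow> 0"
  shows "P T * exp (- (a * (y T)\<^sup>2 + integral {0..T} b)) = x"
proof -
  note g = fine_grids_grid[OF grids]
  define d where "d = cell_len q"
  define dw where "dw = cell_incr q w"
  define dy where "dy = cell_incr q y"
  define Y where "Y = cell_left q y"
  define U where "U = cell_left q \<mu>"
  define r where "r = euler_incr q \<sigma> \<mu> w"
  \<comment> \<open>The Brownian scale of a cell: \<open>dw\<close> is of first order in
    \<open>s\<close> and \<open>d\<close> of second order. Sums of \<open>s p * s p\<close> stay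
    bounded, so third-order terms vanish in the sum. The absolute value keeps the root meaningful at
    indices outside the partition.\<close>
  define s where "s p = sqrt ((dw p)\<^sup>2 + \<bar>d p\<bar>)" for p
  have s0: "s p \<ge> 0" and ss: "s p * s p = (dw p)\<^sup>2 + \<bar>d p\<bar>" for p
    by (simp_all add: s_def)
  have dnn: "d (n, i) > 0" if "i < N n" for n i
    using cell_len_pos[OF grids that] by (simp add: d_def)
  let ?O = "\<lambda>f. O[cells N](f)" and ?o = "\<lambda>f. o[cells N](f)"
  let ?s2 = "\<lambda>p. s p * s p"
  have "((\<lambda>p. sqrt ((dw p)\<^sup>2 + \<bar>d p\<bar>)) \<longlongrightarrow> sqrt (0\<^sup>2 + \<bar>0\<bar>)) (cells N)"
    unfolding dw_def d_def
    by (intro tendsto_intros cell_incr_null[OF grids cont(1)] cell_len_null[OF grids])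
  then have s_null: "(s \<longlongrightarrow> 0) (cells N)" by (simp add: s_def[abs_def])
  then have s_o1: "s \<in> ?o (\<lambda>_. 1)" by (simp add: tendsto_0_iff_smallo_1)
  have s_O1: "s \<in> ?O (\<lambda>_. 1)" by (rule tendsto_imp_bigo_1[OF s_null])
  have s2_Os: "?s2 \<in> ?O s"
    using landau_o.big_mult[OF s_O1 landau_o.big_refl[of s]] by simp
  have s3_os2: "(\<lambda>p. s p * s p * s p) \<in> ?o ?s2"
    using landau_o.big_small_mult[OF landau_o.big_refl[of ?s2] s_o1] by simp
  have dw_O: "dw \<in> ?O s"
    by (rule bigoI[of _ 1]) (auto simp: s_def intro!: always_eventually real_le_rsqrt)
  have d_O: "d \<in> ?O ?s2"
    by (rule bigoI[of _ 1]) (simp add: ss)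
  have Y_O: "Y \<in> ?O (\<lambda>_. 1)" and U_O: "U \<in> ?O (\<lambda>_. 1)"
    and P_O: "cell_left q P \<in> ?O (\<lambda>_. 1)" and b_O: "cell_left q b \<in> ?O (\<lambda>_. 1)"
    unfolding Y_def U_def using cell_left_bounded[OF grids] cont by auto
  have Ud_O: "(\<lambda>p. U p * d p) \<in> ?O ?s2" and Yd_O: "(\<lambda>p. Y p * d p) \<in> ?O ?s2"
    and bd_O: "(\<lambda>p. cell_left q b p * d p) \<in> ?O ?s2"
    using landau_o.big_mult[OF U_O d_O] landau_o.big_mult[OF Y_O d_O] landau_o.big_mult[OF b_O d_O] by simp_all
  have r_eq: "r p = U p * d p + \<sigma> * dw p" for p
    by (simp add: r_def euler_incr_def U_def d_def dw_def)
  have \<sigma>dw_O: "(\<lambda>p. k * dw p) \<in> ?O s" for k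
    using landau_o.big_mult[OF landau_o.big_refl[of "\<lambda>_. 1"] dw_O] dw_O
    by (cases "k = 0") auto
  have r_O: "r \<in> ?O s"
    unfolding r_eq[abs_def] using landau_o.big_trans[OF Ud_O s2_Os] \<sigma>dw_O by (rule sum_in_bigo)
  \<comment> \<open>The cost of freezing \<open>\<mu>\<close> and \<open>y\<close> at the left end
    of the cell.\<close>
  define \<theta> where "\<theta> p = (cell_incr q (\<lambda>t. integral {0..t} \<mu>) p - U p * d p) -
      (cell_incr q (\<lambda>t. integral {0..t} y) p - Y p * d p)" for p
  have \<theta>_o: "\<theta> \<in> ?o ?s2"
    unfolding \<theta>_def[abs_def] U_def Y_def d_def
    by (intro sum_in_smallo landau_o.small_big_trans[OF cell_integral_approx[OF grids]]
        cont d_O[unfolded d_def])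
  have dy_eq: "\<tau> * dy (n, i) = r (n, i) - Y (n, i) * d (n, i) + \<theta> (n, i)" if i: "i < N n" for n i
  proof -
    have t: "q n i \<in> {0..T}" "q n (Suc i) \<in> {0..T}"
      using grid_bounds[OF g, of i n] grid_bounds[OF g, of "Suc i" n] i by auto
    have "\<tau> * y t = - integral {0..t} y + (integral {0..t} \<mu> + \<sigma> * w t)" if "t \<in> {0..T}" for t
      by (subst y[OF that]) (use \<open>\<tau> > 0\<close> in \<open>simp add: field_simps\<close>)
    from this[OF t(1)] this[OF t(2)] show ?thesis
      by (simp add: r_eq \<theta>_def dy_def cell_incr_def dw_def algebra_simps)
  qed
  \<comment> \<open>\<open>h\<close> is the exact increment of the exponent of \<open>z\<close>, and
    \<open>u\<close> is the relative increment of \<open>p\<close> when \<open>e\<close> is 0. In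
    \<open>v\<close> the contributions of \<open>r\<close> cancel, because
    \<open>\<tau> * dy\<close> contains \<open>r\<close> with coefficient 1; so \<open>v\<close> is
    of second order.\<close>
  define h where "h p = - (c * Y p * (\<tau> * dy p) + a * (dy p)\<^sup>2 + cell_left q b p * d p)" for p
  define u where "u p = c * Y p * r p" for p
  define v where "v p = h p + u p" for p
  have zstep: "z (n, Suc i) = z (n, i) * exp (h (n, i))" for n i
  proof -
    have "(y (q n (Suc i)))\<^sup>2 = (Y (n, i))\<^sup>2 + 2 * Y (n, i) * dy (n, i) + (dy (n, i))\<^sup>2"
      by (simp add: Y_def dy_def cell_left_def cell_incr_def power2_eq_square algebra_simps)
    moreover have "a * (2 * Y (n, i) * dy (n, i)) = c * Y (n, i) * (\<tau> * dy (n, i))"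
      using a by (simp add: algebra_simps)
    ultimately have "a * (y (q n (Suc i)))\<^sup>2 = a * (y (q n i))\<^sup>2 + c * Y (n, i) * (\<tau> * dy (n, i)) + a * (dy (n, i))\<^sup>2"
      by (simp add: Y_def cell_left_def distrib_left)
    then show ?thesis
      unfolding z exp_add[symmetric] by (simp add: h_def cell_left_def d_def)
  qed
  \<comment> \<open>Agrees with \<open>\<tau> * dy\<close> on actual cells, that is, eventually
    along the filter, but is a closed formula at all indices.\<close>
  define \<eta> where "\<eta> p = r p - Y p * d p + \<theta> p" for p
  have dy_ev: "\<forall>\<^sub>F p in cells N. \<tau> * dy p = \<eta> p"
    unfolding eventually_cells \<eta>_def using dy_eq by (intro always_eventually) auto
  have \<theta>_O: "\<theta> \<in> ?O ?s2" using \<theta>_o by (rule landau_o.small_imp_big)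
  have \<eta>_O: "\<eta> \<in> ?O s"
    unfolding \<eta>_def[abs_def]
    by (intro sum_in_bigo r_O landau_o.big_trans[OF Yd_O s2_Os] landau_o.big_trans[OF \<theta>_O s2_Os])
  have \<eta>w_O: "(\<lambda>p. \<eta> p - \<sigma> * dw p) \<in> ?O ?s2"
  proof -
    have "(\<lambda>p. \<eta> p - \<sigma> * dw p) = (\<lambda>p. U p * d p - Y p * d p + \<theta> p)"
      by (simp add: \<eta>_def r_eq fun_eq_iff)
    also have "\<dots> \<in> ?O ?s2" by (intro sum_in_bigo Ud_O Yd_O \<theta>_O)
    finally show ?thesis .
  qed
  \<comment> \<open>The difference of the squares factors into a second-order and a first-order
    term.\<close>
  have sq_o: "(\<lambda>p. (f p)\<^sup>2 - (\<sigma> * dw p)\<^sup>2) \<in> ?o ?s2"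
    if "f \<in> ?O s" "(\<lambda>p. f p - \<sigma> * dw p) \<in> ?O ?s2" for f
  proof -
    have "(\<lambda>p. (f p - \<sigma> * dw p) * (f p + \<sigma> * dw p)) \<in> ?O (\<lambda>p. s p * s p * s p)"
      by (rule landau_o.big_mult[OF that(2) sum_in_bigo(1)[OF that(1) \<sigma>dw_O]])
    then show ?thesis using landau_o.big_small_trans[OF _ s3_os2]
      by (simp add: power2_eq_square algebra_simps)
  qed
  have one_mult: "(\<lambda>p. f p * k p) \<in> ?O l" if "f \<in> ?O (\<lambda>_. 1)" "k \<in> ?O l" for f k l
    using landau_o.big_mult[OF that] by simp
  have one_mult_o: "(\<lambda>p. f p * k p) \<in> ?o l" if "f \<in> ?O (\<lambda>_. 1)" "k \<in> ?o l" for f k l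
    using landau_o.big_small_mult[OF that] by simp
  have const_O: "(\<lambda>_. k) \<in> ?O (\<lambda>_. 1)" for k :: real by simp
  have cY_O: "(\<lambda>p. c * Y p) \<in> ?O (\<lambda>_. 1)" by (rule one_mult[OF const_O Y_O])
  have u_O: "u \<in> ?O s" unfolding u_def[abs_def] by (rule one_mult[OF cY_O r_O])
  define v' where "v' p = c * (Y p)\<^sup>2 * d p - c * Y p * \<theta> p - a / \<tau>\<^sup>2 * (\<eta> p)\<^sup>2 - cell_left q b p * d p" for p
  have v_ev: "\<forall>\<^sub>F p in cells N. v p = v' p"
    using dy_ev
  proof eventually_elim
    case (elim p)
    have "dy p = \<eta> p / \<tau>" using elim \<open>\<tau> > 0\<close> by (simp add: field_simps)
    then have sq: "a * (dy p)\<^sup>2 = a / \<tau>\<^sup>2 * (\<eta> p)\<^sup>2" by (simp add: power_divide)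
    have "c * Y p * \<eta> p = c * Y p * r p - c * (Y p)\<^sup>2 * d p + c * Y p * \<theta> p"
      by (simp add: \<eta>_def power2_eq_square algebra_simps)
    then show ?case
      unfolding v_def h_def u_def v'_def elim sq by simp
  qed
  have \<eta>2_O: "(\<lambda>p. (\<eta> p)\<^sup>2) \<in> ?O ?s2"
    using landau_o.big_mult[OF \<eta>_O \<eta>_O] by (simp add: power2_eq_square)
  have Y2_O: "(\<lambda>p. (Y p)\<^sup>2) \<in> ?O (\<lambda>_. 1)"
    using one_mult[OF Y_O Y_O] by (simp add: power2_eq_square)
  have "v' \<in> ?O ?s2"
    unfolding v'_def[abs_def]
    by (intro sum_in_bigo bd_O one_mult[OF one_mult[OF const_O Y2_O] d_O] one_mult[OF cY_O \<theta>_O]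
        one_mult[OF const_O \<eta>2_O])
  then have v_O: "v \<in> ?O ?s2" using landau_o.big.in_cong[OF v_ev] by blast
  have h_eq: "h p = v p - u p" for p by (simp add: v_def)
  have h_O: "h \<in> ?O s"
    unfolding h_eq[abs_def] using landau_o.big_trans[OF v_O s2_Os] u_O by (rule sum_in_bigo)
  have h_null: "(h \<longlongrightarrow> 0) (cells N)"
    unfolding tendsto_0_iff_smallo_1 by (rule landau_o.big_small_trans[OF h_O s_o1])
  define \<rho> where "\<rho> p = exp (h p) - 1 - h p - (h p)\<^sup>2 / 2" for p
  have \<rho>_o: "\<rho> \<in> ?o ?s2"
  proof -
    have "(\<lambda>p. (h p) ^ 3) \<in> ?O (\<lambda>p. s p * s p * s p)"
      using landau_o.big_mult[OF landau_o.big_mult[OF h_O h_O] h_O] by (simp add: power3_eq_cube)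
    then have "\<rho> \<in> ?O (\<lambda>p. s p * s p * s p)"
      unfolding \<rho>_def[abs_def] by (rule landau_o.big_trans[OF exp_taylor_bigo(1)[OF h_null]])
    then show ?thesis using s3_os2 by (rule landau_o.big_small_trans)
  qed
  have v2_o: "(\<lambda>p. v p * v p) \<in> ?o ?s2"
  proof -
    have "v \<in> ?o (\<lambda>_. 1)" using landau_o.big_small_trans[OF landau_o.big_trans[OF v_O s2_Os] s_o1] .
    from landau_o.small_big_mult[OF this v_O] show ?thesis by simp
  qed
  have uh2_o: "(\<lambda>p. u p * (h p * h p)) \<in> ?o ?s2"
    using landau_o.big_small_trans[OF landau_o.big_mult[OF landau_o.big_mult[OF h_O h_O] u_O] s3_os2]
    by (simp add: mult_ac)
  have u1_O: "(\<lambda>p. 1 + u p) \<in> ?O (\<lambda>_. 1)"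
    using sum_in_bigo(1)[OF const_O[of 1] landau_o.big_trans[OF u_O s_O1]] by simp
  \<comment> \<open>The relative increment of \<open>p * z\<close> when \<open>e\<close> is 0.
    Inserting \<open>h = v - u\<close> into the second-order expansion, the products
    \<open>u * v\<close> cancel, and \<open>v - u\<^sup>2 / 2\<close> is the only part that is not
    negligible.\<close>
  define \<beta> where "\<beta> p = (1 + u p) * exp (h p) - 1" for p
  have \<beta>_eq: "\<beta> p = (v p - (u p)\<^sup>2 / 2) + ((v p * v p) * (1 / 2) + (u p * (h p * h p)) * (1 / 2) + (1 + u p) * \<rho> p)" for p
  proof -
    have eq: "exp (h p) = 1 + h p + (h p)\<^sup>2 / 2 + \<rho> p" by (simp add: \<rho>_def)
    show ?thesis unfolding \<beta>_def eq by (simp add: h_eq power2_eq_square field_simps)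
  qed
  have \<beta>_o: "(\<lambda>p. (v p * v p) * (1 / 2) + (u p * (h p * h p)) * (1 / 2) + (1 + u p) * \<rho> p) \<in> ?o ?s2"
    using v2_o uh2_o one_mult_o[OF u1_O \<rho>_o] by (intro sum_in_smallo) auto
  \<comment> \<open>By the choice of \<open>b\<close> all remaining multiples of \<open>d\<close>
    cancel. What is left compares the squares of \<open>\<eta>\<close> and \<open>r\<close> with
    their Brownian part, besides the freezing error \<open>\<theta>\<close>.\<close>
  have drift_eq: "v' p - (u p)\<^sup>2 / 2 + G p * ((dw p)\<^sup>2 - d p) =
      (- 1) * ((c * Y p) * \<theta> p) - (a / \<tau>\<^sup>2) * ((\<eta> p)\<^sup>2 - (\<sigma> * dw p)\<^sup>2)
        - ((c\<^sup>2 / 2) * (Y p)\<^sup>2) * ((r p)\<^sup>2 - (\<sigma> * dw p)\<^sup>2)" for p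
  proof (cases p)
    case (Pair n i)
    have bY: "cell_left q b p = c * (Y p)\<^sup>2 - G p"
      unfolding Pair G by (simp add: cell_left_def b Y_def)
    have G': "G p = a * \<sigma>\<^sup>2 / \<tau>\<^sup>2 + c\<^sup>2 * \<sigma>\<^sup>2 * (Y p)\<^sup>2 / 2"
      unfolding Pair G by (simp add: cell_left_def Y_def)
    have "v' p + G p * ((dw p)\<^sup>2 - d p) = - (c * Y p * \<theta> p) - a / \<tau>\<^sup>2 * (\<eta> p)\<^sup>2 + G p * (dw p)\<^sup>2"
      unfolding v'_def bY by (simp add: algebra_simps)
    then show ?thesis
      unfolding G' u_def by (simp add: power_mult_distrib algebra_simps)
  qed
  have drift_o: "(\<lambda>p. v' p - (u p)\<^sup>2 / 2 + G p * ((dw p)\<^sup>2 - d p)) \<in> ?o ?s2"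
  proof -
    have rw: "(\<lambda>p. r p - \<sigma> * dw p) \<in> ?O ?s2" using Ud_O by (simp add: r_eq)
    show ?thesis unfolding drift_eq
      by (intro sum_in_smallo one_mult_o[OF const_O] one_mult_o[OF cY_O \<theta>_o] sq_o \<eta>_O \<eta>w_O r_O rw
          one_mult_o[OF one_mult[OF const_O Y2_O]])
  qed
  have \<beta>G_o: "(\<lambda>p. \<beta> p + G p * ((dw p)\<^sup>2 - d p)) \<in> ?o ?s2"
  proof -
    have "(\<lambda>p. v p - (u p)\<^sup>2 / 2 + G p * ((dw p)\<^sup>2 - d p)) \<in> ?o ?s2"
      using landau_o.small.in_cong[of "\<lambda>p. v p - (u p)\<^sup>2 / 2 + G p * ((dw p)\<^sup>2 - d p)"
          "\<lambda>p. v' p - (u p)\<^sup>2 / 2 + G p * ((dw p)\<^sup>2 - d p)" "cells N" ?s2] drift_o v_ev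
      by (auto elim: eventually_mono)
    from sum_in_smallo(1)[OF this \<beta>_o] show ?thesis unfolding \<beta>_eq by (simp add: algebra_simps)
  qed
  have p_O: "p \<in> ?O (\<lambda>_. 1)"
  proof -
    have "((\<lambda>t. p t - cell_left q P t) \<longlongrightarrow> 0) (cells N)"
      using tendsto_cells_Suc(1)[OF pP] by (simp add: cell_left_def case_prod_unfold)
    from sum_in_bigo(1)[OF tendsto_imp_bigo_1[OF this] P_O] show ?thesis by simp
  qed
  have sum_d: "(\<Sum>i<N n. \<bar>d (n, i)\<bar>) = T" for n
    using sum_abs_cell_len[OF grids] by (simp add: d_def)
  have z_O: "z \<in> ?O (\<lambda>_. 1)"
    by (rule exp_minus_sum_bounded[OF grids cont(5) \<open>a \<ge> 0\<close> z])
  have pz_O: "(\<lambda>t. p t * z t) \<in> ?O (\<lambda>_. 1)" by (rule one_mult[OF p_O z_O])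
  have e_o: "e \<in> ?o (\<lambda>_. 1)" using \<zeta> by (simp add: tendsto_0_iff_smallo_1)
  have ez_o: "(\<lambda>t. e t * z t) \<in> ?o (\<lambda>_. 1)"
    using landau_o.small_big_mult[OF e_o z_O] by simp
  \<comment> \<open>Collects what is absolutely negligible. The term in \<open>e * z * dw\<close>
    stays outside: \<open>e\<close> is small, but the sums of \<open>\<bar>dw\<bar>\<close> need not
    be bounded, so it is left to \<open>mart\<close>.\<close>
  define f where "f t = p t * z t * (\<beta> t + G t * ((dw t)\<^sup>2 - d t)) + (e t * z t) * (U t * d t) +
      (e t * z t) * (r t * (exp (h t) - 1))" for t
  have f_o: "f \<in> ?o ?s2"
  proof -
    have "(\<lambda>t. (e t * z t) * (U t * d t)) \<in> ?o ?s2"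
      using landau_o.small_big_mult[OF ez_o Ud_O] by simp
    moreover have "(\<lambda>t. (e t * z t) * (r t * (exp (h t) - 1))) \<in> ?o ?s2"
      using landau_o.small_big_mult[OF ez_o landau_o.big_mult[OF r_O
            landau_o.big_trans[OF exp_taylor_bigo(2)[OF h_null] h_O]]] by simp
    ultimately show ?thesis
      unfolding f_def[abs_def] by (intro sum_in_smallo one_mult_o[OF pz_O \<beta>G_o])
  qed
  have incr: "p (n, Suc i) * z (n, Suc i) - p (n, i) * z (n, i) =
      f (n, i) - p (n, i) * z (n, i) * G (n, i) * ((dw (n, i))\<^sup>2 - d (n, i)) +
      \<sigma> * (e (n, i) * z (n, i) * dw (n, i))" for n i
  proof -
    let ?t = "(n, i)"
    have "\<zeta> ?t = e ?t + c * Y ?t * p ?t" unfolding e by (simp add: Y_def cell_left_def)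
    then have "p (n, Suc i) = p ?t + (e ?t + c * Y ?t * p ?t) * r ?t" by (simp add: p r_def)
    then have "p (n, Suc i) * z (n, Suc i) - p ?t * z ?t =
        p ?t * z ?t * \<beta> ?t + (e ?t * z ?t) * (r ?t + r ?t * (exp (h ?t) - 1))"
      unfolding zstep \<beta>_def u_def by (simp add: algebra_simps)
    then show ?thesis unfolding f_def by (simp add: r_eq algebra_simps)
  qed
  \<comment> \<open>By \<open>quad1\<close> the squared increments sum to nearly \<open>T\<close>,
    which bounds the total weight of the remainders.\<close>
  have bound: "\<forall>\<^sub>F n in sequentially. (\<Sum>i<N n. s (n, i) * s (n, i)) \<le> 2 * T + 1"
  proof -
    have "\<forall>\<^sub>F n in sequentially. (\<Sum>i<N n. (dw (n, i))\<^sup>2 - d (n, i)) < 1"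
      using order_tendstoD(2)[OF quad1, of 1] by (simp add: dw_def d_def)
    then show ?thesis
    proof eventually_elim
      case (elim n)
      have "(\<Sum>i<N n. s (n, i) * s (n, i)) = (\<Sum>i<N n. ((dw (n, i))\<^sup>2 - d (n, i)) + 2 * \<bar>d (n, i)\<bar>)"
        using dnn by (intro sum.cong) (auto simp: ss less_imp_le)
      then show ?case using elim sum_d[of n] by (simp add: sum.distrib flip: sum_distrib_left)
    qed
  qed
  have "((\<lambda>(n, k). \<Sum>i<k. f (n, i)) \<longlongrightarrow> 0) (cells (\<lambda>n. Suc (N n)))"
    by (rule sum_cells_null[OF f_o _ bound]) (simp add: s0)
  from tendsto_cells_Suc(3)[OF this] have f_sum: "(\<lambda>n. \<Sum>i<N n. f (n, i)) \<longlonglongrightarrow> 0" by simp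
  have "(\<lambda>n. (\<Sum>i<N n. f (n, i)) - (\<Sum>i<N n. p (n, i) * z (n, i) * G (n, i) * ((dw (n, i))\<^sup>2 - d (n, i))) +
      \<sigma> * (\<Sum>i<N n. e (n, i) * z (n, i) * dw (n, i))) \<longlonglongrightarrow> 0 - 0 + \<sigma> * 0"
    unfolding dw_def d_def by (intro tendsto_intros f_sum quad mart)
  moreover have "(\<Sum>i<N n. f (n, i)) - (\<Sum>i<N n. p (n, i) * z (n, i) * G (n, i) * ((dw (n, i))\<^sup>2 - d (n, i))) +
      \<sigma> * (\<Sum>i<N n. e (n, i) * z (n, i) * dw (n, i)) = p (n, N n) * z (n, N n) - x" for n
  proof -
    have "q n 0 = 0" using g[of n] by (simp add: grid_def)
    moreover have "y 0 = 0" using y[of 0] w0 \<open>T > 0\<close> by simp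
    ultimately have "p (n, 0) * z (n, 0) = x" by (simp add: p z)
    moreover have "(\<Sum>i<N n. p (n, Suc i) * z (n, Suc i) - p (n, i) * z (n, i)) =
        p (n, N n) * z (n, N n) - p (n, 0) * z (n, 0)"
      by (rule sum_lessThan_telescope)
    ultimately show ?thesis
      unfolding incr by (simp add: sum.distrib sum_subtractf sum_distrib_left)
  qed
  ultimately have "(\<lambda>n. p (n, N n) * z (n, N n) - x) \<longlonglongrightarrow> 0" by simp
  then have lim1: "(\<lambda>n. p (n, N n) * z (n, N n)) \<longlonglongrightarrow> x" by (simp add: LIM_zero_iff)
  have qT: "q n (N n) = T" for n using g[of n] by (simp add: grid_def)
  have "(\<lambda>n. p (n, N n) - P T) \<longlonglongrightarrow> 0"
    using tendsto_cells_Suc(3)[OF pP] by (simp add: qT)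
  then have limp: "(\<lambda>n. p (n, N n)) \<longlonglongrightarrow> P T" by (simp add: LIM_zero_iff)
  have "(\<lambda>n. exp (- (a * (y T)\<^sup>2 + (\<Sum>i<N n. cell_left q b (n, i) * cell_len q (n, i)))))
      \<longlonglongrightarrow> exp (- (a * (y T)\<^sup>2 + integral {0..T} b))"
    by (intro tendsto_intros riemann_sum_limit[OF grids cont(5) \<open>T > 0\<close>])
  then have "(\<lambda>n. z (n, N n)) \<longlonglongrightarrow> exp (- (a * (y T)\<^sup>2 + integral {0..T} b))"
    by (simp add: z qT cell_left_def)
  from tendsto_mult[OF limp this] show ?thesis using lim1 by (rule LIMSEQ_unique)
qed

section \<open>Identification of the returns and of the portfolio\<close>

text \<open>Subsequences are extracted one after another; a further extraction preserves the limits
  already obtained.\<close>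

lemma (in filtered_prob_space) martingale_diff_sums_null:
  fixes e Y :: "'c \<Rightarrow> nat \<times> nat \<Rightarrow> 'w \<Rightarrow> real"
  assumes "finite I" and grids: "fine_grids T N q"
    and e: "\<And>c n i. c \<in> I \<Longrightarrow> i < N n \<Longrightarrow> e c (n, i) \<in> borel_measurable (F (q n i))"
    and Y: "\<And>c n i. c \<in> I \<Longrightarrow> i < N n \<Longrightarrow> Y c (n, i) \<in> borel_measurable (F (q n (Suc i)))"
    and md: "\<And>c n i. c \<in> I \<Longrightarrow> i < N n \<Longrightarrow> martingale_diff M (F (q n i)) (Y c (n, i)) (v c (n, i))"
    and v: "\<And>c n i. c \<in> I \<Longrightarrow> i < N n \<Longrightarrow> v c (n, i) \<le> K * cell_len q (n, i)"
    and null: "\<And>c. c \<in> I \<Longrightarrow> AE \<omega> in M. ((\<lambda>p. e c p \<omega>) \<longlongrightarrow> 0) (cells N)"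
  shows "\<exists>r. strict_mono r \<and>
    (AE \<omega> in M. \<forall>c\<in>I. (\<lambda>n. \<Sum>i<N (r n). e c (r n, i) \<omega> * Y c (r n, i) \<omega>) \<longlonglongrightarrow> 0)"
  using assms(1) e Y md v null
proof (induction I rule: finite_induct)
  case empty
  show ?case by (intro exI[of _ "\<lambda>n. n"]) (auto simp: strict_mono_def)
next
  case (insert c I)
  have "\<exists>r. strict_mono r \<and>
    (AE \<omega> in M. \<forall>c\<in>I. (\<lambda>n. \<Sum>i<N (r n). e c (r n, i) \<omega> * Y c (r n, i) \<omega>) \<longlonglongrightarrow> 0)"
    by (rule insert.IH) (use insert.prems in auto)
  then obtain r where r: "strict_mono r"
    "AE \<omega> in M. \<forall>c\<in>I. (\<lambda>n. \<Sum>i<N (r n). e c (r n, i) \<omega> * Y c (r n, i) \<omega>) \<longlonglongrightarrow> 0"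
    by blast
  let ?s = "\<lambda>f. \<lambda>p :: nat \<times> nat. f (r (fst p), snd p)"
  have "\<exists>r'. strict_mono r' \<and> (AE \<omega> in M. (\<lambda>n. \<Sum>i<N (r (r' n)). ?s (e c) (r' n, i) \<omega> * ?s (Y c) (r' n, i) \<omega>) \<longlonglongrightarrow> 0)"
  proof (rule martingale_diff_sum_null[OF fine_grids_subseq[OF grids r(1)], where v = "?s (v c)"])
    show "AE \<omega> in M. ((\<lambda>p. ?s (e c) p \<omega>) \<longlongrightarrow> 0) (cells (\<lambda>n. N (r n)))"
      using insert.prems(5)[of c, simplified]
    proof eventually_elim
      case (elim \<omega>)
      from tendsto_cells_subseq[OF this r(1)] show ?case by (simp add: case_prod_unfold)
    qed
    show "?s (v c) (n, i) \<le> K * cell_len (\<lambda>n. q (r n)) (n, i)" if "i < N (r n)" for n i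
      using insert.prems(4)[of c i "r n"] that by (simp add: cell_incr_def)
  qed (use insert.prems(1-3)[of c] in auto)
  then obtain r' where r': "strict_mono r'"
    "AE \<omega> in M. (\<lambda>n. \<Sum>i<N (r (r' n)). e c (r (r' n), i) \<omega> * Y c (r (r' n), i) \<omega>) \<longlonglongrightarrow> 0"
    by auto
  have "AE \<omega> in M. \<forall>c'\<in>insert c I. (\<lambda>n. \<Sum>i<N ((r \<circ> r') n). e c' ((r \<circ> r') n, i) \<omega> * Y c' ((r \<circ> r') n, i) \<omega>) \<longlonglongrightarrow> 0"
    using r(2) r'(2)
  proof eventually_elim
    case (elim \<omega>)
    show ?case
    proof
      fix c' assume "c' \<in> insert c I"
      then consider "c' = c" | "c' \<in> I" by blast
      then show "(\<lambda>n. \<Sum>i<N ((r \<circ> r') n). e c' ((r \<circ> r') n, i) \<omega> * Y c' ((r \<circ> r') n, i) \<omega>) \<longlonglongrightarrow> 0"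
      proof cases
        case 1 then show ?thesis using elim(2) by simp
      next
        case 2
        then have "(\<lambda>n. \<Sum>i<N (r n). e c' (r n, i) \<omega> * Y c' (r n, i) \<omega>) \<longlonglongrightarrow> 0" using elim(1) by blast
        from LIMSEQ_subseq_LIMSEQ[OF this r'(1)] show ?thesis by (simp add: o_def)
      qed
    qed
  qed
  moreover have "strict_mono (r \<circ> r')" using r(1) r'(1) by (rule strict_mono_o)
  ultimately show ?case by blast
qed

text \<open>Integrals are given as limits only, so even their vanishing at time 0 has to be
  inherited from the simple integrals. It fixes the initial value of the price.\<close>

lemma (in filtered_prob_space) stoch_integral_at_0:
  assumes "has_stoch_integral M F H X J"
  shows "AE \<omega> in M. J 0 \<omega> = 0"
proof -
  have "\<exists>A. A \<in> sets M \<and> measure M A < (1 / 2) ^ n \<and> (\<forall>\<omega>\<in>space M - A. \<bar>J 0 \<omega>\<bar> \<le> (1 / 2) ^ n)" for n :: nat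
  proof -
    have pos: "(1 / 2 :: real) ^ n > 0" by simp
    obtain k t \<xi> A where A: "simple_coeffs M F k t \<xi>" "A \<in> sets M" "measure M A < (1 / 2) ^ n"
      "\<And>\<omega> s. \<omega> \<in> space M - A \<Longrightarrow> s \<in> {0..0} \<Longrightarrow> \<bar>simple_integral k t \<xi> X s \<omega> - J s \<omega>\<bar> \<le> (1 / 2) ^ n"
      by (rule has_stoch_integral_simple[OF assms order_refl pos pos finite_measure_axioms]) blast
    have "\<bar>J 0 \<omega>\<bar> \<le> (1 / 2) ^ n" if "\<omega> \<in> space M - A" for \<omega>
      using A(4)[OF that, of 0] simple_integral_0[OF A(1)] by simp
    then show ?thesis using A by blast
  qed
  then obtain A where A: "\<And>n. A n \<in> sets M" "\<And>n. measure M (A n) < (1 / 2) ^ n"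
    "\<And>n \<omega>. \<omega> \<in> space M - A n \<Longrightarrow> \<bar>J 0 \<omega>\<bar> \<le> (1 / 2) ^ n"
    by metis
  have "summable (\<lambda>n. measure M (A n))"
    by (rule summable_comparison_test'[OF summable_geometric[of "1 / 2 :: real"], of 0])
       (use A(2) in \<open>auto intro: less_imp_le\<close>)
  then have "AE \<omega> in M. \<forall>\<^sub>F n in sequentially. \<omega> \<in> space M - A n"
    using A(1) by (intro borel_cantelli_AE1) (auto simp: less_top[symmetric])
  then show ?thesis
  proof eventually_elim
    case (elim \<omega>)
    have "\<forall>\<^sub>F n in sequentially. \<bar>J 0 \<omega>\<bar> \<le> (1 / 2) ^ n"
      using elim by (rule eventually_mono) (rule A(3))
    moreover have "(\<lambda>n. (1 / 2 :: real) ^ n) \<longlonglongrightarrow> 0" by (rule LIMSEQ_realpow_zero) auto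
    ultimately have "\<bar>J 0 \<omega>\<bar> \<le> 0"
      by (intro tendsto_le[OF sequentially_bot _ tendsto_const]) auto
    then show ?case by simp
  qed
qed

section \<open>Passage from fixed times to whole paths\<close>

lemma continuous_eq_on_nonneg:
  fixes f g :: "real \<Rightarrow> real"
  assumes "continuous_on {0..} f" "continuous_on {0..} g"
    and "\<And>t. t > 0 \<Longrightarrow> t \<in> \<rat> \<Longrightarrow> f t = g t" and "t \<ge> 0"
  shows "f t = g t"
proof -
  define h where "h u = f u - g u" for u
  have h: "continuous_on {0..} h" unfolding h_def[abs_def] by (intro continuous_intros assms)
  have "h t = 0"
  proof (rule ccontr)
    assume "h t \<noteq> 0"
    then obtain d where d: "d > 0" "\<And>u. u \<in> {0..} \<Longrightarrow> dist u t < d \<Longrightarrow> dist (h u) (h t) < \<bar>h t\<bar>"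
      using h[unfolded continuous_on_iff, rule_format, of t "\<bar>h t\<bar>"] assms(4) by auto
    obtain u where u: "u \<in> \<rat>" "t < u" "u < t + d"
      using Rats_dense_in_real[of t "t + d"] d(1) by auto
    have "dist (h u) (h t) < \<bar>h t\<bar>" using d(2)[of u] u assms(4) by (auto simp: dist_real_def)
    moreover have "h u = 0" using assms(3)[of u] u assms(4) by (simp add: h_def)
    ultimately show False by (simp add: dist_real_def)
  qed
  then show ?thesis by (simp add: h_def)
qed

text \<open>Equality at the countably many positive rational times holds off one null set and
  extends by continuity. Time 0 is reached as a limit, since the partitions need an interval of
  positive length.\<close>

lemma AE_eq_all_times:
  fixes f g :: "real \<Rightarrow> 'w \<Rightarrow> real"
  assumes "AE \<omega> in M. continuous_on {0..} (\<lambda>t. f t \<omega>) \<and> continuous_on {0..} (\<lambda>t. g t \<omega>)"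
    and "\<And>t. t > 0 \<Longrightarrow> AE \<omega> in M. f t \<omega> = g t \<omega>"
  shows "AE \<omega> in M. \<forall>t\<ge>0. f t \<omega> = g t \<omega>"
proof -
  have "AE \<omega> in M. \<forall>t\<in>\<rat> \<inter> {0<..}. f t \<omega> = g t \<omega>"
    by (subst AE_ball_countable) (use countable_rat assms(2) in \<open>auto intro: countable_subset[of _ "\<rat>"]\<close>)
  with assms(1) show ?thesis
  proof eventually_elim
    case (elim \<omega>)
    show ?case
      using continuous_eq_on_nonneg[OF elim(1)[THEN conjunct1] elim(1)[THEN conjunct2]] elim(2) by auto
  qed
qed

text \<open>Continuity at \<open>t\<close> is local and is taken from the compact interval
  \<open>{0..t + 1}\<close>.\<close>

lemma continuous_on_integral_nonneg:
  fixes f :: "real \<Rightarrow> real"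
  assumes "continuous_on {0..} f"
  shows "continuous_on {0..} (\<lambda>t. integral {0..t} f)"
proof (rule continuous_on_eq_continuous_within[THEN iffD2], intro ballI)
  fix t :: real assume t: "t \<in> {0..}"
  have "continuous_on {0..t + 1} (\<lambda>t. integral {0..t} f)"
    by (intro indefinite_integral_continuous_1 integrable_continuous_interval continuous_on_subset[OF assms]) auto
  then have "continuous (at t within {0..t + 1}) (\<lambda>t. integral {0..t} f)"
    using t by (auto simp: continuous_on_eq_continuous_within)
  moreover have "at t within {0..t + 1} = at t within {0..}"
    by (rule at_within_nhd[of t "{..<t + 1}"]) auto
  ultimately show "continuous (at t within {0..}) (\<lambda>t. integral {0..t} f)"
    by (simp add: continuous_within)
qed

text \<open>
  \<open>S (1 / S)\<close> takes the values 0 and 1 only, so the continuity of the integrand \<open>1 / S\<close> (with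
  \<open>1 / 0 = 0\<close>) keeps the price away from 0.
\<close>

lemma (in filtered_prob_space) price_nonzero:
  assumes "price_process M F W \<sigma> S0 \<mu> S" "S0 > 0" "continuous_adapted M F (\<lambda>t \<omega>. 1 / S t \<omega>)"
  shows "AE \<omega> in M. \<forall>t\<ge>0. S t \<omega> \<noteq> 0"
proof -
  obtain J where J: "has_stoch_integral M F S W J"
    "AE \<omega> in M. \<forall>t\<ge>0. S t \<omega> = S0 + (LBINT u:{0..t}. S u \<omega> * \<mu> u \<omega>) + \<sigma> * J t \<omega>"
    and S: "AE \<omega> in M. continuous_on {0..} (\<lambda>t. S t \<omega>)"
    using assms(1) unfolding price_process_def continuous_adapted_def by blast
  have "AE \<omega> in M. continuous_on {0..} (\<lambda>t. 1 / S t \<omega>)"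
    using assms(3) by (simp add: continuous_adapted_def)
  with J(2) S stoch_integral_at_0[OF J(1)] show ?thesis
  proof eventually_elim
    case (elim \<omega>)
    \<comment> \<open>The drift integral over a single point and \<open>J 0 \<omega>\<close> both
      vanish.\<close>
    have "S 0 \<omega> = S0"
      using elim(1,3) by (simp add: set_lebesgue_integral_def AE_lborel_singleton
          integral_eq_zero_AE[OF AE_mp[OF AE_lborel_singleton[of 0]]] indicator_def)
    let ?f = "\<lambda>t. S t \<omega> * (1 / S t \<omega>)"
    have "?f ` {0..} \<subseteq> {0, 1}" by auto
    then have fin: "finite (?f ` {0..})" by (rule finite_subset) simp
    have "?f constant_on {0..}"
      by (rule continuous_finite_range_constant[OF _ _ fin]) (intro continuous_on_mult elim | simp)+
    then have "?f t = ?f 0" if "t \<ge> 0" for t using that unfolding constant_on_def by (metis atLeast_iff order_refl)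
    moreover have "?f 0 = 1" using \<open>S 0 \<omega> = S0\<close> assms(2) by simp
    ultimately show ?case by (metis mult_zero_left zero_neq_one)
  qed
qed

text \<open>The deviation of the weights from 1 is treated separately on the two parts of the Euler
  step: against \<mu> dt it is summed pathwise, against \<sigma> dW it vanishes only through
  orthogonality and along a subsequence.\<close>

lemma (in filtered_prob_space) log_return_at:
  assumes "wiener_process_2 M F W W'" "price_process M F W \<sigma> S0 \<mu> S" "continuous_adapted M F \<mu>"
    "has_stoch_integral M F (\<lambda>t \<omega>. 1 / S t \<omega>) S R" "S0 > 0" "T > 0"
  shows "AE \<omega> in M. R T \<omega> = integral {0..T} (\<lambda>u. \<mu> u \<omega>) + \<sigma> * W T \<omega>"
proof -
  obtain N q \<zeta> where grids: "fine_grids T N q"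
    and meas: "\<And>n i. i < N n \<Longrightarrow> \<zeta> (n, i) \<in> borel_measurable (F (q n i))"
    and lim: "AE \<omega> in M. ((\<lambda>p. \<zeta> p \<omega> - cell_left q (\<lambda>u. 1 / S u \<omega> * S u \<omega>) p) \<longlongrightarrow> 0) (cells N) \<and>
       ((\<lambda>(n, k). (\<Sum>i<k. \<zeta> (n, i) \<omega> * euler_incr q \<sigma> (\<lambda>u. \<mu> u \<omega>) (\<lambda>u. W u \<omega>) (n, i)) - R (q n k) \<omega>)
          \<longlongrightarrow> 0) (cells (\<lambda>n. Suc (N n)))"
    using stoch_integral_euler[OF filtered_prob_space_axioms assms(4,3,2,6)] by blast
  note g = fine_grids_grid[OF grids]
  have adapted: "\<And>t. t \<ge> 0 \<Longrightarrow> W t \<in> borel_measurable (F t)"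
    and W0: "AE \<omega> in M. W 0 \<omega> = 0" 
    using assms(1) by (auto simp: wiener_process_2_def continuous_adapted_def)
  have q: "0 \<le> q n i" "q n i < q n (Suc i)" if "i < N n" for n i
    using grid_bounds(1)[OF g] grid_step(1)[OF g] that by auto
  have \<mu>: "AE \<omega> in M. continuous_on {0..} (\<lambda>t. \<mu> t \<omega>)"
    using assms(3) by (simp add: continuous_adapted_def)
  have nz: "AE \<omega> in M. \<forall>t\<ge>0. S t \<omega> \<noteq> 0"
    using price_nonzero[OF assms(2,5)] assms(4) by (simp add: has_stoch_integral_def)
  have \<zeta>1: "AE \<omega> in M. ((\<lambda>p. \<zeta> p \<omega> - 1) \<longlongrightarrow> 0) (cells N)"
    using lim nz
  proof eventually_elim
    case (elim \<omega>)
    show ?case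
    proof (rule Lim_transform_eventually[OF elim(1)[THEN conjunct1]])
      show "\<forall>\<^sub>F p in cells N. \<zeta> p \<omega> - cell_left q (\<lambda>u. 1 / S u \<omega> * S u \<omega>) p = \<zeta> p \<omega> - 1"
        unfolding eventually_cells using elim(2) q by (intro always_eventually) (auto simp: cell_left_def)
    qed
  qed
  have "\<exists>r. strict_mono r \<and>
    (AE \<omega> in M. (\<lambda>n. \<Sum>i<N (r n). (\<lambda>p \<omega>. \<zeta> p \<omega> - 1) (r n, i) \<omega> *
       (\<lambda>p \<omega>. cell_incr q (\<lambda>t. W t \<omega>) p) (r n, i) \<omega>) \<longlonglongrightarrow> 0)"
  proof (rule martingale_diff_sum_null[OF grids, where v = "cell_len q" and C = 1])
    show "(\<lambda>\<omega>. \<zeta> (n, i) \<omega> - 1) \<in> borel_measurable (F (q n i))" if "i < N n" for n i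
      using meas[OF that] by measurable
    show "(\<lambda>\<omega>. cell_incr q (\<lambda>t. W t \<omega>) (n, i)) \<in> borel_measurable (F (q n (Suc i)))" if "i < N n" for n i
      using measurable_F(1)[OF adapted, of "q n i" "q n (Suc i)"] adapted[of "q n (Suc i)"] q[OF that]
      by (simp add: cell_incr_def)
    show "martingale_diff M (F (q n i)) (\<lambda>\<omega>. cell_incr q (\<lambda>t. W t \<omega>) (n, i)) (cell_len q (n, i))"
      if "i < N n" for n i
      using wiener_increment_martingale_diff(1)[OF assms(1) q[OF that]] by (simp add: cell_incr_def)
  qed (use \<zeta>1 in auto)
  then obtain r where r: "strict_mono r"
    and mart: "AE \<omega> in M. (\<lambda>n. \<Sum>i<N (r n). (\<zeta> (r n, i) \<omega> - 1) * cell_incr q (\<lambda>t. W t \<omega>) (r n, i)) \<longlonglongrightarrow> 0"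
    by auto
  show ?thesis
    using lim \<zeta>1 mart W0 \<mu>
  proof eventually_elim
    case (elim \<omega>)
    let ?\<mu> = "\<lambda>u. \<mu> u \<omega>" and ?w = "\<lambda>u. W u \<omega>"
    have c\<mu>: "continuous_on {0..T} ?\<mu>" by (rule continuous_on_subset[OF elim(5)]) auto
    have qT: "q n (N n) = T" "q n 0 = 0" for n using g[of n] by (auto simp: grid_def)
    have "(\<lambda>n. (\<Sum>i<N n. \<zeta> (n, i) \<omega> * euler_incr q \<sigma> ?\<mu> ?w (n, i)) - R T \<omega>) \<longlonglongrightarrow> 0"
      using tendsto_cells_Suc(3)[OF elim(1)[THEN conjunct2]] by (simp add: qT)
    then have 1: "(\<lambda>n. \<Sum>i<N (r n). \<zeta> (r n, i) \<omega> * euler_incr q \<sigma> ?\<mu> ?w (r n, i)) \<longlonglongrightarrow> R T \<omega>"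
      using LIMSEQ_subseq_LIMSEQ[OF _ r] by (fastforce simp: LIM_zero_iff o_def)
    have "((\<lambda>p. (\<zeta> p \<omega> - 1) * cell_left q ?\<mu> p) \<longlongrightarrow> 0) (cells N)"
      by (rule null_mult_bigo_1[OF elim(2) cell_left_bounded[OF grids c\<mu>]])
    then have "(\<lambda>p. ((\<zeta> p \<omega> - 1) * cell_left q ?\<mu> p) * cell_len q p) \<in> o[cells N](\<lambda>p. 1 * cell_len q p)"
      unfolding tendsto_0_iff_smallo_1 by (rule landau_o.small_big_mult) simp
    then have "(\<lambda>p. ((\<zeta> p \<omega> - 1) * cell_left q ?\<mu> p) * cell_len q p) \<in> o[cells N](\<lambda>p. \<bar>cell_len q p\<bar>)" by simp
    then have "((\<lambda>(n, k). \<Sum>i<k. ((\<zeta> (n, i) \<omega> - 1) * cell_left q ?\<mu> (n, i)) * cell_len q (n, i)) \<longlongrightarrow> 0) (cells (\<lambda>n. Suc (N n)))"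
      by (rule sum_cells_null[where C = T]) (use sum_abs_cell_len[OF grids] in auto)
    from LIMSEQ_subseq_LIMSEQ[OF tendsto_cells_Suc(3)[OF this] r]
    have 2: "(\<lambda>n. \<Sum>i<N (r n). ((\<zeta> (r n, i) \<omega> - 1) * cell_left q ?\<mu> (r n, i)) * cell_len q (r n, i)) \<longlonglongrightarrow> 0"
      by (simp add: o_def)
    have "(\<lambda>n. \<Sum>i<N (r n). cell_left q ?\<mu> (r n, i) * cell_len q (r n, i)) \<longlonglongrightarrow> integral {0..T} ?\<mu>"
      using LIMSEQ_subseq_LIMSEQ[OF riemann_sum_limit[OF grids c\<mu> assms(6)] r] by (simp add: o_def)
    from tendsto_add[OF tendsto_add[OF 2 tendsto_mult[OF tendsto_const[of \<sigma>] elim(3)]] tendsto_add[OF this tendsto_const[of "\<sigma> * ?w T"]]]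
    have 3: "(\<lambda>n. (\<Sum>i<N (r n). ((\<zeta> (r n, i) \<omega> - 1) * cell_left q ?\<mu> (r n, i)) * cell_len q (r n, i)) +
        \<sigma> * (\<Sum>i<N (r n). (\<zeta> (r n, i) \<omega> - 1) * cell_incr q ?w (r n, i)) +
        ((\<Sum>i<N (r n). cell_left q ?\<mu> (r n, i) * cell_len q (r n, i)) + \<sigma> * ?w T)) \<longlonglongrightarrow> integral {0..T} ?\<mu> + \<sigma> * ?w T"
      by simp
    have "(\<Sum>i<N (r n). ((\<zeta> (r n, i) \<omega> - 1) * cell_left q ?\<mu> (r n, i)) * cell_len q (r n, i)) +
        \<sigma> * (\<Sum>i<N (r n). (\<zeta> (r n, i) \<omega> - 1) * cell_incr q ?w (r n, i)) +
        ((\<Sum>i<N (r n). cell_left q ?\<mu> (r n, i) * cell_len q (r n, i)) + \<sigma> * ?w T) =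
        (\<Sum>i<N (r n). \<zeta> (r n, i) \<omega> * euler_incr q \<sigma> ?\<mu> ?w (r n, i))" for n
    proof -
      have "(\<Sum>i<N (r n). cell_incr q ?w (r n, i)) = ?w (q (r n) (N (r n))) - ?w (q (r n) 0)"
        unfolding cell_incr_def prod.case by (rule sum_lessThan_telescope)
      then have "?w T = (\<Sum>i<N (r n). cell_incr q ?w (r n, i))" using elim(4) by (simp add: qT)
      then show ?thesis
        by (simp only: sum_distrib_left sum.distrib[symmetric])
           (simp add: euler_incr_def algebra_simps)
    qed
    with 3 have "(\<lambda>n. \<Sum>i<N (r n). \<zeta> (r n, i) \<omega> * euler_incr q \<sigma> ?\<mu> ?w (r n, i)) \<longlonglongrightarrow> integral {0..T} ?\<mu> + \<sigma> * ?w T"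
      by simp
    from LIMSEQ_unique[OF 1 this] show ?case .
  qed
qed

text \<open>\<open>discrete_ito\<close> applies to almost every path once its three random sums are
  known to vanish along a common subsequence; the probabilistic work here is to arrange
  this.\<close>

lemma (in filtered_prob_space) portfolio_at:
  assumes W: "wiener_process_2 M F W W'" and S: "price_process M F W \<sigma> S0 \<mu> S"
    and \<mu>: "continuous_adapted M F \<mu>" and mt: "continuous_adapted M F mt"
    and P: "portfolio_process M F m \<sigma> x S mt P"
    and mt_eq: "AE \<omega> in M. \<forall>t\<ge>0. mt t \<omega> = - (1 / \<tau>) * integral {0..t} (\<lambda>u. mt u \<omega>) +
      (1 / \<tau>) * (integral {0..t} (\<lambda>u. \<mu> u \<omega>) + \<sigma> * W t \<omega>)"
    and S_nz: "AE \<omega> in M. \<forall>t\<ge>0. S t \<omega> \<noteq> 0"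
    and pos: "\<sigma> > 0" "\<tau> > 0" "m > 0" "T > 0"
  shows "AE \<omega> in M. P T \<omega> * exp (- (m * \<tau> / (2 * \<sigma>\<^sup>2) * (mt T \<omega>)\<^sup>2 +
    integral {0..T} (\<lambda>u. m * ((mt u \<omega>)\<^sup>2 / \<sigma>\<^sup>2 * (1 - m / 2) - 1 / (2 * \<tau>))))) = x"
proof -
  define c where "c = m / \<sigma>\<^sup>2"
  define a where "a = m * \<tau> / (2 * \<sigma>\<^sup>2)"
  \<comment> \<open>The quadratic variation part of the drift:
    \<open>a * \<sigma>\<^sup>2 / \<tau>\<^sup>2\<close> comes from squaring the moving average, the
    rest from taking the logarithm of the portfolio.\<close>
  define G where "G v = a * \<sigma>\<^sup>2 / \<tau>\<^sup>2 + c\<^sup>2 * \<sigma>\<^sup>2 * v\<^sup>2 / 2" for v :: real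
  define b where "b v = m * (v\<^sup>2 / \<sigma>\<^sup>2 * (1 - m / 2) - 1 / (2 * \<tau>))" for v :: real
  have ac: "2 * a = c * \<tau>" and a0: "a \<ge> 0" using pos by (auto simp: a_def c_def)
  have b_eq: "b v = c * v\<^sup>2 - G v" for v
    using pos by (simp add: b_def G_def a_def c_def field_simps power2_eq_square)
  obtain J where J: "has_stoch_integral M F (\<lambda>t \<omega>. P t \<omega> * (m * (mt t \<omega> / \<sigma>\<^sup>2)) * (1 / S t \<omega>)) S J"
    and PJ: "AE \<omega> in M. \<forall>t\<ge>0. P t \<omega> = x + J t \<omega>" and cP: "AE \<omega> in M. continuous_on {0..} (\<lambda>t. P t \<omega>)"
    using P unfolding portfolio_process_def continuous_adapted_def by blast
  obtain N q \<zeta> where grids: "fine_grids T N q"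
    and \<zeta>: "\<And>n i. i < N n \<Longrightarrow> \<zeta> (n, i) \<in> borel_measurable (F (q n i))"
    and lim: "AE \<omega> in M.
       ((\<lambda>p. \<zeta> p \<omega> - cell_left q (\<lambda>u. P u \<omega> * (m * (mt u \<omega> / \<sigma>\<^sup>2)) * (1 / S u \<omega>) * S u \<omega>) p) \<longlongrightarrow> 0) (cells N) \<and>
       ((\<lambda>(n, k). (\<Sum>i<k. \<zeta> (n, i) \<omega> * euler_incr q \<sigma> (\<lambda>u. \<mu> u \<omega>) (\<lambda>u. W u \<omega>) (n, i)) - J (q n k) \<omega>)
          \<longlongrightarrow> 0) (cells (\<lambda>n. Suc (N n)))"
    using stoch_integral_euler[OF filtered_prob_space_axioms J \<mu> S pos(4)] by blast
  note g = fine_grids_grid[OF grids]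
  have q: "0 \<le> q n i" "q n i < q n (Suc i)" if "i < N n" for n i
    using grid_bounds(1)[OF g] grid_step(1)[OF g] that by auto
  have adapted: "W t \<in> borel_measurable (F t)" "\<mu> t \<in> borel_measurable (F t)" "mt t \<in> borel_measurable (F t)"
    if "t \<ge> 0" for t
    using W \<mu> mt that by (auto simp: wiener_process_2_def continuous_adapted_def)
  have conts: "AE \<omega> in M. continuous_on {0..} (\<lambda>t. W t \<omega>)" "AE \<omega> in M. continuous_on {0..} (\<lambda>t. \<mu> t \<omega>)"
    "AE \<omega> in M. continuous_on {0..} (\<lambda>t. mt t \<omega>)" and W0: "AE \<omega> in M. W 0 \<omega> = 0"
    using W \<mu> mt by (auto simp: wiener_process_2_def continuous_adapted_def)
  \<comment> \<open>Sums instead of path integrals: as \<open>F\<close> need not be complete and continuity is only almost sure,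
    the integrals need not be adapted.\<close>
  define p where "p t \<omega> = x + (\<Sum>i<snd t. \<zeta> (fst t, i) \<omega> * euler_incr q \<sigma> (\<lambda>u. \<mu> u \<omega>) (\<lambda>u. W u \<omega>) (fst t, i))"
    for t :: "nat \<times> nat" and \<omega>
  define z where "z t \<omega> = exp (- (a * (mt (q (fst t) (snd t)) \<omega>)\<^sup>2 +
      (\<Sum>i<snd t. b (mt (q (fst t) i) \<omega>) * cell_len q (fst t, i))))" for t :: "nat \<times> nat" and \<omega>
  \<comment> \<open>Measured against the Euler value \<open>p\<close> instead of \<open>P\<close>,
    which makes the decomposition of the increments of \<open>p\<close> exact.\<close>
  define e where "e t \<omega> = \<zeta> t \<omega> - c * mt (q (fst t) (snd t)) \<omega> * p t \<omega>" for t :: "nat \<times> nat" and \<omega>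
  define Gt where "Gt t \<omega> = G (mt (q (fst t) (snd t)) \<omega>)" for t :: "nat \<times> nat" and \<omega>
  define dW where "dW t \<omega> = cell_incr q (\<lambda>u. W u \<omega>) t" for t \<omega>
  have meas: "p (n, k) \<in> borel_measurable (F (q n k)) \<and> z (n, k) \<in> borel_measurable (F (q n k))"
    if k: "k \<le> N n" for n k
  proof
    have le: "q n i \<le> q n k" "0 \<le> q n i" if "i \<le> k" for i
      using grid_mono[OF g that k] grid_bounds(1)[OF g, of i n] that k by auto
    have [measurable]: "W (q n i) \<in> borel_measurable (F (q n k))" "\<mu> (q n i) \<in> borel_measurable (F (q n k))"
      "mt (q n i) \<in> borel_measurable (F (q n k))" if "i \<le> k" for i
      using measurable_F(1)[OF adapted(1)] measurable_F(1)[OF adapted(2)] measurable_F(1)[OF adapted(3)]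
        le[OF that] by blast+
    have "(\<lambda>\<omega>. \<zeta> (n, i) \<omega> * euler_incr q \<sigma> (\<lambda>u. \<mu> u \<omega>) (\<lambda>u. W u \<omega>) (n, i)) \<in> borel_measurable (F (q n k))"
      if i: "i < k" for i
    proof -
      have [measurable]: "\<zeta> (n, i) \<in> borel_measurable (F (q n k))"
        using measurable_F(1)[OF \<zeta>[of i n] le(1)] i k by auto
      have [simp]: "i \<le> k" "Suc i \<le> k" using i by auto
      show ?thesis unfolding euler_incr_def cell_left_def cell_incr_def prod.case by measurable
    qed
    then show "p (n, k) \<in> borel_measurable (F (q n k))"
      unfolding p_def[abs_def] fst_conv snd_conv
      by (intro borel_measurable_add borel_measurable_const borel_measurable_sum) auto
    have "(\<lambda>\<omega>. b (mt (q n i) \<omega>) * cell_len q (n, i)) \<in> borel_measurable (F (q n k))" if "i \<le> k" for i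
      using that unfolding b_def by measurable
    then have [measurable]: "(\<lambda>\<omega>. \<Sum>i<k. b (mt (q n i) \<omega>) * cell_len q (n, i)) \<in> borel_measurable (F (q n k))"
      by (intro borel_measurable_sum) auto
    have [simp]: "k \<le> k" by simp
    show "z (n, k) \<in> borel_measurable (F (q n k))"
      unfolding z_def[abs_def] fst_conv snd_conv by measurable
  qed
  have e_meas: "e (n, i) \<in> borel_measurable (F (q n i))" if i: "i < N n" for n i
  proof -
    have [measurable]: "p (n, i) \<in> borel_measurable (F (q n i))" "\<zeta> (n, i) \<in> borel_measurable (F (q n i))"
      "mt (q n i) \<in> borel_measurable (F (q n i))"
      using meas[of i n] \<zeta>[OF i] adapted(3)[OF q(1)[OF i]] i by auto
    show ?thesis unfolding e_def[abs_def] fst_conv snd_conv by measurable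
  qed
  have pP: "AE \<omega> in M. ((\<lambda>(n, k). p (n, k) \<omega> - P (q n k) \<omega>) \<longlongrightarrow> 0) (cells (\<lambda>n. Suc (N n)))"
    using lim PJ
  proof eventually_elim
    case (elim \<omega>)
    show ?case
    proof (rule Lim_transform_eventually[OF elim(1)[THEN conjunct2]], unfold eventually_cells,
        intro always_eventually allI impI)
      fix n k assume "k < Suc (N n)"
      then have "q n k \<ge> 0" using grid_bounds(1)[OF g] by simp
      then show "(case (n, k) of (n, k) \<Rightarrow>
            (\<Sum>i<k. \<zeta> (n, i) \<omega> * euler_incr q \<sigma> (\<lambda>u. \<mu> u \<omega>) (\<lambda>u. W u \<omega>) (n, i)) - J (q n k) \<omega>) =
          (case (n, k) of (n, k) \<Rightarrow> p (n, k) \<omega> - P (q n k) \<omega>)"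
        using elim(2) by (simp add: p_def)
    qed
  qed
  have bounds: "AE \<omega> in M. ((\<lambda>t. e t \<omega>) \<longlongrightarrow> 0) (cells N) \<and> (\<lambda>t. p t \<omega>) \<in> O[cells N](\<lambda>_. 1) \<and>
      (\<lambda>t. z t \<omega>) \<in> O[cells N](\<lambda>_. 1) \<and> (\<lambda>t. Gt t \<omega>) \<in> O[cells N](\<lambda>_. 1)"
    using lim pP S_nz conts(3) cP
  proof eventually_elim
    case (elim \<omega>)
    have cont: "continuous_on {0..T} (\<lambda>t. mt t \<omega>)" "continuous_on {0..T} (\<lambda>t. P t \<omega>)"
      by (rule continuous_on_subset[OF elim(4)], simp, rule continuous_on_subset[OF elim(5)], simp)
    have p0: "((\<lambda>t. p t \<omega> - cell_left q (\<lambda>u. P u \<omega>) t) \<longlongrightarrow> 0) (cells N)"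
      using tendsto_cells_Suc(1)[OF elim(2)] by (simp add: cell_left_def case_prod_unfold)
    have pO: "(\<lambda>t. p t \<omega>) \<in> O[cells N](\<lambda>_. 1)"
      using sum_in_bigo(1)[OF tendsto_imp_bigo_1[OF p0] cell_left_bounded[OF grids cont(2)]] by simp
    have zO: "(\<lambda>t. z t \<omega>) \<in> O[cells N](\<lambda>_. 1)"
      by (rule exp_minus_sum_bounded[OF grids _ a0, where y = "\<lambda>t. mt t \<omega>" and b = "\<lambda>t. b (mt t \<omega>)"])
         (use pos in \<open>auto simp: z_def b_def intro!: continuous_intros cont\<close>)
    have "cell_left q (\<lambda>u. G (mt u \<omega>)) \<in> O[cells N](\<lambda>_. 1)"
      unfolding G_def by (intro cell_left_bounded[OF grids] continuous_intros cont) (use pos in auto)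
    then have GO: "(\<lambda>t. Gt t \<omega>) \<in> O[cells N](\<lambda>_. 1)"
      by (simp add: Gt_def cell_left_def case_prod_unfold)
    have \<zeta>0: "((\<lambda>t. \<zeta> t \<omega> - cell_left q (\<lambda>u. c * mt u \<omega>) t * cell_left q (\<lambda>u. P u \<omega>) t) \<longlongrightarrow> 0) (cells N)"
    proof (rule Lim_transform_eventually[OF elim(1)[THEN conjunct1]], unfold eventually_cells,
        intro always_eventually allI impI)
      fix n i assume "i < N n"
      \<comment> \<open>Needed to cancel the price against the factor \<open>1 / S\<close> of the
        integrand, which would give 0 at a zero of \<open>S\<close>.\<close>
      then have "S (q n i) \<omega> \<noteq> 0" using q elim(3) by auto
      then show "\<zeta> (n, i) \<omega> - cell_left q (\<lambda>u. P u \<omega> * (m * (mt u \<omega> / \<sigma>\<^sup>2)) * (1 / S u \<omega>) * S u \<omega>) (n, i) =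
          \<zeta> (n, i) \<omega> - cell_left q (\<lambda>u. c * mt u \<omega>) (n, i) * cell_left q (\<lambda>u. P u \<omega>) (n, i)"
        by (simp add: cell_left_def c_def)
    qed
    have "((\<lambda>t. cell_left q (\<lambda>u. c * mt u \<omega>) t * (p t \<omega> - cell_left q (\<lambda>u. P u \<omega>) t)) \<longlongrightarrow> 0) (cells N)"
      by (intro null_mult_bigo_1(2)[OF p0] cell_left_bounded[OF grids] continuous_intros cont)
    from tendsto_diff[OF \<zeta>0 this] have "((\<lambda>t. e t \<omega>) \<longlongrightarrow> 0) (cells N)"
      by (simp add: e_def cell_left_def case_prod_unfold algebra_simps)
    with pO zO GO show ?case by simp
  qed
  \<comment> \<open>With mesh \<open>4\<^sup>-\<^sup>n\<close>, the factor \<open>2\<^sup>n\<close> can be moved from the weights, which become null, to the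
    compensated squares, whose second moment stays of the order of the cell length.\<close>
  define E where "E k t \<omega> = (if k = 0 then e t \<omega> * z t \<omega> else if k = 1 then (1 / 2) ^ fst t
      else (1 / 2) ^ fst t * (p t \<omega> * z t \<omega> * Gt t \<omega>))" for k :: nat and t \<omega>
  define Y where "Y k t \<omega> = (if k = 0 then dW t \<omega> else 2 ^ fst t * ((dW t \<omega>)\<^sup>2 - cell_len q t))"
    for k :: nat and t \<omega>
  define V where "V k t = (if k = 0 then cell_len q t else 2 * (2 ^ fst t * cell_len q t)\<^sup>2)" for k :: nat and t
  \<comment> \<open>Index 0 stands for the Brownian remainder, 1 for the quadratic variation and 2
    for its weighted version.\<close>
  have "\<exists>r. strict_mono r \<and>
    (AE \<omega> in M. \<forall>k\<in>{0, 1, 2}. (\<lambda>n. \<Sum>i<N (r n). E k (r n, i) \<omega> * Y k (r n, i) \<omega>) \<longlonglongrightarrow> 0)"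
  proof (rule martingale_diff_sums_null[OF _ grids, where v = V and K = 2])
    fix k n i assume i: "i < N n"
    have [measurable]: "p (n, i) \<in> borel_measurable (F (q n i))" "z (n, i) \<in> borel_measurable (F (q n i))"
      "mt (q n i) \<in> borel_measurable (F (q n i))" "e (n, i) \<in> borel_measurable (F (q n i))"
      using meas[of i n] adapted(3)[OF q(1)[OF i]] e_meas[OF i] i by auto
    show "E k (n, i) \<in> borel_measurable (F (q n i))"
      unfolding E_def[abs_def] Gt_def G_def fst_conv snd_conv by measurable
    have [measurable]: "W (q n i) \<in> borel_measurable (F (q n (Suc i)))" "W (q n (Suc i)) \<in> borel_measurable (F (q n (Suc i)))"
      using measurable_F(1)[OF adapted(1)[OF q(1)[OF i]]] adapted(1)[of "q n (Suc i)"] q[OF i] by auto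
    show "Y k (n, i) \<in> borel_measurable (F (q n (Suc i)))"
      unfolding Y_def[abs_def] dW_def cell_incr_def prod.case by measurable
    show "martingale_diff M (F (q n i)) (Y k (n, i)) (V k (n, i))"
      using wiener_increment_martingale_diff(1)[OF W q[OF i]]
        wiener_increment_martingale_diff(2)[OF W q[OF i], of "2 ^ n"]
      by (simp add: Y_def[abs_def] V_def dW_def cell_incr_def)
    have len: "0 < cell_len q (n, i)" "cell_len q (n, i) \<le> (1 / 4) ^ n"
      using grid_step[OF g i] by (auto simp: cell_incr_def)
    \<comment> \<open>The rate of the mesh enters here: \<open>4 ^ n * cell_len q (n, i)\<close> is
      at most 1.\<close>
    have "(2 ^ n * cell_len q (n, i))\<^sup>2 = (4 ^ n * cell_len q (n, i)) * cell_len q (n, i)"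
      by (simp add: power2_eq_square mult_ac power_mult_distrib[symmetric])
    also have "\<dots> \<le> 1 * cell_len q (n, i)"
    proof (rule mult_right_mono)
      have "4 ^ n * cell_len q (n, i) \<le> 4 ^ n * (1 / 4) ^ n" using len by (intro mult_left_mono) auto
      then show "4 ^ n * cell_len q (n, i) \<le> 1" by (simp add: power_mult_distrib[symmetric])
    qed (use len in simp)
    finally show "V k (n, i) \<le> 2 * cell_len q (n, i)" using len by (simp add: V_def)
  next
    fix k
    show "AE \<omega> in M. ((\<lambda>t. E k t \<omega>) \<longlongrightarrow> 0) (cells N)"
      using bounds
    proof eventually_elim
      case (elim \<omega>)
      have "(\<lambda>t. p t \<omega> * z t \<omega> * Gt t \<omega>) \<in> O[cells N](\<lambda>_. 1 * 1 * 1)"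
        using elim by (intro landau_o.big_mult) auto
      then have "((\<lambda>t. (1 / 2) ^ fst t * (p t \<omega> * z t \<omega> * Gt t \<omega>)) \<longlongrightarrow> 0) (cells N)"
        by (intro null_mult_bigo_1(1)[OF pow_half_cells]) simp
      moreover have "((\<lambda>t. e t \<omega> * z t \<omega>) \<longlongrightarrow> 0) (cells N)"
        using elim by (intro null_mult_bigo_1(1)) auto
      ultimately show ?case
        unfolding E_def using pow_half_cells[of N] by (cases "k = 0"; cases "k = 1") simp_all
    qed
  qed auto
  then obtain r where r: "strict_mono r"
    and sums: "AE \<omega> in M. \<forall>k\<in>{0, 1, 2}. (\<lambda>n. \<Sum>i<N (r n). E k (r n, i) \<omega> * Y k (r n, i) \<omega>) \<longlonglongrightarrow> 0"
    by blast
  have cancel: "(1 / 2) ^ n * A * (2 ^ n * B) = A * B" for n and A B :: real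
    by (simp add: power_divide)
  have cancel1: "(1 / 2) ^ n * (2 ^ n * B) = B" for n and B :: real
    by (simp add: power_divide)
  show ?thesis
    using sums bounds pP mt_eq conts cP W0
  proof eventually_elim
    case (elim \<omega>)
    have sub: "{0..T} \<subseteq> {0..}" by auto
    have cont: "continuous_on {0..T} (\<lambda>t. W t \<omega>)" "continuous_on {0..T} (\<lambda>t. \<mu> t \<omega>)"
      "continuous_on {0..T} (\<lambda>t. mt t \<omega>)" "continuous_on {0..T} (\<lambda>t. P t \<omega>)"
      "continuous_on {0..T} (\<lambda>t. b (mt t \<omega>))"
      unfolding b_def
      by (intro continuous_intros continuous_on_subset[OF elim(5) sub] continuous_on_subset[OF elim(6) sub]
          continuous_on_subset[OF elim(7) sub] continuous_on_subset[OF elim(8) sub]; use pos in simp)+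
    let ?r = "\<lambda>f. \<lambda>t :: nat \<times> nat. f (r (fst t), snd t) \<omega>"
    have "P T \<omega> * exp (- (a * (mt T \<omega>)\<^sup>2 + integral {0..T} (\<lambda>u. b (mt u \<omega>)))) = x"
    proof (rule discrete_ito[OF fine_grids_subseq[OF grids r] pos(4,2) a0 cont, where \<sigma> = \<sigma> and c = c
          and \<zeta> = "?r \<zeta>" and p = "?r p" and z = "?r z" and e = "?r e" and G = "?r Gt"])
      show "((\<lambda>(n, k). ?r p (n, k) - P (q (r n) k) \<omega>) \<longlongrightarrow> 0) (cells (\<lambda>n. Suc (N (r n))))"
        using tendsto_cells_subseq[OF elim(3) r] by simp
      show "(?r e \<longlongrightarrow> 0) (cells (\<lambda>n. N (r n)))"
        using tendsto_cells_subseq[OF elim(2)[THEN conjunct1] r] by (simp add: case_prod_unfold)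
      have incr: "cell_incr (\<lambda>n. q (r n)) f (n, i) = cell_incr q f (r n, i)" for f :: "real \<Rightarrow> real" and n i
        by (simp add: cell_incr_def)
      have "(\<lambda>n. \<Sum>i<N (r n). E 1 (r n, i) \<omega> * Y 1 (r n, i) \<omega>) \<longlonglongrightarrow> 0" using elim(1) by simp
      then show "(\<lambda>n. \<Sum>i<N (r n). (cell_incr (\<lambda>n. q (r n)) (\<lambda>t. W t \<omega>) (n, i))\<^sup>2 -
          cell_len (\<lambda>n. q (r n)) (n, i)) \<longlonglongrightarrow> 0"
        by (simp add: E_def Y_def incr dW_def cancel1)
      have "(\<lambda>n. \<Sum>i<N (r n). E 2 (r n, i) \<omega> * Y 2 (r n, i) \<omega>) \<longlonglongrightarrow> 0" using elim(1) by simp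
      then show "(\<lambda>n. \<Sum>i<N (r n). ?r p (n, i) * ?r z (n, i) * ?r Gt (n, i) *
          ((cell_incr (\<lambda>n. q (r n)) (\<lambda>t. W t \<omega>) (n, i))\<^sup>2 - cell_len (\<lambda>n. q (r n)) (n, i))) \<longlonglongrightarrow> 0"
        by (simp add: E_def Y_def incr dW_def cancel)
      have "(\<lambda>n. \<Sum>i<N (r n). E 0 (r n, i) \<omega> * Y 0 (r n, i) \<omega>) \<longlonglongrightarrow> 0" using elim(1) by simp
      then show "(\<lambda>n. \<Sum>i<N (r n). ?r e (n, i) * ?r z (n, i) * cell_incr (\<lambda>n. q (r n)) (\<lambda>t. W t \<omega>) (n, i)) \<longlonglongrightarrow> 0"
        by (simp add: E_def Y_def incr dW_def)
      show "mt t \<omega> = - (1 / \<tau>) * integral {0..t} (\<lambda>t. mt t \<omega>) +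
          1 / \<tau> * (integral {0..t} (\<lambda>t. \<mu> t \<omega>) + \<sigma> * W t \<omega>)" if "t \<in> {0..T}" for t
        using elim(4) that by simp
      show "?r p (n, k) = x + (\<Sum>i<k. ?r \<zeta> (n, i) * euler_incr (\<lambda>n. q (r n)) \<sigma> (\<lambda>t. \<mu> t \<omega>) (\<lambda>t. W t \<omega>) (n, i))" for n k
        by (simp add: p_def euler_incr_def cell_left_def cell_incr_def)
      show "?r z (n, k) = exp (- (a * (mt (q (r n) k) \<omega>)\<^sup>2 +
          (\<Sum>i<k. b (mt (q (r n) i) \<omega>) * cell_len (\<lambda>n. q (r n)) (n, i))))" for n k
        by (simp add: z_def incr)
    qed (use ac elim(9) in \<open>simp_all add: b_eq G_def e_def Gt_def\<close>)
    then show ?case by (simp add: a_def b_def)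
  qed
qed

section \<open>The logarithm of the portfolio\<close>

theorem proposition4:
  fixes M :: "'w measure" and F :: "real \<Rightarrow> 'w measure"
    and W_S W_\<mu> S \<mu> mt P :: "real \<Rightarrow> 'w \<Rightarrow> real"
    and lam \<sigma>_\<mu> \<sigma>_S \<tau> m x S0 :: real
  assumes "lam > 0" "\<sigma>_\<mu> > 0" "\<sigma>_S > 0" "\<tau> > 0" "m > 0" "x > 0" "S0 > 0"
    and "filtered_prob_space M F"
    and "wiener_process_2 M F W_S W_\<mu>"
    and "trend_process M F W_\<mu> lam \<sigma>_\<mu> \<mu>"
    and "price_process M F W_S \<sigma>_S S0 \<mu> S"
    and "ema_process M F \<tau> S mt"
    and "portfolio_process M F m \<sigma>_S x S mt P"
  shows "AE \<omega> in M.
     (\<forall>t\<ge>0. P t \<omega> > 0) \<and>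
     (\<forall>s t. 0 \<le> s \<and> s \<le> t \<longrightarrow>
        ln (P t \<omega>) - ln (P s \<omega>) =
          m * \<tau> / (2 * \<sigma>_S\<^sup>2) * ((mt t \<omega>)\<^sup>2 - (mt s \<omega>)\<^sup>2) +
          (LBINT u:{s..t}. m * ((mt u \<omega>)\<^sup>2 / \<sigma>_S\<^sup>2 * (1 - m / 2) - 1 / (2 * \<tau>))))"
proof -
  interpret filtered_prob_space M F by fact
  note W = assms(9) and S = assms(11)
  have \<mu>: "continuous_adapted M F \<mu>" using assms(10) by (simp add: trend_process_def)
  obtain R where mt: "continuous_adapted M F mt"
    and R: "has_stoch_integral M F (\<lambda>t \<omega>. 1 / S t \<omega>) S R"
    and mtR: "AE \<omega> in M. \<forall>t\<ge>0. mt t \<omega> = - (1 / \<tau>) * (LBINT u:{0..t}. mt u \<omega>) + (1 / \<tau>) * R t \<omega>"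
    using assms(12) unfolding ema_process_def by blast
  have conts: "AE \<omega> in M. continuous_on {0..} (\<lambda>t. mt t \<omega>)" "AE \<omega> in M. continuous_on {0..} (\<lambda>t. \<mu> t \<omega>)"
    "AE \<omega> in M. continuous_on {0..} (\<lambda>t. W_S t \<omega>)" "AE \<omega> in M. continuous_on {0..} (\<lambda>t. P t \<omega>)"
    using mt \<mu> W assms(13)
    by (auto simp: wiener_process_2_def continuous_adapted_def portfolio_process_def)
  have nz: "AE \<omega> in M. \<forall>t\<ge>0. S t \<omega> \<noteq> 0"
    using price_nonzero[OF S assms(7)] R by (simp add: has_stoch_integral_def)
  \<comment> \<open>\<open>R\<close> carries no continuity assumption of its own, so it is
    eliminated at fixed times before passing to all times.\<close>
  have mt_eq: "AE \<omega> in M. \<forall>t\<ge>0. mt t \<omega> = - (1 / \<tau>) * integral {0..t} (\<lambda>u. mt u \<omega>) +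
      (1 / \<tau>) * (integral {0..t} (\<lambda>u. \<mu> u \<omega>) + \<sigma>_S * W_S t \<omega>)"
  proof (rule AE_eq_all_times)
    show "AE \<omega> in M. continuous_on {0..} (\<lambda>t. mt t \<omega>) \<and>
      continuous_on {0..} (\<lambda>t. - (1 / \<tau>) * integral {0..t} (\<lambda>u. mt u \<omega>) +
        (1 / \<tau>) * (integral {0..t} (\<lambda>u. \<mu> u \<omega>) + \<sigma>_S * W_S t \<omega>))"
      using conts(1-3)
      by eventually_elim (use assms(4) in \<open>auto intro!: continuous_intros continuous_on_integral_nonneg\<close>)
    fix t :: real assume t: "t > 0"
    show "AE \<omega> in M. mt t \<omega> = - (1 / \<tau>) * integral {0..t} (\<lambda>u. mt u \<omega>) +
      (1 / \<tau>) * (integral {0..t} (\<lambda>u. \<mu> u \<omega>) + \<sigma>_S * W_S t \<omega>)"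
      using mtR conts(1) log_return_at[OF W S \<mu> R assms(7) t]
    proof eventually_elim
      case (elim \<omega>)
      then show ?case using t lborel_integral_eq[OF elim(2), of 0 t] by simp
    qed
  qed
  let ?a = "m * \<tau> / (2 * \<sigma>_S\<^sup>2)"
  let ?b = "\<lambda>\<omega> u. m * ((mt u \<omega>)\<^sup>2 / \<sigma>_S\<^sup>2 * (1 - m / 2) - 1 / (2 * \<tau>))"
  let ?L = "\<lambda>t \<omega>. ?a * (mt t \<omega>)\<^sup>2 + integral {0..t} (?b \<omega>)"
  have cb: "continuous_on {0..} (?b \<omega>)" if "continuous_on {0..} (\<lambda>t. mt t \<omega>)" for \<omega>
    using assms(3,4) by (intro continuous_intros that) auto
  have "AE \<omega> in M. \<forall>t\<ge>0. P t \<omega> * exp (- ?L t \<omega>) = x"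
  proof (rule AE_eq_all_times)
    show "AE \<omega> in M. continuous_on {0..} (\<lambda>t. P t \<omega> * exp (- ?L t \<omega>)) \<and> continuous_on {0..} (\<lambda>t. x)"
      using conts(1,4)
      by eventually_elim (intro conjI continuous_intros continuous_on_integral_nonneg cb)
    show "AE \<omega> in M. P t \<omega> * exp (- ?L t \<omega>) = x" if "t > 0" for t
      by (rule portfolio_at[OF W S \<mu> mt assms(13) mt_eq nz assms(3,4,5) that])
  qed
  with conts(1) show ?thesis
  proof eventually_elim
    case (elim \<omega>)
    \<comment> \<open>This representation comes before any logarithm; the positivity of
      \<open>P\<close> is read off from it.\<close>
    have P: "P t \<omega> = x * exp (?L t \<omega>)" if "t \<ge> 0" for t
    proof -
      have "A = A * exp (- l) * exp l" for A l :: real by (simp add: exp_minus)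
      from this[of "P t \<omega>" "?L t \<omega>"] show ?thesis
        unfolding elim(2)[rule_format, OF that] .
    qed
    have lnP: "ln (P t \<omega>) = ln x + ?L t \<omega>" if "t \<ge> 0" for t
      unfolding P[OF that] using assms(6) by (simp add: ln_mult)
    have I: "integral {0..s} (?b \<omega>) + integral {s..t} (?b \<omega>) = integral {0..t} (?b \<omega>)"
      if "0 \<le> s" "s \<le> t" for s t
      by (intro Henstock_Kurzweil_Integration.integral_combine that integrable_continuous_interval
          continuous_on_subset[OF cb[OF elim(1)]]) auto
    have B: "(LBINT u:{s..t}. ?b \<omega> u) = integral {s..t} (?b \<omega>)" if "0 \<le> s" for s t
      by (rule lborel_integral_eq[OF cb[OF elim(1)] that])
    have "ln (P t \<omega>) - ln (P s \<omega>) = ?a * ((mt t \<omega>)\<^sup>2 - (mt s \<omega>)\<^sup>2) + (LBINT u:{s..t}. ?b \<omega> u)"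
      if "0 \<le> s" "s \<le> t" for s t
      using lnP[OF that(1)] lnP[OF order_trans[OF that]] I[OF that]
      unfolding B[OF that(1)] right_diff_distrib[of ?a "(mt t \<omega>)\<^sup>2"] by linarith
    moreover have "P t \<omega> > 0" if "t \<ge> 0" for t unfolding P[OF that] using assms(6) by simp
    ultimately show ?case by blast
  qed
qed

end
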